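(* Let $p$ be a prime, let $A_n\in\operatorname{M}_n(\mathbb{Z}_p)$ be a Haar random matrix for each $n\ge1$, let $y_1,\dots,y_m$ be distinct elements of $\mathbb{Z}_p$, and let $H_1,\dots,H_m$ be finite abelian $p$-groups. Then the limit $$\lim_{n\to\infty}\mathbb{P}\big(\operatorname{cok}(A_n+y_iI_n)\cong H_i \text{ for } 1\le i\le m\big)$$ exists.
   Context: $\mathbb{Z}_p$ is the ring of $p$-adic integers; a Haar random matrix in $\operatorname{M}_n(\mathbb{Z}_p)$ is one distributed according to the (normalized) Haar measure on the additive group $\operatorname{M}_n(\mathbb{Z}_p)$, i.e. its entries are independent and Haar distributed on $\mathbb{Z}_p$. $\operatorname{cok}(B)=\mathbb{Z}_p^n/B\mathbb{Z}_p^n$ and $I_n$ is the $n\times n$ identity matrix. *)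

theory Defs
  imports
    "HOL-Probability.Probability"
    "Berlekamp_Zassenhaus.Finite_Field"
    "Jordan_Normal_Form.Matrix"
begin

text \<open>
  The ring of \<open>p\<close>-adic integers as the inverse limit of the rings \<open>\<int>/p\<^sup>k\<int>\<close>: the \<open>k\<close>-th entry of
  a sequence is the canonical representative of the residue class modulo \<open>p\<^sup>k\<close>.
  The prime is \<open>p = CARD('p)\<close>; class \<open>prime_card\<close> says precisely that this number is prime.
\<close>

typedef ('p :: prime_card) padic_int =
  "{x :: nat \<Rightarrow> int. \<forall>k. x k \<in> {0..<int CARD('p) ^ k} \<and>
      x (Suc k) mod int CARD('p) ^ k = x k}"
  morphisms residue Abs_padic_int
proof -
  have "int CARD('p) > 0"
    using prime_card_int[where 'a = 'p] prime_gt_0_int by blast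
  then show ?thesis by (intro exI[of _ "\<lambda>_. 0"]) auto
qed

setup_lifting type_definition_padic_int

lemma CARD_prime_card_pos: "int CARD('p :: prime_card) ^ k > 0"
  using prime_card_int[where 'a = 'p] prime_gt_0_int zero_less_power by blast

lemma mod_CARD_power_mem:
  "a mod int CARD('p :: prime_card) ^ k \<in> {0..<int CARD('p) ^ k}"
  using CARD_prime_card_pos[where 'p = 'p and k = k] by simp

lemma mod_power_Suc_mod: "(a :: int) mod q ^ Suc k mod q ^ k = a mod q ^ k"
  by (rule mod_mod_cancel) (simp add: le_imp_power_dvd)

instantiation padic_int :: (prime_card) comm_ring_1
begin

lift_definition zero_padic_int :: "'a padic_int" is "\<lambda>_. 0"
  using CARD_prime_card_pos by auto

lift_definition one_padic_int :: "'a padic_int" is "\<lambda>k. 1 mod int CARD('a) ^ k"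
  by (simp only: mod_power_Suc_mod mod_CARD_power_mem simp_thms)

lift_definition plus_padic_int :: "'a padic_int \<Rightarrow> 'a padic_int \<Rightarrow> 'a padic_int"
  is "\<lambda>x y k. (x k + y k) mod int CARD('a) ^ k"
proof -
  fix x y :: "nat \<Rightarrow> int" and k
  assume xy: "\<And>k. x k \<in> {0..<int CARD('a) ^ k} \<and> x (Suc k) mod int CARD('a) ^ k = x k"
    "\<And>k. y k \<in> {0..<int CARD('a) ^ k} \<and> y (Suc k) mod int CARD('a) ^ k = y k"
  show "(x k + y k) mod int CARD('a) ^ k \<in> {0..<int CARD('a) ^ k} \<and>
     (x (Suc k) + y (Suc k)) mod int CARD('a) ^ Suc k mod int CARD('a) ^ k =
     (x k + y k) mod int CARD('a) ^ k"
    unfolding mod_power_Suc_mod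
    by (intro conjI mod_CARD_power_mem mod_add_cong) (metis xy mod_mod_trivial)+
qed

lift_definition uminus_padic_int :: "'a padic_int \<Rightarrow> 'a padic_int"
  is "\<lambda>x k. (- x k) mod int CARD('a) ^ k"
proof -
  fix x :: "nat \<Rightarrow> int" and k
  assume x: "\<And>k. x k \<in> {0..<int CARD('a) ^ k} \<and> x (Suc k) mod int CARD('a) ^ k = x k"
  show "(- x k) mod int CARD('a) ^ k \<in> {0..<int CARD('a) ^ k} \<and>
     (- x (Suc k)) mod int CARD('a) ^ Suc k mod int CARD('a) ^ k =
     (- x k) mod int CARD('a) ^ k"
    unfolding mod_power_Suc_mod
    by (intro conjI mod_CARD_power_mem mod_minus_cong) (metis x mod_mod_trivial)+
qed

lift_definition times_padic_int :: "'a padic_int \<Rightarrow> 'a padic_int \<Rightarrow> 'a padic_int"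
  is "\<lambda>x y k. (x k * y k) mod int CARD('a) ^ k"
proof -
  fix x y :: "nat \<Rightarrow> int" and k
  assume xy: "\<And>k. x k \<in> {0..<int CARD('a) ^ k} \<and> x (Suc k) mod int CARD('a) ^ k = x k"
    "\<And>k. y k \<in> {0..<int CARD('a) ^ k} \<and> y (Suc k) mod int CARD('a) ^ k = y k"
  show "(x k * y k) mod int CARD('a) ^ k \<in> {0..<int CARD('a) ^ k} \<and>
     (x (Suc k) * y (Suc k)) mod int CARD('a) ^ Suc k mod int CARD('a) ^ k =
     (x k * y k) mod int CARD('a) ^ k"
    unfolding mod_power_Suc_mod
    by (intro conjI mod_CARD_power_mem mod_mult_cong) (metis xy mod_mod_trivial)+
qed

definition minus_padic_int :: "'a padic_int \<Rightarrow> 'a padic_int \<Rightarrow> 'a padic_int"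
  where "minus_padic_int x y = x + (- y)"

instance
proof
  fix a b c :: "'a padic_int"
  show "a * b * c = a * (b * c)"
    by transfer (simp add: mod_simps mult.assoc)
  show "a * b = b * a"
    by transfer (simp add: mult.commute)
  show "1 * a = a"
    by transfer (auto simp: mod_simps fun_eq_iff)
  show "a + b + c = a + (b + c)"
    by transfer (simp add: mod_simps add.assoc)
  show "a + b = b + a"
    by transfer (simp add: add.commute)
  show "0 + a = a"
    by transfer (auto simp: fun_eq_iff)
  show "- a + a = 0"
    by transfer (simp add: mod_simps)
  show "a - b = a + - b"
    by (simp add: minus_padic_int_def)
  show "(a + b) * c = a * c + b * c"
    by transfer (simp add: mod_simps algebra_simps)
  have "int CARD('a) > 1"
    using prime_card_int[where 'a = 'a] prime_gt_1_int by blast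
  then have "1 mod int CARD('a) ^ 1 \<noteq> 0" by simp
  then show "(0 :: 'a padic_int) \<noteq> 1"
    by transfer metis
qed

end

text \<open>The profinite topology, induced by the product topology of the discrete space \<open>int\<close>.\<close>

instantiation padic_int :: (prime_card) topological_space
begin

definition open_padic_int :: "'a padic_int set \<Rightarrow> bool"
  where "open_padic_int U \<longleftrightarrow> (\<exists>V. open V \<and> U = residue -` V)"

instance
proof
  show "open (UNIV :: 'a padic_int set)"
    unfolding open_padic_int_def by (intro exI[of _ UNIV]) auto
  fix S T :: "'a padic_int set"
  assume "open S" "open T"
  then show "open (S \<inter> T)"
    unfolding open_padic_int_def by (metis open_Int vimage_Int)
next
  fix K :: "'a padic_int set set"
  assume "\<forall>S\<in>K. open S"
  then obtain V where V: "\<And>S. S \<in> K \<Longrightarrow> open (V S)" "\<And>S. S \<in> K \<Longrightarrow> S = residue -` V S"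
    unfolding open_padic_int_def by metis
  have "open (\<Union>S\<in>K. V S)"
    using V(1) by (intro open_UN ballI)
  moreover have "\<Union> K = residue -` (\<Union>S\<in>K. V S)"
    using V(2) by auto
  ultimately show "open (\<Union> K)"
    unfolding open_padic_int_def by (intro exI conjI)
qed

end

text \<open>
  The Borel sets of the space of \<open>n \<times> n\<close> matrices with the topology of entrywise convergence.
  For entries in a second countable space, such as \<^typ>\<open>'p padic_int\<close>, that \<open>\<sigma>\<close>-algebra is
  generated by the entries.
\<close>

definition borel_mat :: "nat \<Rightarrow> 'a :: topological_space mat measure" where
  "borel_mat n = sigma (carrier_mat n n)
     {{B \<in> carrier_mat n n. B $$ (i, j) \<in> U} | i j U. i < n \<and> j < n \<and> open U}"

definition haar_mat :: "nat \<Rightarrow> 'p :: prime_card padic_int mat measure \<Rightarrow> bool" where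
  "haar_mat n \<mu> \<longleftrightarrow> prob_space \<mu> \<and> sets \<mu> = sets (borel_mat n) \<and>
     (\<forall>B \<in> carrier_mat n n. \<forall>S \<in> sets \<mu>. emeasure \<mu> ((\<lambda>X. B + X) ` S) = emeasure \<mu> S)"

definition haar_random_matrix ::
  "'w measure \<Rightarrow> nat \<Rightarrow> ('w \<Rightarrow> 'p :: prime_card padic_int mat) \<Rightarrow> bool" where
  "haar_random_matrix M n A \<longleftrightarrow>
     prob_space M \<and> A \<in> measurable M (borel_mat n) \<and> haar_mat n (distr M (borel_mat n) A)"

definition cok :: "'a :: comm_ring_1 mat \<Rightarrow> 'a Matrix.vec set monoid" where
  "cok B = monoid_vec TYPE('a) (dim_row B) Mod ((\<lambda>v. B *\<^sub>v v) ` carrier_vec (dim_col B))"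

definition finite_abelian_p_group :: "nat \<Rightarrow> ('g, 'b) monoid_scheme \<Rightarrow> bool" where
  "finite_abelian_p_group p G \<longleftrightarrow>
     comm_group G \<and> finite (carrier G) \<and> (\<exists>k. Coset.order G = p ^ k)"

end

theory Submission
  imports Defs "HOL-Algebra.Multiplicative_Group" "HOL-Computational_Algebra.Formal_Power_Series"
begin

text \<open>
  If \<open>p\<^sup>L\<^sup>-\<^sup>1\<close> kills all the \<open>H\<^sub>i\<close>, the event only depends on \<open>A\<^sub>n\<close> modulo \<open>p\<^sup>L\<close>, so its probability is the
  proportion of the endomorphisms \<open>f\<close> of \<open>V\<^sub>n = (\<int>/p\<^sup>L)\<^sup>n\<close> such that \<open>f + y\<^sub>i\<close> has cokernel \<open>H\<^sub>i\<close> for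
  all \<open>i\<close>. For a residue class \<open>t\<close> modulo \<open>p\<close>, Fitting's lemma splits \<open>V\<^sub>n\<close> canonically into a part
  where \<open>f + t\<close> is nilpotent and a part where it is bijective; both are free, hence of the form
  \<open>V\<^sub>s\<close> and \<open>V\<^sub>n\<^sub>-\<^sub>s\<close>. The cokernel conditions at the \<open>y\<^sub>i\<close> in the class \<open>t\<close> only concern the first part and
  all the others only the second one. Weighting endomorphisms of \<open>V\<^sub>n\<close> by \<open>1 / |Aut V\<^sub>n|\<close> turns this
  into a convolution: the generating function of the event is \<open>U = (\<Prod>\<^sub>t A\<^sub>t) G\<close>, where \<open>t\<close> runs over
  the \<open>k\<close> residue classes of the \<open>y\<^sub>i\<close> and \<open>G\<close> counts the endomorphisms with all \<open>f + t\<close> invertible.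

  With no cokernel conditions the same argument gives \<open>\<Phi> = F\<^sup>k G\<close>, where \<open>\<Phi> = \<Sum>\<^sub>n u\<^sup>n / c\<^sub>n\<close> with
  \<open>c\<^sub>n = \<Prod>\<^sub>i\<^sub>\<le>\<^sub>n (1 - p\<^sup>-\<^sup>i)\<close>, and the case of a single class shows \<open>F = (1 - u) \<Phi>\<close>. Hence
  \<open>(1 - u) U = (\<Prod>\<^sub>t A\<^sub>t) F (1 / F)\<^sup>k\<close>. The coefficients of \<open>A\<^sub>t\<close> lie between \<open>0\<close> and those of \<open>F\<close>, and \<open>F\<close>
  and \<open>1 / F\<close> have absolutely summable coefficients. So the coefficients of \<open>U\<close>, being the partial
  sums of an absolutely convergent series, converge.
\<close>

section \<open>Power series with absolutely summable coefficients\<close>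

text \<open>By Euler's identity Phi is the product of 1 / (1 - u / p^i) over i >= 0, so F is the
  product over i >= 1 alone: the factor 1 - u removes the pole at u = 1. What remains converges for
  |u| < p, and 1 / F is entire; hence both have absolutely summable coefficients.

  The weights 1 / |Aut V_n| come from orbit counting: V_n has |Aut V_n| / (|Aut V_s| |Aut V_(n-s)|)
  decompositions into free summands of ranks s and n - s. For one class without conditions, G has
  all coefficients 1, because f -> f + t maps the endomorphisms with f + t invertible onto Aut V_n;
  this gives F = (1 - u) Phi.

  The exponent L - 1 instead of L leaves one spare factor p for lifting: if p^(L-1) kills the
  cokernel modulo p^L, then that is already the whole cokernel over the p-adic integers. Fitting
  summands come without a basis, so freeness is expressed by the condition
  \<open>homocyclic\<close>, which passes to direct summands.\<close>

definition abs_summable_fps :: "real fps \<Rightarrow> bool" where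
  "abs_summable_fps f \<longleftrightarrow> summable (\<lambda>n. \<bar>fps_nth f n\<bar>)"

lemma abs_summable_fps_1: "abs_summable_fps 1"
  unfolding abs_summable_fps_def by (rule summable_finite[of "{0}"]) auto

lemma abs_summable_fps_mult:
  assumes "abs_summable_fps f" "abs_summable_fps g"
  shows "abs_summable_fps (f * g)"
proof -
  have "summable (\<lambda>k. \<Sum>i\<le>k. \<bar>fps_nth f i\<bar> * \<bar>fps_nth g (k - i)\<bar>)"
    using assms unfolding abs_summable_fps_def by (intro summable_Cauchy_product) auto
  then show ?thesis
    unfolding abs_summable_fps_def
  proof (rule summable_comparison_test')
    fix n :: nat
    show "norm \<bar>fps_nth (f * g) n\<bar> \<le> (\<Sum>i\<le>n. \<bar>fps_nth f i\<bar> * \<bar>fps_nth g (n - i)\<bar>)"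
      by (simp add: fps_mult_nth atLeast0AtMost abs_mult[symmetric])
  qed
qed

lemma abs_summable_fps_prod:
  "(\<And>j. j \<in> J \<Longrightarrow> abs_summable_fps (A j)) \<Longrightarrow> abs_summable_fps (\<Prod>j\<in>J. A j)"
  by (induction J rule: infinite_finite_induct) (auto intro: abs_summable_fps_1 abs_summable_fps_mult)

lemma abs_summable_fps_power: "abs_summable_fps f \<Longrightarrow> abs_summable_fps (f ^ k)"
  by (induction k) (auto intro: abs_summable_fps_1 abs_summable_fps_mult)

lemma convergent_nth_of_abs_summable:
  assumes "abs_summable_fps ((1 - fps_X) * U)"
  shows "convergent (fps_nth U)"
proof -
  let ?g = "(1 - fps_X) * U"
  have "fps_nth U n = (\<Sum>i\<le>n. fps_nth ?g i)" for n
  proof (induction n)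
    case 0 then show ?case by (simp add: algebra_simps)
  next
    case (Suc n)
    have "fps_nth ?g (Suc n) = fps_nth U (Suc n) - fps_nth U n" by (simp add: algebra_simps)
    then show ?case using Suc by simp
  qed
  moreover have "summable (\<lambda>n. fps_nth ?g n)"
    using assms unfolding abs_summable_fps_def by (rule summable_rabs_cancel)
  ultimately show ?thesis
    by (metis (no_types, lifting) convergentI ext summable_LIMSEQ')
qed

text \<open>The proportion of \<open>GL\<^sub>n\<close> in \<open>M\<^sub>n\<close> over \<open>\<int>/p\<^sup>L\<close>; it does not depend on \<open>L \<ge> 1\<close>.\<close>

definition gl_density :: "real \<Rightarrow> nat \<Rightarrow> real" where
  "gl_density p n = (\<Prod>i\<in>{1..n}. 1 - (1 / p) ^ i)"

text \<open>The series Phi: its coefficients are |End V_n| / |Aut V_n|, see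
  \<open>mass_True\<close>.\<close>

definition mat_fps :: "real \<Rightarrow> real fps" where
  "mat_fps p = Abs_fps (\<lambda>n. 1 / gl_density p n)"

text \<open>The series f (c u); the substitution is used with c = 1 / p.\<close>

definition fps_dilate :: "real \<Rightarrow> real fps \<Rightarrow> real fps" where
  "fps_dilate c f = Abs_fps (\<lambda>n. c ^ n * fps_nth f n)"

lemma fps_dilate_mult: "fps_dilate c (f * g) = fps_dilate c f * fps_dilate c g"
  by (rule fps_ext)
     (auto simp: fps_dilate_def fps_mult_nth sum_distrib_left power_add[symmetric] intro!: sum.cong)

lemma nth_mult_linear:
  fixes f :: "real fps"
  shows "fps_nth (f * (1 - fps_const c * fps_X)) (Suc k) = fps_nth f (Suc k) - c * fps_nth f k"
proof -
  have "f * (1 - fps_const c * fps_X) = f - fps_X * (fps_const c * f)"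
    by (simp only: right_diff_distrib mult_1_right mult.commute[of f] mult.assoc mult.left_commute)
  then show ?thesis by simp
qed

section \<open>Euler's product for the nilpotent masses, and its inverse\<close>

context
  fixes p :: real
  assumes p: "p > 1"
begin

lemma one_minus_power_pos: "n > 0 \<Longrightarrow> 1 - (1 / p) ^ n > 0"
  using p by (simp add: power_less_one_iff divide_simps)

lemma gl_density_Suc: "gl_density p (Suc n) = gl_density p n * (1 - (1 / p) ^ Suc n)"
  by (simp add: gl_density_def)

lemma gl_density_0: "gl_density p 0 = 1"
  by (simp add: gl_density_def)

lemma gl_density_pos: "gl_density p n > 0"
  unfolding gl_density_def by (intro prod_pos) (use one_minus_power_pos in auto)

text \<open>Needed to pass from masses, weighted by 1 / |Aut V_n|, to proportions among all
  endomorphisms.\<close>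

lemma convergent_gl_density: "convergent (gl_density p)"
proof -
  have "gl_density p (Suc n) \<le> gl_density p n" for n
    using gl_density_pos[of n] p unfolding gl_density_Suc by (simp add: mult_left_le)
  then have "decseq (gl_density p)" by (simp add: decseq_Suc_iff)
  moreover have "0 \<le> gl_density p n" for n using gl_density_pos[of n] by simp
  ultimately show ?thesis using decseq_convergent[of "gl_density p" 0] convergentI by metis
qed

text \<open>These numbers will be the masses of the nilpotent endomorphisms of V_n
  (\<open>mass_nilpotent\<close>); for L = 1 they are p^(n^2 - n) / |GL_n| over the field with p
  elements. They arise as differences of consecutive coefficients of \<open>mat_fps\<close>.\<close>

lemma nth_nilpotent_fps: "fps_nth ((1 - fps_X) * mat_fps p) n = (1 / p) ^ n / gl_density p n"
proof (cases n)
  case 0 then show ?thesis by (simp add: algebra_simps mat_fps_def gl_density_0)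
next
  case (Suc k)
  have "fps_nth ((1 - fps_X) * mat_fps p) n = 1 / gl_density p (Suc k) - 1 / gl_density p k"
    by (simp add: Suc algebra_simps mat_fps_def)
  also have "1 / gl_density p k = (1 - (1 / p) ^ Suc k) / gl_density p (Suc k)"
    using gl_density_pos[of k] one_minus_power_pos[of "Suc k"] unfolding gl_density_Suc
    by (simp add: divide_simps)
  finally show ?thesis by (simp add: Suc diff_divide_distrib)
qed

text \<open>Coefficients of h(u), the product of 1 - u / p^i over i >= 1. The recursion is read off
  from h(u) = (1 - u / p) h(u / p).\<close>

fun inv_nilp_coeff :: "nat \<Rightarrow> real" where
  "inv_nilp_coeff 0 = 1"
| "inv_nilp_coeff (Suc n) = - inv_nilp_coeff n * (1 / p) ^ Suc n / (1 - (1 / p) ^ Suc n)"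

text \<open>The absolute ratio of consecutive coefficients tends to 0, so it is eventually below
  1/2.\<close>

lemma abs_summable_inv_nilp: "abs_summable_fps (Abs_fps inv_nilp_coeff)"
proof -
  have lim: "(\<lambda>n. (1 / p) ^ Suc n / (1 - (1 / p) ^ Suc n)) \<longlonglongrightarrow> 0 / (1 - 0)"
    using p by (intro tendsto_intros LIMSEQ_Suc[OF LIMSEQ_realpow_zero]) auto
  then have "eventually (\<lambda>n. (1 / p) ^ Suc n / (1 - (1 / p) ^ Suc n) < 1 / 2) sequentially"
    by (rule order_tendstoD) simp
  then obtain N where N: "\<And>n. n \<ge> N \<Longrightarrow> (1 / p) ^ Suc n / (1 - (1 / p) ^ Suc n) < 1 / 2"
    unfolding eventually_sequentially by blast
  have "summable inv_nilp_coeff'" if "inv_nilp_coeff' = (\<lambda>n. \<bar>inv_nilp_coeff n\<bar>)" for inv_nilp_coeff'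
  proof (rule summable_ratio_test[where c = "1/2" and N = N])
    fix n assume "n \<ge> N"
    then have "(1 / p) ^ Suc n / (1 - (1 / p) ^ Suc n) \<le> 1 / 2" using N by force
    moreover have "0 \<le> (1 / p) ^ Suc n / (1 - (1 / p) ^ Suc n)"
      using one_minus_power_pos[of "Suc n"] p by (intro divide_nonneg_pos) auto
    moreover have "\<bar>inv_nilp_coeff (Suc n)\<bar> =
        \<bar>inv_nilp_coeff n\<bar> * \<bar>(1 / p) ^ Suc n / (1 - (1 / p) ^ Suc n)\<bar>"
      by (simp add: abs_mult)
    ultimately have "\<bar>inv_nilp_coeff (Suc n)\<bar> \<le> \<bar>inv_nilp_coeff n\<bar> * (1/2)"
      by (metis abs_ge_zero abs_of_nonneg mult_left_mono)
    then show "norm (inv_nilp_coeff' (Suc n)) \<le> 1/2 * norm (inv_nilp_coeff' n)"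
      by (simp add: that)
  qed simp
  then show ?thesis unfolding abs_summable_fps_def by simp
qed

text \<open>Both series satisfy a functional equation under \<open>u \<mapsto> u / p\<close>, and the two equations say that their
  product is invariant under this dilation, hence constant.\<close>

lemma nilpotent_fps_mult_inverse: "(1 - fps_X) * mat_fps p * Abs_fps inv_nilp_coeff = 1"
proof -
  let ?F = "(1 - fps_X) * mat_fps p" and ?h = "Abs_fps inv_nilp_coeff"
  let ?D = "fps_dilate (1 / p)" and ?l = "1 - fps_const (1 / p) * fps_X"
  have "?D ?F = ?F * ?l"
  proof (rule fps_ext)
    fix n
    show "fps_nth (?D ?F) n = fps_nth (?F * ?l) n"
    proof (cases n)
      case 0 then show ?thesis by (simp add: fps_dilate_def)
    next
      case (Suc k)
      have "fps_nth (?F * ?l) n = fps_nth ?F (Suc k) - 1 / p * fps_nth ?F k"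
        unfolding Suc by (rule nth_mult_linear)
      also have "\<dots> = (1 / p) ^ Suc k / gl_density p (Suc k) - (1 / p) ^ Suc k / gl_density p k"
        unfolding nth_nilpotent_fps by simp
      also have "\<dots> = (1 / p) ^ Suc k * ((1 / p) ^ Suc k / gl_density p (Suc k))"
      proof -
        have "r / (c * (1 - r)) - r / c = r * (r / (c * (1 - r)))"
          if "c > 0" "1 - r > 0" for r c :: real
          using that by (simp add: field_simps)
        then show ?thesis
          unfolding gl_density_Suc using gl_density_pos one_minus_power_pos[of "Suc k"] by blast
      qed
      finally show ?thesis by (simp add: Suc fps_dilate_def nth_nilpotent_fps)
    qed
  qed
  moreover have "?l * ?D ?h = ?h"
  proof (rule fps_ext)
    fix n
    show "fps_nth (?l * ?D ?h) n = fps_nth ?h n"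
    proof (cases n)
      case 0 then show ?thesis by (simp add: fps_dilate_def)
    next
      case (Suc k)
      have "fps_nth (?l * ?D ?h) n = (1 / p) ^ Suc k * inv_nilp_coeff (Suc k) - 1 / p * ((1 / p) ^ k * inv_nilp_coeff k)"
        unfolding Suc mult.commute[of ?l] nth_mult_linear by (simp add: fps_dilate_def)
      also have "\<dots> = inv_nilp_coeff (Suc k)"
      proof -
        have "r * (- a * r / (1 - r)) - r * a = - a * r / (1 - r)" if "1 - r > 0" for r a :: real
          using that by (simp add: field_simps)
        from this[OF one_minus_power_pos[of "Suc k"]] show ?thesis by simp
      qed
      finally show ?thesis by (simp add: Suc)
    qed
  qed
  ultimately have inv: "?D (?F * ?h) = ?F * ?h"
    by (metis fps_dilate_mult mult.assoc)
  show ?thesis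
  proof (rule fps_ext)
    fix n
    show "fps_nth (?F * ?h) n = fps_nth 1 n"
    proof (cases n)
      case 0 then show ?thesis by (simp add: nth_nilpotent_fps gl_density_0 mat_fps_def)
    next
      case (Suc k)
      have "(1 / p) ^ n * fps_nth (?F * ?h) n = fps_nth (?F * ?h) n"
        by (subst (2) inv[symmetric]) (simp add: fps_dilate_def)
      then have "(1 - (1 / p) ^ n) * fps_nth (?F * ?h) n = 0" by (simp add: algebra_simps)
      then have "fps_nth (?F * ?h) n = 0"
        using one_minus_power_pos[of n] Suc by (metis less_irrefl mult_eq_0_iff zero_less_Suc)
      then show ?thesis using Suc by simp
    qed
  qed
qed

text \<open>G is eliminated through the second factorization: (1 - u) G = h^k F, where h is the
  inverse of F and k = \<open>card J\<close>. This leaves a product of absolutely summable series,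
  since the A_j are dominated by F.\<close>

lemma convergent_nth_of_factorization:
  fixes J :: "'j set"
  assumes U: "U = (\<Prod>j\<in>J. A j) * G"
    and G: "mat_fps p = ((1 - fps_X) * mat_fps p) ^ card J * G"
    and A: "\<And>j n. j \<in> J \<Longrightarrow> 0 \<le> fps_nth (A j) n"
      "\<And>j n. j \<in> J \<Longrightarrow> fps_nth (A j) n \<le> fps_nth ((1 - fps_X) * mat_fps p) n"
  shows "convergent (fps_nth U)"
proof (rule convergent_nth_of_abs_summable)
  let ?F = "(1 - fps_X) * mat_fps p" and ?h = "Abs_fps inv_nilp_coeff"
  have nn: "0 \<le> fps_nth ?F n" for n
    using gl_density_pos[of n] p by (simp add: nth_nilpotent_fps)
  have lim: "(\<lambda>n. (1 / p) / (1 - (1 / p) ^ Suc n)) \<longlonglongrightarrow> (1 / p) / (1 - 0)"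
    using p by (intro tendsto_intros LIMSEQ_Suc[OF LIMSEQ_realpow_zero]) auto
  \<comment> \<open>The ratio of consecutive coefficients of F tends to 1 / p < 1; any c strictly in
    between serves in the ratio test.\<close>
  obtain c where c: "1 / p < c" "c < 1" using dense[of "1 / p" 1] p by auto
  have "eventually (\<lambda>n. (1 / p) / (1 - (1 / p) ^ Suc n) < c) sequentially"
    using lim by (rule order_tendstoD) (use c in simp)
  then obtain N where N: "\<And>n. n \<ge> N \<Longrightarrow> (1 / p) / (1 - (1 / p) ^ Suc n) < c"
    unfolding eventually_sequentially by blast
  have "summable (fps_nth ?F)"
  proof (rule summable_ratio_test[where c = c and N = N])
    fix n assume "n \<ge> N"
    have "fps_nth ?F (Suc n) = fps_nth ?F n * ((1 / p) / (1 - (1 / p) ^ Suc n))"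
      by (simp add: nth_nilpotent_fps gl_density_Suc)
    also have "\<dots> \<le> fps_nth ?F n * c"
      using N[OF \<open>n \<ge> N\<close>] nn by (intro mult_left_mono) auto
    finally show "norm (fps_nth ?F (Suc n)) \<le> c * norm (fps_nth ?F n)"
      using nn by (simp add: mult.commute)
  qed (use c in simp)
  then have F: "abs_summable_fps ?F" unfolding abs_summable_fps_def using nn by (simp del: fps_mult_nth_0)
  have AJ: "abs_summable_fps (A j)" if "j \<in> J" for j
    unfolding abs_summable_fps_def
  proof (rule summable_comparison_test')
    show "summable (fps_nth ?F)" by fact
    show "norm \<bar>fps_nth (A j) n\<bar> \<le> fps_nth ?F n" for n
      using A[OF that, of n] by simp
  qed
  have Gh: "?h ^ card J * ?F ^ card J = 1"
    by (metis nilpotent_fps_mult_inverse mult.commute power_mult_distrib power_one)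
  have "(1 - fps_X) * G = (?h ^ card J * ?F ^ card J) * ((1 - fps_X) * G)"
    unfolding Gh by simp
  also have "\<dots> = ?h ^ card J * ((1 - fps_X) * (?F ^ card J * G))"
    by (simp only: ac_simps)
  also have "\<dots> = ?h ^ card J * ?F"
    by (simp only: G[symmetric])
  finally have "(1 - fps_X) * U = (\<Prod>j\<in>J. A j) * (?h ^ card J * ?F)"
    unfolding U by (metis mult.left_commute)
  also have "abs_summable_fps \<dots>"
    by (intro abs_summable_fps_mult abs_summable_fps_prod abs_summable_fps_power
        abs_summable_inv_nilp F AJ)
  finally show "abs_summable_fps ((1 - fps_X) * U)" .
qed

end

section \<open>Finite modules over the integers\<close>

locale int_module = Modules.module scale for scale :: "int \<Rightarrow> 'v::ab_group_add \<Rightarrow> 'v" (infixr "\<star>" 75)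
begin

definition additive_on :: "'v set \<Rightarrow> ('v \<Rightarrow> 'v) \<Rightarrow> bool" where
  "additive_on N f \<longleftrightarrow> (\<forall>x\<in>N. \<forall>y\<in>N. f (x + y) = f x + f y)"

text \<open>Modules are subsets of one type. Extension by 0 makes a map determined by its values on
  N, so that sets of maps between finite modules are finite and can be counted. Additivity suffices,
  as it implies Z-linearity on subspaces (\<open>Homs_scale\<close>).\<close>

definition Homs :: "'v set \<Rightarrow> 'v set \<Rightarrow> ('v \<Rightarrow> 'v) set" where
  "Homs N N' = {f. f ` N \<subseteq> N' \<and> additive_on N f \<and> (\<forall>x. x \<notin> N \<longrightarrow> f x = 0)}"

definition Monos :: "'v set \<Rightarrow> 'v set \<Rightarrow> ('v \<Rightarrow> 'v) set" where
  "Monos N N' = {f \<in> Homs N N'. inj_on f N}"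

definition Isos :: "'v set \<Rightarrow> 'v set \<Rightarrow> ('v \<Rightarrow> 'v) set" where
  "Isos N N' = {f \<in> Homs N N'. bij_betw f N N'}"

definition rst :: "'v set \<Rightarrow> ('v \<Rightarrow> 'v) \<Rightarrow> 'v \<Rightarrow> 'v" where
  "rst K f x = (if x \<in> K then f x else 0)"

lemma HomsI:
  assumes "\<And>x. x \<in> N \<Longrightarrow> f x \<in> N'" "\<And>x y. x \<in> N \<Longrightarrow> y \<in> N \<Longrightarrow> f (x + y) = f x + f y"
    "\<And>x. x \<notin> N \<Longrightarrow> f x = 0"
  shows "f \<in> Homs N N'"
  using assms by (auto simp: Homs_def additive_on_def)

lemma Homs_mem: "f \<in> Homs N N' \<Longrightarrow> x \<in> N \<Longrightarrow> f x \<in> N'"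
  by (auto simp: Homs_def)

lemma Homs_add: "f \<in> Homs N N' \<Longrightarrow> x \<in> N \<Longrightarrow> y \<in> N \<Longrightarrow> f (x + y) = f x + f y"
  by (auto simp: Homs_def additive_on_def)

lemma Homs_outside: "f \<in> Homs N N' \<Longrightarrow> x \<notin> N \<Longrightarrow> f x = 0"
  by (auto simp: Homs_def)

lemma Homs_eqI:
  assumes "f \<in> Homs N N'" "g \<in> Homs N N''" "\<And>x. x \<in> N \<Longrightarrow> f x = g x"
  shows "f = g"
  using assms Homs_outside by (metis ext)

lemma Monos_subset: "Monos N N' \<subseteq> Homs N N'"
  by (auto simp: Monos_def)

lemma Isos_subset_Monos: "Isos N N' \<subseteq> Monos N N'"
  by (auto simp: Monos_def Isos_def bij_betw_def)



lemma Homs_0: "f \<in> Homs N N' \<Longrightarrow> subspace N \<Longrightarrow> f 0 = 0"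
  using Homs_add[of f N N' 0 0] subspace_0 by fastforce

lemma Homs_neg:
  assumes f: "f \<in> Homs N N'" and N: "subspace N" and x: "x \<in> N"
  shows "f (- x) = - f x"
proof -
  have "f (x + - x) = f x + f (- x)"
    using Homs_add[OF f x] subspace_neg[OF N x] by blast
  then show ?thesis using Homs_0[OF f N] by (simp add: minus_unique)
qed

lemma Homs_diff:
  assumes f: "f \<in> Homs N N'" and N: "subspace N" and x: "x \<in> N" "y \<in> N"
  shows "f (x - y) = f x - f y"
  using Homs_add[OF f x(1), of "- y"] Homs_neg[OF f N x(2)] subspace_neg[OF N x(2)] by simp

lemma Homs_inj_iff:
  assumes f: "f \<in> Homs N N'" and N: "subspace N"
  shows "inj_on f N \<longleftrightarrow> (\<forall>x\<in>N. f x = 0 \<longrightarrow> x = 0)"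
proof
  assume "inj_on f N"
  then show "\<forall>x\<in>N. f x = 0 \<longrightarrow> x = 0"
    using Homs_0[OF f N] subspace_0[OF N] by (metis inj_onD)
next
  assume *: "\<forall>x\<in>N. f x = 0 \<longrightarrow> x = 0"
  show "inj_on f N"
  proof (rule inj_onI)
    fix x y assume xy: "x \<in> N" "y \<in> N" "f x = f y"
    then have "f (x - y) = 0" using Homs_diff[OF f N] by simp
    then show "x = y" using * subspace_diff[OF N] xy by force
  qed
qed

lemma rst_Homs: "f \<in> Homs N N' \<Longrightarrow> subspace K \<Longrightarrow> K \<subseteq> N \<Longrightarrow> f ` K \<subseteq> M \<Longrightarrow> rst K f \<in> Homs K M"
  by (rule HomsI) (auto simp: rst_def subspace_add subsetD Homs_add)

lemma finite_Homs:
  assumes "finite N" "finite N'" shows "finite (Homs N N')"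
proof (rule finite_subset)
  show "Homs N N' \<subseteq> {f. \<forall>x. (x \<in> N \<longrightarrow> f x \<in> N') \<and> (x \<notin> N \<longrightarrow> f x = 0)}"
    by (auto simp: Homs_def)
  show "finite {f. \<forall>x. (x \<in> N \<longrightarrow> f x \<in> N') \<and> (x \<notin> N \<longrightarrow> f x = 0)}"
    using assms by (rule finite_set_of_finite_funs)
qed

text \<open>Every nonempty fibre is a translate of the kernel.\<close>

lemma card_vimage_Homs:
  assumes f: "f \<in> Homs N N'" and N: "subspace N" "finite N" and S: "S \<subseteq> f ` N"
  shows "card {x \<in> N. f x \<in> S} = card {x \<in> N. f x = 0} * card S"
proof -
  have "card {x \<in> N. f x = s} = card {x \<in> N. f x = 0}" if "s \<in> S" for s
  proof -
    obtain z where z: "z \<in> N" "f z = s" using S \<open>s \<in> S\<close> by blast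
    have "bij_betw (\<lambda>x. x + z) {x \<in> N. f x = 0} {x \<in> N. f x = s}"
      by (rule bij_betw_byWitness[where f' = "\<lambda>x. x - z"])
         (use z N in \<open>auto simp: Homs_add[OF f] Homs_diff[OF f N(1)] subspace_add subspace_diff\<close>)
    then show ?thesis by (simp add: bij_betw_same_card)
  qed
  moreover have "{x \<in> N. f x \<in> S} = (\<Union>s\<in>S. {x \<in> N. f x = s})" by auto
  moreover have "card (\<Union>s\<in>S. {x \<in> N. f x = s}) = (\<Sum>s\<in>S. card {x \<in> N. f x = s})"
    using N S by (intro card_UN_disjoint) (auto intro: finite_subset)
  ultimately show ?thesis by simp
qed



lemma Homs_scale:
  assumes f: "f \<in> Homs N N'" and N: "subspace N" and x: "x \<in> N"
  shows "f (c \<star> x) = c \<star> f x"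
proof -
  have *: "f (int n \<star> x) = int n \<star> f x" for n
  proof (induction n)
    case 0 then show ?case using Homs_0[OF f N] by simp
  next
    case (Suc n)
    have "f (int (Suc n) \<star> x) = f (int n \<star> x + x)" by (simp add: scale_left_distrib add.commute)
    also have "\<dots> = f (int n \<star> x) + f x" by (intro Homs_add[OF f] subspace_scale N x)
    finally show ?case using Suc by (simp add: scale_left_distrib add.commute)
  qed
  show ?thesis
  proof (cases "c \<ge> 0")
    case True then show ?thesis using *[of "nat c"] by simp
  next
    case False
    then have c: "c = - int (nat (- c))" by simp
    have "f (c \<star> x) = f (- (int (nat (- c)) \<star> x))" by (subst c) simp
    also have "\<dots> = - f (int (nat (- c)) \<star> x)" by (intro Homs_neg[OF f N] subspace_scale N x)
    also have "\<dots> = c \<star> f x" by (subst *) (use False in simp)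
    finally show ?thesis .
  qed
qed

lemma subspace_image:
  assumes f: "f \<in> Homs N N'" and N: "subspace N" and K: "subspace K" "K \<subseteq> N"
  shows "subspace (f ` K)"
proof (rule subspaceI)
  show "0 \<in> f ` K" using Homs_0[OF f N] subspace_0[OF K(1)] by force
  fix x y assume "x \<in> f ` K" "y \<in> f ` K"
  then obtain a b where ab: "a \<in> K" "b \<in> K" "x = f a" "y = f b" by blast
  then have "x + y = f (a + b)" using K Homs_add[OF f] by (simp add: subsetD)
  then show "x + y \<in> f ` K" using ab K by (auto intro: subspace_add)
next
  fix c x assume "x \<in> f ` K"
  then obtain a where a: "a \<in> K" "x = f a" by blast
  then have "c \<star> x = f (c \<star> a)" using K Homs_scale[OF f N] by (simp add: subsetD)
  then show "c \<star> x \<in> f ` K" using a K by (auto intro: subspace_scale)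
qed

end

section \<open>Free modules over Z/p^L and the counts of their homomorphisms\<close>

locale torsion_basis = int_module scale
  for scale :: "int \<Rightarrow> 'v::ab_group_add \<Rightarrow> 'v" (infixr "\<star>" 75) +
  fixes p L :: nat and e :: "nat \<Rightarrow> 'v"
  assumes prime_p: "Factorial_Ring.prime p" and L_pos: "L > 0"
    and e_torsion: "int p ^ L \<star> e i = 0"
    and e_indep: "(\<Sum>i<n. c i \<star> e i) = 0 \<Longrightarrow> i < n \<Longrightarrow> int p ^ L dvd c i"
begin

abbreviation q :: int where "q \<equiv> int p ^ L"

abbreviation q' :: int where "q' \<equiv> int p ^ (L - 1)"

text \<open>The free Z/p^L-module on the first n basis vectors. One infinite sequence carries all
  ranks, so these modules are nested and lie in the same type.\<close>

definition V :: "nat \<Rightarrow> 'v set" where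
  "V n = {\<Sum>i<n. c i \<star> e i | c. True}"

text \<open>For finite modules killed by p^L this amounts to freeness over Z/p^L
  (\<open>homocyclic_Iso_V\<close>), in a form that mentions no basis and passes to direct
  summands.\<close>

definition homocyclic :: "'v set \<Rightarrow> bool" where
  "homocyclic N \<longleftrightarrow> subspace N \<and> finite N \<and> (\<forall>x\<in>N. q \<star> x = 0) \<and>
     (\<forall>x\<in>N. int p \<star> x = 0 \<longrightarrow> (\<exists>z\<in>N. x = q' \<star> z))"

lemma p_gt_1: "p > 1" using prime_p by (rule prime_gt_1_nat)

lemma q_pos: "q > 0" using p_gt_1 by simp

lemma q_eq: "q = int p * q'" using L_pos by (simp add: power_eq_if)

lemma V_0: "V 0 = {0}" by (auto simp: V_def)

lemma V_Suc: "V (Suc n) = {v + c \<star> e n | v c. v \<in> V n}"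
proof safe
  fix x assume "x \<in> V (Suc n)"
  then show "\<exists>v c. x = v + c \<star> e n \<and> v \<in> V n" unfolding V_def by auto
next
  fix v c assume "v \<in> V n"
  then obtain d where d: "v = (\<Sum>i<n. d i \<star> e i)" unfolding V_def by auto
  have "v + c \<star> e n = (\<Sum>i<Suc n. (d(n := c)) i \<star> e i)"
    unfolding d by simp
  then show "v + c \<star> e n \<in> V (Suc n)" unfolding V_def by blast
qed

lemma V_indep: "v \<in> V n \<Longrightarrow> v + c \<star> e n = 0 \<Longrightarrow> q dvd c"
proof -
  assume "v \<in> V n" "v + c \<star> e n = 0"
  then obtain d where d: "v = (\<Sum>i<n. d i \<star> e i)" unfolding V_def by auto
  have "(\<Sum>i<Suc n. (d(n := c)) i \<star> e i) = 0"
    using \<open>v + c \<star> e n = 0\<close> unfolding d by simp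
  from e_indep[OF this, of n] show ?thesis by simp
qed

lemma subspace_V: "subspace (V n)"
proof (rule subspaceI)
  show "0 \<in> V n" unfolding V_def by (auto intro!: exI[of _ "\<lambda>_. 0"])
  fix x y assume "x \<in> V n" "y \<in> V n"
  then obtain c d where "x = (\<Sum>i<n. c i \<star> e i)" "y = (\<Sum>i<n. d i \<star> e i)"
    unfolding V_def by auto
  then have "x + y = (\<Sum>i<n. (\<lambda>i. c i + d i) i \<star> e i)"
    by (simp add: scale_left_distrib sum.distrib)
  then show "x + y \<in> V n" unfolding V_def by (intro CollectI exI conjI TrueI)
next
  fix k x assume "x \<in> V n"
  then obtain c where "x = (\<Sum>i<n. c i \<star> e i)" unfolding V_def by auto
  then have "k \<star> x = (\<Sum>i<n. (\<lambda>i. k * c i) i \<star> e i)" by (simp add: scale_sum_right)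
  then show "k \<star> x \<in> V n" unfolding V_def by (intro CollectI exI conjI TrueI)
qed

lemmas V_zero = subspace_0[OF subspace_V]
  and V_add = subspace_add[OF subspace_V]
  and V_neg = subspace_neg[OF subspace_V]
  and V_diff = subspace_diff[OF subspace_V]
  and V_scale = subspace_scale[OF subspace_V]

lemma V_SucI: "v \<in> V n \<Longrightarrow> v + c \<star> e n \<in> V (Suc n)"
  unfolding V_Suc by blast

lemma e_mem_V: "e n \<in> V (Suc n)"
  using V_SucI[OF V_zero[of n], of 1] by simp

lemma V_subset_Suc: "V n \<subseteq> V (Suc n)"
  using V_SucI[of _ n 0] by auto

lemma V_mono: "m \<le> n \<Longrightarrow> V m \<subseteq> V n"
  using lift_Suc_mono_le[of V] V_subset_Suc by blast

lemma scale_e_eq_0: "q dvd c \<Longrightarrow> c \<star> e i = 0"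
  by (auto elim!: dvdE) (metis e_torsion mult.commute scale_scale scale_zero_right)

lemma torsion_mod: assumes "q \<star> z = 0" "q dvd c - d" shows "c \<star> z = d \<star> z"
proof -
  obtain k where k: "c - d = q * k" using assms(2) by (auto elim: dvdE)
  have "c \<star> z - d \<star> z = (k * q) \<star> z" using k by (simp add: scale_left_diff_distrib[symmetric] mult.commute)
  also have "\<dots> = 0" using assms(1) by (metis scale_scale scale_zero_right)
  finally show ?thesis by simp
qed

lemma V_unique:
  assumes "v \<in> V n" "v' \<in> V n" "v + c \<star> e n = v' + c' \<star> e n"
  shows "v = v'" "q dvd c - c'"
proof -
  have "(v - v') + (c - c') \<star> e n = 0" using assms(3) by (simp add: scale_left_diff_distrib algebra_simps)
  then show "q dvd c - c'" using V_indep V_diff assms by blast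
  then have "c \<star> e n = c' \<star> e n" using torsion_mod e_torsion by blast
  then show "v = v'" using assms(3) by simp
qed

lemma V_Suc_bij: "bij_betw (\<lambda>(v, c). v + c \<star> e n) (V n \<times> {0..<q}) (V (Suc n))"
proof (rule bij_betw_imageI)
  show "inj_on (\<lambda>(v, c). v + c \<star> e n) (V n \<times> {0..<q})"
  proof (rule inj_onI, clarify)
    fix v c v' c' assume *: "v \<in> V n" "v' \<in> V n" "c \<in> {0..<q}" "c' \<in> {0..<q}"
      "v + c \<star> e n = v' + c' \<star> e n"
    then have "q dvd c - c'" "v = v'" using V_unique by blast+
    moreover from this(1) have "c mod q = c' mod q" by (simp add: mod_eq_dvd_iff)
    ultimately show "v = v' \<and> c = c'" using * by simp
  qed
  show "(\<lambda>(v, c). v + c \<star> e n) ` (V n \<times> {0..<q}) = V (Suc n)"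
  proof safe
    fix v c assume "v \<in> V n" then show "v + c \<star> e n \<in> V (Suc n)" unfolding V_Suc by blast
  next
    fix x assume "x \<in> V (Suc n)"
    then obtain v c where x: "x = v + c \<star> e n" "v \<in> V n" unfolding V_Suc by blast
    have "c \<star> e n = (c mod q) \<star> e n" by (rule torsion_mod[OF e_torsion]) (simp add: minus_mod_eq_mult_div)
    then have "x = (\<lambda>(v, c). v + c \<star> e n) (v, c mod q)" using x by simp
    moreover have "(v, c mod q) \<in> V n \<times> {0..<q}" using x q_pos by simp
    ultimately show "x \<in> (\<lambda>(v, c). v + c \<star> e n) ` (V n \<times> {0..<q})" by blast
  qed
qed

lemma finite_V: "finite (V n)"
proof (induction n)
  case 0 then show ?case by (simp add: V_0)
next
  case (Suc n) then show ?case using bij_betw_finite[OF V_Suc_bij[of n]] by simp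
qed

lemma card_V: "card (V n) = (p ^ L) ^ n"
proof (induction n)
  case 0 then show ?case by (simp add: V_0)
next
  case (Suc n)
  have "card (V (Suc n)) = card (V n \<times> {0..<q})" using V_Suc_bij bij_betw_same_card by metis
  then show ?case using Suc by (simp add: card_cartesian_product nat_power_eq)
qed

lemma V_torsion: "x \<in> V n \<Longrightarrow> q \<star> x = 0"
proof (induction n arbitrary: x)
  case 0 then show ?case by (simp add: V_0)
next
  case (Suc n)
  then obtain v c where x: "x = v + c \<star> e n" "v \<in> V n" unfolding V_Suc by blast
  then show ?case using Suc.IH[OF x(2)] scale_e_eq_0[of "q * c" n] by (simp add: scale_right_distrib)
qed

lemma q_dvd_p_mult: "q dvd int p * c \<longleftrightarrow> q' dvd c"
  unfolding q_eq using p_gt_1 by simp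

lemma homocyclic_V: "homocyclic (V n)"
proof -
  have "\<exists>z\<in>V n. x = q' \<star> z" if "x \<in> V n" "int p \<star> x = 0" for x
    using that
  proof (induction n arbitrary: x)
    case 0 then show ?case by (simp add: V_0)
  next
    case (Suc n)
    then obtain v c where x: "x = v + c \<star> e n" "v \<in> V n" unfolding V_Suc by blast
    have "int p \<star> v + (int p * c) \<star> e n = 0" using Suc.prems x by (simp add: scale_right_distrib)
    moreover from this have "q dvd int p * c" using V_indep V_scale[OF x(2)] by blast
    ultimately have "int p \<star> v = 0" "q' dvd c"
      using scale_e_eq_0[of "int p * c" n] q_dvd_p_mult by auto
    then obtain z d where "z \<in> V n" "v = q' \<star> z" "c = q' * d"
      using Suc.IH[OF x(2)] by (metis dvdE)
    then have "z + d \<star> e n \<in> V (Suc n)" "x = q' \<star> (z + d \<star> e n)"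
      unfolding V_Suc using x by (auto simp: scale_right_distrib)
    then show ?case by blast
  qed
  then show ?thesis unfolding homocyclic_def using subspace_V finite_V V_torsion by blast
qed

abbreviation ptor :: "'v set \<Rightarrow> 'v set" where "ptor N \<equiv> {x \<in> N. int p \<star> x = 0}"

text \<open>The \<open>p\<close>-torsion of \<open>V n\<close> is the space \<open>V n\<close> for \<open>L = 1\<close> and the basis \<open>p\<^sup>L\<^sup>-\<^sup>1 e\<^sub>i\<close>.\<close>

lemma card_ptor_V: "card (ptor (V n)) = p ^ n"
proof -
  interpret W: torsion_basis scale p 1 "\<lambda>i. q' \<star> e i"
  proof unfold_locales
    show "int p ^ 1 \<star> (q' \<star> e i) = 0" for i
      unfolding scale_scale power_one_right q_eq[symmetric] by (rule e_torsion)
    fix n i and c :: "nat \<Rightarrow> int"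
    assume "(\<Sum>i<n. c i \<star> (q' \<star> e i)) = 0" "i < n"
    then have "q dvd c i * q'" using e_indep[of "\<lambda>i. c i * q'"] by simp
    then show "int p ^ 1 dvd c i" unfolding q_eq using p_gt_1 by simp
  qed (use prime_p in auto)
  have "(\<Sum>i<n. c i \<star> (q' \<star> e i)) = q' \<star> (\<Sum>i<n. c i \<star> e i)" for c
    by (simp add: scale_sum_right mult.commute)
  then have "W.V n = (\<lambda>v. q' \<star> v) ` V n" unfolding W.V_def V_def by auto
  also have "\<dots> = ptor (V n)"
  proof (intro equalityI subsetI)
    fix x assume "x \<in> (\<lambda>v. q' \<star> v) ` V n"
    then obtain v where v: "v \<in> V n" "x = q' \<star> v" by blast
    then have "int p \<star> x = q \<star> v" by (simp only: scale_scale q_eq)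
    then show "x \<in> ptor (V n)" using v V_torsion V_scale by simp
  qed (use homocyclic_V[of n] in \<open>auto simp: homocyclic_def\<close>)
  finally show ?thesis using W.card_V[of n] by simp
qed

text \<open>The linear extension of h that sends e_n to z. The coefficient of e_n is unique only
  modulo p^L, hence the choice, and hence the assumption q z = 0 in \<open>ext_eq\<close>.\<close>

definition ext :: "nat \<Rightarrow> ('v \<Rightarrow> 'v) \<Rightarrow> 'v \<Rightarrow> 'v \<Rightarrow> 'v" where
  "ext n h z w = (if w \<in> V (Suc n)
     then (let (v, c) = SOME (v, c). v \<in> V n \<and> w = v + c \<star> e n in h v + c \<star> z) else 0)"

lemma ext_eq:
  assumes "v \<in> V n" "q \<star> z = 0"
  shows "ext n h z (v + c \<star> e n) = h v + c \<star> z"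
proof -
  let ?P = "\<lambda>(v', c'). v' \<in> V n \<and> v + c \<star> e n = v' + c' \<star> e n"
  obtain v' c' where vc: "(SOME x. ?P x) = (v', c')" by force
  have "?P (SOME x. ?P x)" by (rule someI[of ?P "(v, c)"]) (use assms in simp)
  then have "v' \<in> V n" "v + c \<star> e n = v' + c' \<star> e n" unfolding vc by auto
  then have "v = v'" "q dvd c - c'" using V_unique assms(1) by blast+
  then have "h v' + c' \<star> z = h v + c \<star> z" using torsion_mod assms(2) by simp
  then show ?thesis using V_SucI[OF assms(1), of c] unfolding ext_def vc by simp
qed

lemma ext_Homs:
  assumes h: "h \<in> Homs (V n) N" and N: "subspace N" and z: "z \<in> N" "q \<star> z = 0"
  shows "ext n h z \<in> Homs (V (Suc n)) N"
proof (rule HomsI)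
  fix x assume "x \<in> V (Suc n)"
  then obtain v c where x: "x = v + c \<star> e n" "v \<in> V n" unfolding V_Suc by blast
  then show "ext n h z x \<in> N"
    using ext_eq[OF x(2) z(2)] Homs_mem[OF h] N z by (auto intro!: subspace_add subspace_scale)
  fix y assume "y \<in> V (Suc n)"
  then obtain w d where y: "y = w + d \<star> e n" "w \<in> V n" unfolding V_Suc by blast
  have "x + y = (v + w) + (c + d) \<star> e n" unfolding x y by (simp add: scale_left_distrib algebra_simps)
  then have "ext n h z (x + y) = h (v + w) + (c + d) \<star> z"
    using ext_eq[OF V_add[OF x(2) y(2)] z(2)] by simp
  also have "\<dots> = ext n h z x + ext n h z y"
    unfolding x y ext_eq[OF x(2) z(2)] ext_eq[OF y(2) z(2)] Homs_add[OF h x(2) y(2)]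
    by (simp add: scale_left_distrib algebra_simps)
  finally show "ext n h z (x + y) = ext n h z x + ext n h z y" .
qed (simp add: ext_def)

lemma ext_V: "h \<in> Homs (V n) N \<Longrightarrow> q \<star> z = 0 \<Longrightarrow> v \<in> V n \<Longrightarrow> ext n h z v = h v"
  using ext_eq[of v n z h 0] by simp

lemma ext_e: "h \<in> Homs (V n) N \<Longrightarrow> q \<star> z = 0 \<Longrightarrow> ext n h z (e n) = z"
  using ext_eq[OF V_zero, of z n h 1] Homs_0[OF _ subspace_V] by simp

lemma V_Suc_eqI:
  assumes "f \<in> Homs (V (Suc n)) N" "g \<in> Homs (V (Suc n)) N"
    "\<And>v. v \<in> V n \<Longrightarrow> f v = g v" "f (e n) = g (e n)"
  shows "f = g"
proof (rule Homs_eqI[OF assms(1,2)])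
  fix x assume "x \<in> V (Suc n)"
  then obtain v c where x: "x = v + c \<star> e n" "v \<in> V n" unfolding V_Suc by blast
  have "h x = h v + c \<star> h (e n)" if "h \<in> Homs (V (Suc n)) N" for h
    unfolding x(1) using Homs_add[OF that] Homs_scale[OF that subspace_V e_mem_V]
      V_scale[OF e_mem_V] x(2) V_subset_Suc by (metis subsetD)
  then show "f x = g x" using assms(3)[OF x(2)] assms(1,2,4) by metis
qed

lemma ext_bij:
  assumes N: "subspace N" "\<And>z. z \<in> N \<Longrightarrow> q \<star> z = 0"
  shows "bij_betw (\<lambda>(h, z). ext n h z) (Homs (V n) N \<times> N) (Homs (V (Suc n)) N)"
proof (rule bij_betw_byWitness[where f' = "\<lambda>f. (rst (V n) f, f (e n))"])
  show "\<forall>a\<in>Homs (V n) N \<times> N. (rst (V n) ((\<lambda>(h, z). ext n h z) a), (\<lambda>(h, z). ext n h z) a (e n)) = a"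
    using N ext_V ext_e by (auto simp: rst_def fun_eq_iff Homs_outside)
  show R: "(\<lambda>f. (rst (V n) f, f (e n))) ` Homs (V (Suc n)) N \<subseteq> Homs (V n) N \<times> N"
  proof safe
    fix f assume f: "f \<in> Homs (V (Suc n)) N"
    show "rst (V n) f \<in> Homs (V n) N"
      using f V_subset_Suc Homs_mem[OF f] by (intro rst_Homs[OF f subspace_V]) auto
    show "f (e n) \<in> N" using Homs_mem[OF f e_mem_V] .
  qed
  show "(\<lambda>(h, z). ext n h z) ` (Homs (V n) N \<times> N) \<subseteq> Homs (V (Suc n)) N"
    using ext_Homs N by auto
  show "\<forall>f\<in>Homs (V (Suc n)) N. (\<lambda>(h, z). ext n h z) (rst (V n) f, f (e n)) = f"
  proof
    fix f assume f: "f \<in> Homs (V (Suc n)) N"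
    then have *: "rst (V n) f \<in> Homs (V n) N" "f (e n) \<in> N" using R by auto
    have "ext n (rst (V n) f) (f (e n)) = f"
      using * N by (intro V_Suc_eqI[of _ n N]) (auto simp: ext_Homs f ext_V ext_e, simp add: rst_def)
    then show "(\<lambda>(h, z). ext n h z) (rst (V n) f, f (e n)) = f" by simp
  qed
qed

lemma card_Homs_V:
  assumes N: "subspace N" "\<And>z. z \<in> N \<Longrightarrow> q \<star> z = 0"
  shows "card (Homs (V n) N) = card N ^ n"
proof (induction n)
  case 0
  have "Homs (V 0) N = {\<lambda>_. 0}"
    using subspace_0[OF N(1)] by (auto simp: Homs_def V_0 additive_on_def fun_eq_iff) metis
  then show ?case by simp
next
  case (Suc n)
  then show ?case using bij_betw_same_card[OF ext_bij[OF N, of n]]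
    by (simp add: card_cartesian_product mult.commute)
qed

text \<open>A nonzero kernel contains an element of order \<open>p\<close>, so injectivity can be tested on the
  \<open>p\<close>-torsion.\<close>

lemma Homs_inj_iff_ptor:
  assumes f: "f \<in> Homs N N'" and N: "subspace N" "\<And>z. z \<in> N \<Longrightarrow> q \<star> z = 0"
  shows "inj_on f N \<longleftrightarrow> (\<forall>x\<in>ptor N. f x = 0 \<longrightarrow> x = 0)"
proof
  assume "inj_on f N"
  then show "\<forall>x\<in>ptor N. f x = 0 \<longrightarrow> x = 0" using Homs_inj_iff[OF f N(1)] by blast
next
  assume *: "\<forall>x\<in>ptor N. f x = 0 \<longrightarrow> x = 0"
  have "int p ^ k \<star> x = 0 \<Longrightarrow> x \<in> N \<Longrightarrow> f x = 0 \<Longrightarrow> x = 0" for k x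
  proof (induction k arbitrary: x)
    case (Suc k)
    have "int p ^ k \<star> (int p \<star> x) = 0" using Suc.prems by (simp add: mult.commute)
    moreover have "int p \<star> x \<in> N" "f (int p \<star> x) = 0"
      using Suc.prems N Homs_scale[OF f N(1)] by (auto intro: subspace_scale)
    ultimately have "int p \<star> x = 0" by (rule Suc.IH)
    then show ?case using * Suc.prems by blast
  qed simp
  then show "inj_on f N" unfolding Homs_inj_iff[OF f N(1)] using N(2) by blast
qed

lemma ex_inverse_mod_q:
  assumes "\<not> int p dvd c" shows "\<exists>a. q dvd a * c - 1"
proof -
  have "coprime c q" using assms prime_p
    by (metis coprime_commute coprime_power_left_iff prime_imp_coprime prime_nat_int_transfer)
  then obtain a b where "a * c + b * q = 1" using bezout_int[of c q] by (metis coprime_imp_gcd_eq_1)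
  then have "a * c - 1 = q * (- b)" by (simp add: algebra_simps)
  then show ?thesis by (metis dvdI)
qed

text \<open>Injectivity can be tested on the p-torsion of V_(n+1), which consists of multiples of
  q', so an element of the kernel there gives a relation h v + c q' z = 0. If p divides c, the last
  coordinate vanishes and only h matters; otherwise c is invertible modulo q and the relation puts
  q' z into the image of h.\<close>

lemma ext_inj_iff:
  assumes h: "h \<in> Homs (V n) N" and N: "subspace N" "\<And>z. z \<in> N \<Longrightarrow> q \<star> z = 0" and z: "z \<in> N"
  shows "inj_on (ext n h z) (V (Suc n)) \<longleftrightarrow> inj_on h (V n) \<and> q' \<star> z \<notin> h ` V n"
proof -
  note qz = N(2)[OF z]
  note E = ext_Homs[OF h N(1) z qz]
  show ?thesis
  proof (intro iffI conjI notI; (elim conjE)?)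
    assume inj: "inj_on (ext n h z) (V (Suc n))"
    then have "inj_on (ext n h z) (V n)" using V_subset_Suc inj_on_subset by blast
    then show "inj_on h (V n)" using ext_V[OF h qz] by (simp cong: inj_on_cong)
    assume "q' \<star> z \<in> h ` V n"
    then obtain v where v: "v \<in> V n" "q' \<star> z = h v" by blast
    \<comment> \<open>The relation q' z = h v yields an element of the kernel whose last coordinate
      q' is nonzero modulo q.\<close>
    have "ext n h z (- v + q' \<star> e n) = 0"
      using ext_eq[OF V_neg[OF v(1)] qz] Homs_neg[OF h subspace_V v(1)] v by simp
    moreover have m: "- v + q' \<star> e n \<in> V (Suc n)"
      using V_SucI[OF V_neg[OF v(1)]] .
    ultimately have "- v + q' \<star> e n = 0"
      using inj Homs_inj_iff[OF E subspace_V] by blast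
    then have "q dvd q'" using V_indep V_neg[OF v(1)] by blast
    then have "L \<le> L - 1" using p_gt_1 by (intro power_dvd_imp_le[of p]) (auto simp flip: of_nat_power)
    then show False using L_pos by simp
  next
    assume inj: "inj_on h (V n)" and nz: "q' \<star> z \<notin> h ` V n"
    have "\<forall>w\<in>ptor (V (Suc n)). ext n h z w = 0 \<longrightarrow> w = 0"
    proof (intro ballI impI)
      fix w assume w: "w \<in> ptor (V (Suc n))" and 0: "ext n h z w = 0"
      obtain w' where w': "w' \<in> V (Suc n)" "w = q' \<star> w'"
        using w homocyclic_V[of "Suc n"] unfolding homocyclic_def by blast
      then obtain v' c where v': "w' = v' + c \<star> e n" "v' \<in> V n" unfolding V_Suc by blast
      define v where "v = q' \<star> v'"
      have v: "v \<in> V n" unfolding v_def using v' V_scale by blast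
      have w_eq: "w = v + (q' * c) \<star> e n"
        unfolding w' v' v_def by (simp add: scale_right_distrib)
      have eq0: "h v + c \<star> (q' \<star> z) = 0"
        using 0 ext_eq[OF v qz] unfolding w_eq by (simp add: mult.commute)
      show "w = 0"
      proof (cases "int p dvd c")
        case True
        then have "q dvd q' * c" unfolding q_eq by (auto elim!: dvdE)
        then have "w = v" using scale_e_eq_0 w_eq by simp
        then have "h w = 0" using 0 ext_V[OF h qz] v by simp
        then show ?thesis using inj Homs_inj_iff[OF h subspace_V] \<open>w = v\<close> v by blast
      next
        case False
        then obtain a where a: "q dvd a * c - 1" using ex_inverse_mod_q by blast
        have qpz: "q \<star> (q' \<star> z) = 0"
          using N(2) subspace_scale[OF N(1) z] by blast
        have "q' \<star> z = (a * c) \<star> (q' \<star> z)"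
          using torsion_mod[OF qpz a] by simp
        also have "\<dots> = a \<star> (c \<star> (q' \<star> z))" by (simp add: mult.assoc)
        also have "c \<star> (q' \<star> z) = - h v" using eq0 by (simp add: add_eq_0_iff)
        also have "a \<star> (- h v) = (- a) \<star> h v" by simp
        also have "\<dots> = h ((- a) \<star> v)" by (rule Homs_scale[OF h subspace_V v, symmetric])
        finally have "q' \<star> z \<in> h ` V n" using v V_scale by blast
        then show ?thesis using nz by blast
      qed
    qed
    then show "inj_on (ext n h z) (V (Suc n))"
      using Homs_inj_iff_ptor[OF E subspace_V] V_torsion by blast
  qed
qed

lemma ext_bij_Monos:
  assumes N: "subspace N" "\<And>z. z \<in> N \<Longrightarrow> q \<star> z = 0"
  shows "bij_betw (\<lambda>(h, z). ext n h z)
    (SIGMA h:Monos (V n) N. {z \<in> N. q' \<star> z \<notin> h ` V n}) (Monos (V (Suc n)) N)"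
proof (rule bij_betw_subset[OF ext_bij[OF N, of n]])
  show "(SIGMA h:Monos (V n) N. {z \<in> N. q' \<star> z \<notin> h ` V n}) \<subseteq> Homs (V n) N \<times> N"
    using Monos_subset by blast
  have surj: "(\<lambda>(h, z). ext n h z) ` (Homs (V n) N \<times> N) = Homs (V (Suc n)) N"
    using ext_bij[OF N] by (rule bij_betw_imp_surj_on)
  show "(\<lambda>(h, z). ext n h z) ` (SIGMA h:Monos (V n) N. {z \<in> N. q' \<star> z \<notin> h ` V n}) =
    Monos (V (Suc n)) N"
  proof safe
    fix h z assume *: "h \<in> Monos (V n) N" "z \<in> N" "q' \<star> z \<notin> h ` V n"
    then have "h \<in> Homs (V n) N" "inj_on h (V n)" by (auto simp: Monos_def)
    then show "ext n h z \<in> Monos (V (Suc n)) N"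
      using ext_inj_iff[OF _ N, of h n z] * ext_Homs[OF _ N(1), of h n z] N(2)
      by (simp add: Monos_def)
  next
    fix f assume f: "f \<in> Monos (V (Suc n)) N"
    then have "f \<in> (\<lambda>(h, z). ext n h z) ` (Homs (V n) N \<times> N)" using surj by (simp add: Monos_def)
    then obtain h z where *: "h \<in> Homs (V n) N" "z \<in> N" "f = ext n h z" by auto
    then have "inj_on h (V n) \<and> q' \<star> z \<notin> h ` V n"
      using ext_inj_iff[OF *(1) N *(2)] f by (simp add: Monos_def)
    then show "f \<in> (\<lambda>(h, z). ext n h z) `
        (SIGMA h:Monos (V n) N. {z \<in> N. q' \<star> z \<notin> h ` V n})"
      using * by (intro image_eqI[of _ _ "(h, z)"]) (auto simp: Monos_def)
  qed
qed

lemma ptor_image: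
  assumes f: "f \<in> Homs N N'" "inj_on f N" and N: "subspace N"
  shows "f ` ptor N = ptor (f ` N)"
proof -
  have "int p \<star> f x = 0 \<longleftrightarrow> int p \<star> x = 0" if "x \<in> N" for x
    using Homs_scale[OF f(1) N that, of "int p"] Homs_inj_iff[OF f(1) N] f(2) Homs_0[OF f(1) N]
      subspace_scale[OF N that] by metis
  then show ?thesis by auto
qed

lemma scale_Homs:
  "subspace N \<Longrightarrow> rst N ((\<star>) c) \<in> Homs N N"
  by (rule HomsI) (auto simp: rst_def subspace_add subspace_scale scale_right_distrib)

text \<open>Multiplication by q' maps V_n onto its p-torsion, which has p^n elements, with fibres of
  equal size. The image of h contains p^k of these elements, so the fraction p^k / p^n of all z is
  excluded.\<close>

lemma card_ext_monos:
  assumes h: "h \<in> Monos (V k) (V n)" and k: "k \<le> n"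
  shows "real (card {z \<in> V n. q' \<star> z \<notin> h ` V k}) =
    real ((p ^ L) ^ n) * (1 - (1 / real p) ^ (n - k))"
proof -
  let ?h = "rst (V n) ((\<star>) q')"
  let ?B = "{z \<in> V n. q' \<star> z \<in> h ` V k}"
  note H = scale_Homs[OF subspace_V, of n "q'"]
  have h': "h \<in> Homs (V k) (V n)" "inj_on h (V k)" using h by (auto simp: Monos_def)
  have im: "?h ` V n = ptor (V n)"
  proof (intro equalityI subsetI)
    fix x assume "x \<in> ?h ` V n"
    then obtain z where z: "z \<in> V n" "x = q' \<star> z" by (auto simp: rst_def)
    then have "int p \<star> x = 0" using V_torsion[OF z(1)] by (simp only: scale_scale q_eq[symmetric])
    then show "x \<in> ptor (V n)" using z V_scale by blast
  next
    fix x assume "x \<in> ptor (V n)"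
    then obtain z where "z \<in> V n" "x = q' \<star> z"
      using homocyclic_V[of n] unfolding homocyclic_def by blast
    then show "x \<in> ?h ` V n" by (auto simp: rst_def intro!: image_eqI[of _ _ z])
  qed
  have sub: "ptor (h ` V k) \<subseteq> ?h ` V n" unfolding im using Homs_mem[OF h'(1)] by auto
  have tz: "int p \<star> (q' \<star> z) = 0" if "z \<in> V n" for z
    using V_torsion[OF that] by (simp only: scale_scale q_eq[symmetric])
  have "?B = {z \<in> V n. ?h z \<in> ptor (h ` V k)}"
    using tz by (auto simp: rst_def simp del: scale_scale)
  then have cB: "card ?B = card {z \<in> V n. ?h z = 0} * card (ptor (h ` V k))"
    using card_vimage_Homs[OF H subspace_V finite_V sub] by simp
  have "{z \<in> V n. ?h z \<in> ?h ` V n} = V n" by auto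
  then have "card (V n) = card {z \<in> V n. ?h z = 0} * card (ptor (V n))"
    using card_vimage_Homs[OF H subspace_V finite_V subset_refl] im by simp
  then have cV: "(p ^ L) ^ n = card {z \<in> V n. ?h z = 0} * p ^ n" by (simp add: card_V card_ptor_V)
  have "card (ptor (h ` V k)) = p ^ k"
    using ptor_image[OF h' subspace_V] card_image[OF inj_on_subset[OF h'(2), of "ptor (V k)"]]
    by (simp add: card_ptor_V)
  then have B: "real (card ?B) = real ((p ^ L) ^ n) * (1 / real p) ^ (n - k)"
    using k p_gt_1 unfolding cB cV by (simp add: power_diff power_one_over)
  have "{z \<in> V n. q' \<star> z \<notin> h ` V k} = V n - ?B" by auto
  moreover have "card (V n - ?B) = card (V n) - card ?B" "card ?B \<le> card (V n)"
    using finite_V by (auto intro!: card_Diff_subset card_mono)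
  ultimately have "real (card {z \<in> V n. q' \<star> z \<notin> h ` V k}) = real ((p ^ L) ^ n) - real (card ?B)"
    by (simp add: of_nat_diff card_V)
  then show ?thesis unfolding B by (simp add: right_diff_distrib)
qed

text \<open>The images of the basis vectors are chosen one after the other.\<close>

lemma card_Monos_V:
  "k \<le> n \<Longrightarrow> real (card (Monos (V k) (V n))) = (\<Prod>i<k. real ((p ^ L) ^ n) * (1 - (1 / real p) ^ (n - i)))"
proof (induction k)
  case 0
  have "Monos (V 0) (V n) = {\<lambda>_. 0}"
    using V_zero by (auto simp: Monos_def Homs_def V_0 additive_on_def fun_eq_iff) metis
  then show ?case by simp
next
  case (Suc k)
  have "card (Monos (V (Suc k)) (V n)) =
    card (SIGMA h:Monos (V k) (V n). {z \<in> V n. q' \<star> z \<notin> h ` V k})"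
    by (rule bij_betw_same_card[OF ext_bij_Monos[OF subspace_V V_torsion], symmetric])
  also have "\<dots> = (\<Sum>h\<in>Monos (V k) (V n). card {z \<in> V n. q' \<star> z \<notin> h ` V k})"
    using finite_V finite_Homs finite_subset[OF Monos_subset] by (intro card_SigmaI) auto
  finally have "real (card (Monos (V (Suc k)) (V n))) =
      (\<Sum>h\<in>Monos (V k) (V n). real ((p ^ L) ^ n) * (1 - (1 / real p) ^ (n - k)))"
    using card_ext_monos Suc.prems by simp
  then show ?case using Suc by simp
qed

lemma Isos_V: "Isos (V n) (V n) = Monos (V n) (V n)"
proof -
  have "f ` V n = V n" if "f \<in> Monos (V n) (V n)" for f
    using that finite_V by (intro card_subset_eq) (auto simp: Monos_def card_image Homs_mem)
  then show ?thesis by (auto simp: Isos_def Monos_def bij_betw_def)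
qed

text \<open>Take an injection h of V_s into N with s maximal. As it has no injective extension to
  V_(s+1), \<open>ext_inj_iff\<close> puts all of q' N into the image of h. By homocyclicity the
  p-torsion of N lies there too, and induction on k covers the elements killed by p^k.\<close>

lemma homocyclic_Iso_V:
  assumes N: "homocyclic N"
  shows "\<exists>s. Isos (V s) N \<noteq> {}"
proof -
  have N': "subspace N" "\<And>z. z \<in> N \<Longrightarrow> q \<star> z = 0" "finite N" using N unfolding homocyclic_def by auto
  let ?P = "\<lambda>s. Monos (V s) N \<noteq> {}"
  have "(\<lambda>_. 0) \<in> Monos (V 0) N"
    using subspace_0[OF N'(1)] by (auto simp: Monos_def Homs_def V_0 additive_on_def)
  then have "?P 0" by blast
  \<comment> \<open>An injection of V_s forces p^(L s) <= |N|, so the possible s are bounded and a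
    maximum exists.\<close>
  moreover have bd: "s \<le> card N" if "?P s" for s
  proof -
    have "card (V s) \<le> card N" using that N'(3) by (auto simp: Monos_def Homs_def intro!: card_inj_on_le)
    moreover have "s < (p ^ L) ^ s"
      using p_gt_1 L_pos by (intro power_gt_expt) (metis One_nat_def one_less_power)
    ultimately show ?thesis by (simp add: card_V)
  qed
  ultimately obtain s where s: "?P s" "\<And>t. ?P t \<Longrightarrow> t \<le> s"
    using Nat.ex_has_greatest_nat[of ?P 0 "card N"] by blast
  then obtain h where "h \<in> Monos (V s) N" by blast
  then have h: "h \<in> Homs (V s) N" "inj_on h (V s)" by (auto simp: Monos_def)
  have "\<not> ?P (Suc s)" using s(2)[of "Suc s"] by auto
  have top: "q' \<star> z \<in> h ` V s" if "z \<in> N" for z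
  proof (rule ccontr)
    assume "q' \<star> z \<notin> h ` V s"
    then have "ext s h z \<in> Monos (V (Suc s)) N"
      using ext_inj_iff[OF h(1) N'(1,2) that] ext_Homs[OF h(1) N'(1) that] N'(2)[OF that] h(2)
      by (simp add: Monos_def)
    then show False using \<open>\<not> ?P (Suc s)\<close> by blast
  qed
  have pt: "x \<in> h ` V s" if "x \<in> N" "int p \<star> x = 0" for x
  proof -
    from N have "\<exists>z\<in>N. x = q' \<star> z" using \<open>x \<in> N\<close> \<open>int p \<star> x = 0\<close> unfolding homocyclic_def by simp
    then obtain z where "z \<in> N" "x = q' \<star> z" by blast
    then show ?thesis using top by blast
  qed
  have "x \<in> N \<Longrightarrow> int p ^ k \<star> x = 0 \<Longrightarrow> k \<le> L \<Longrightarrow> x \<in> h ` V s" for k x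
  proof (induction k arbitrary: x)
    case 0
    then show ?case using Homs_0[OF h(1) subspace_V] V_zero[of s] by force
  next
    case (Suc k)
    have "int p ^ k \<star> x \<in> ptor (h ` V s)"
      using Suc.prems pt[of "int p ^ k \<star> x"] subspace_scale[OF N'(1)] by simp
    then obtain w where w: "w \<in> ptor (V s)" "int p ^ k \<star> x = h w"
      using ptor_image[OF h subspace_V] by blast
    then obtain u where u: "u \<in> V s" "w = q' \<star> u"
      using homocyclic_V[of s] unfolding homocyclic_def by blast
    \<comment> \<open>The exponents k and L - 1 - k add up to L - 1, so p^k y = h (q' u) = h w = p^k
      x. The induction hypothesis then applies to x - y.\<close>
    define y where "y = h (int p ^ (L - 1 - k) \<star> u)"
    have y: "y \<in> h ` V s" unfolding y_def using u V_scale by blast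
    have "int p ^ k \<star> y = h (int p ^ k \<star> (int p ^ (L - 1 - k) \<star> u))"
      unfolding y_def using Homs_scale[OF h(1) subspace_V] V_scale[OF u(1)] by metis
    also have "\<dots> = int p ^ k \<star> x"
      using Suc.prems w u by (simp flip: power_add)
    finally have "int p ^ k \<star> (x - y) = 0" by (simp add: scale_right_diff_distrib)
    moreover have "y \<in> N" using y Homs_mem[OF h(1)] by blast
    ultimately have "x - y \<in> h ` V s"
      using Suc.IH[of "x - y"] Suc.prems subspace_diff[OF N'(1)] by simp
    then have "(x - y) + y \<in> h ` V s"
      using y subspace_add[OF subspace_image[OF h(1) subspace_V subspace_V subset_refl]] by blast
    then show ?case by simp
  qed
  then have "N \<subseteq> h ` V s" using N'(2) by blast
  then have "h \<in> Isos (V s) N" using h Homs_mem[OF h(1)] by (auto simp: Isos_def bij_betw_def)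
  then show ?thesis by blast
qed

end

section \<open>Direct sums and transport\<close>

context int_module
begin

definition direct :: "'v set \<Rightarrow> 'v set \<Rightarrow> 'v set \<Rightarrow> bool" where
  "direct N K1 K2 \<longleftrightarrow> subspace K1 \<and> subspace K2 \<and> K1 \<inter> K2 = {0} \<and> N = {y + z | y z. y \<in> K1 \<and> z \<in> K2}"

text \<open>The map that acts as a on K1 and as d on K2. For a direct sum the chosen decomposition
  of x is the only one (\<open>glue_eq\<close>).\<close>

definition glue :: "'v set \<Rightarrow> 'v set \<Rightarrow> ('v \<Rightarrow> 'v) \<Rightarrow> ('v \<Rightarrow> 'v) \<Rightarrow> 'v \<Rightarrow> 'v" where
  "glue K1 K2 a d x = (if \<exists>y\<in>K1. \<exists>z\<in>K2. x = y + z
     then (let (y, z) = SOME (y, z). y \<in> K1 \<and> z \<in> K2 \<and> x = y + z in a y + d z) else 0)"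

lemma direct_unique:
  assumes D: "direct N K1 K2" and "y \<in> K1" "y' \<in> K1" "z \<in> K2" "z' \<in> K2" "y + z = y' + z'"
  shows "y = y'" "z = z'"
proof -
  have "y - y' = z' - z" using assms(6) by (simp add: algebra_simps)
  moreover have "y - y' \<in> K1" "z' - z \<in> K2" using assms by (auto simp: direct_def subspace_diff)
  ultimately have "y - y' \<in> K1 \<inter> K2" by simp
  then have "y - y' = 0" using D unfolding direct_def by blast
  then show "y = y'" by simp
  then show "z = z'" using assms(6) by simp
qed

lemma direct_sym: "direct N K1 K2 \<Longrightarrow> direct N K2 K1"
proof -
  assume D: "direct N K1 K2"
  have "{y + z | y z. y \<in> K1 \<and> z \<in> K2} = {z + y | y z. y \<in> K1 \<and> z \<in> K2}"
    by (simp only: add.commute)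
  also have "\<dots> = {y + z | y z. y \<in> K2 \<and> z \<in> K1}" by blast
  finally show ?thesis using D unfolding direct_def by (simp add: Int_commute)
qed

lemma direct_obtain:
  assumes "direct N K1 K2" "x \<in> N" obtains y z where "y \<in> K1" "z \<in> K2" "x = y + z"
proof -
  have "x \<in> {y + z | y z. y \<in> K1 \<and> z \<in> K2}" using assms by (simp add: direct_def)
  then show thesis using that by blast
qed

lemma direct_sumI:
  assumes "direct N K1 K2" "y \<in> K1" "z \<in> K2" shows "y + z \<in> N"
proof -
  have "y + z \<in> {y + z | y z. y \<in> K1 \<and> z \<in> K2}" using assms(2,3) by blast
  then show ?thesis using assms(1) by (simp add: direct_def)
qed

lemma direct_subspaces: "direct N K1 K2 \<Longrightarrow> subspace K1" "direct N K1 K2 \<Longrightarrow> subspace K2"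
  by (simp_all add: direct_def)

lemma direct_subsets:
  assumes "direct N K1 K2" shows "K1 \<subseteq> N" "K2 \<subseteq> N"
proof -
  have "0 \<in> K1" "0 \<in> K2" using direct_subspaces[OF assms] subspace_0 by auto
  then show "K1 \<subseteq> N" "K2 \<subseteq> N"
    using direct_sumI[OF assms, of _ 0] direct_sumI[OF assms, of 0] by auto
qed

lemma direct_subspace:
  assumes D: "direct N K1 K2" shows "subspace N"
proof (rule subspaceI)
  note S = direct_subspaces[OF D]
  show "0 \<in> N" using subspace_0[OF S(1)] direct_subsets(1)[OF D] by blast
  fix x y assume "x \<in> N" "y \<in> N"
  then obtain a b c d where x: "a \<in> K1" "b \<in> K2" "x = a + b" and y: "c \<in> K1" "d \<in> K2" "y = c + d"
    using direct_obtain[OF D] by metis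
  have "x + y = (a + c) + (b + d)" unfolding x y by (simp add: algebra_simps)
  then show "x + y \<in> N"
    using direct_sumI[OF D] subspace_add[OF S(1) x(1) y(1)] subspace_add[OF S(2) x(2) y(2)] by simp
next
  note S = direct_subspaces[OF D]
  fix c x assume "x \<in> N"
  then obtain a b where x: "a \<in> K1" "b \<in> K2" "x = a + b" using direct_obtain[OF D] by blast
  then show "c \<star> x \<in> N"
    using direct_sumI[OF D] subspace_scale[OF S(1)] subspace_scale[OF S(2)] by (simp add: scale_right_distrib)
qed

lemma direct_bij:
  assumes D: "direct N K1 K2" shows "bij_betw (\<lambda>(y, z). y + z) (K1 \<times> K2) N"
proof (rule bij_betw_imageI)
  show "inj_on (\<lambda>(y, z). y + z) (K1 \<times> K2)"
    using direct_unique[OF D] by (auto simp: inj_on_def)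
  show "(\<lambda>(y, z). y + z) ` (K1 \<times> K2) = N" using D by (auto simp: direct_def)
qed

lemma card_direct: "direct N K1 K2 \<Longrightarrow> card N = card K1 * card K2"
  using bij_betw_same_card[OF direct_bij] by (simp add: card_cartesian_product)

lemma glue_eq:
  assumes D: "direct N K1 K2" and "y \<in> K1" "z \<in> K2"
  shows "glue K1 K2 a d (y + z) = a y + d z"
proof -
  let ?P = "\<lambda>(y', z'). y' \<in> K1 \<and> z' \<in> K2 \<and> y + z = y' + z'"
  obtain y' z' where yz: "(SOME x. ?P x) = (y', z')" by force
  have "?P (SOME x. ?P x)" by (rule someI[of ?P "(y, z)"]) (use assms in simp)
  then have "y' \<in> K1" "z' \<in> K2" "y + z = y' + z'" unfolding yz by auto
  then have "y' = y" "z' = z" using direct_unique[OF D] assms by blast+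
  moreover have "\<exists>y'\<in>K1. \<exists>z'\<in>K2. y + z = y' + z'" using assms by blast
  ultimately show ?thesis unfolding glue_def yz by simp
qed

lemma glue_left:
  assumes "direct N K1 K2" "d \<in> Homs K2 N'" "y \<in> K1" shows "glue K1 K2 a d y = a y"
  using glue_eq[OF assms(1,3) subspace_0[OF direct_subspaces(2)[OF assms(1)]], of a d]
    Homs_0[OF assms(2) direct_subspaces(2)[OF assms(1)]] by simp

lemma glue_right:
  assumes "direct N K1 K2" "a \<in> Homs K1 N'" "z \<in> K2" shows "glue K1 K2 a d z = d z"
  using glue_eq[OF assms(1) subspace_0[OF direct_subspaces(1)[OF assms(1)]] assms(3), of a d]
    Homs_0[OF assms(2) direct_subspaces(1)[OF assms(1)]] by simp

lemma glue_Homs: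
  assumes D: "direct N K1 K2" and a: "a \<in> Homs K1 N'" and d: "d \<in> Homs K2 N'" and N': "subspace N'"
  shows "glue K1 K2 a d \<in> Homs N N'"
proof (rule HomsI)
  fix x assume "x \<in> N"
  then obtain y z where x: "y \<in> K1" "z \<in> K2" "x = y + z" using direct_obtain[OF D] by blast
  then show "glue K1 K2 a d x \<in> N'"
    using glue_eq[OF D x(1,2)] Homs_mem[OF a] Homs_mem[OF d] N' by (simp add: subspace_add)
  fix x' assume "x' \<in> N"
  then obtain y' z' where x': "y' \<in> K1" "z' \<in> K2" "x' = y' + z'" using direct_obtain[OF D] by blast
  have "x + x' = (y + y') + (z + z')" unfolding x x' by (simp add: algebra_simps)
  then have "glue K1 K2 a d (x + x') = a (y + y') + d (z + z')"
    using glue_eq[OF D, of "y + y'" "z + z'"] x(1,2) x'(1,2) direct_subspaces[OF D] by (simp add: subspace_add)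
  also have "\<dots> = glue K1 K2 a d x + glue K1 K2 a d x'"
    unfolding x(3) x'(3) glue_eq[OF D x(1,2)] glue_eq[OF D x'(1,2)]
      Homs_add[OF a x(1) x'(1)] Homs_add[OF d x(2) x'(2)] by (simp add: algebra_simps)
  finally show "glue K1 K2 a d (x + x') = glue K1 K2 a d x + glue K1 K2 a d x'" .
next
  fix x assume "x \<notin> N"
  then show "glue K1 K2 a d x = 0" unfolding glue_def using direct_sumI[OF D] by auto
qed

lemma rst_glue:
  assumes D: "direct N K1 K2" and a: "a \<in> Homs K1 N'" and d: "d \<in> Homs K2 N''"
  shows "rst K1 (glue K1 K2 a d) = a" "rst K2 (glue K1 K2 a d) = d"
  using glue_left[OF D d, of _ a] glue_right[OF D a, of _ d] Homs_outside[OF a] Homs_outside[OF d]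
  by (auto simp: rst_def fun_eq_iff)

lemma glue_rst:
  assumes D: "direct N K1 K2" and f: "f \<in> Homs N N'"
  shows "glue K1 K2 (rst K1 f) (rst K2 f) = f"
proof
  fix x
  show "glue K1 K2 (rst K1 f) (rst K2 f) x = f x"
  proof (cases "x \<in> N")
    case True
    then obtain y z where x: "y \<in> K1" "z \<in> K2" "x = y + z" using direct_obtain[OF D] by blast
    then show ?thesis using glue_eq[OF D x(1,2)] Homs_add[OF f, of y z] direct_subsets[OF D]
      by (simp add: rst_def subset_iff)
  next
    case False
    then have "glue K1 K2 (rst K1 f) (rst K2 f) x = 0"
      unfolding glue_def using direct_sumI[OF D] by auto
    then show ?thesis using Homs_outside[OF f False] by simp
  qed
qed

section \<open>Transport of maps and of invariant properties along isomorphisms\<close>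

definition transport :: "'v set \<Rightarrow> ('v \<Rightarrow> 'v) \<Rightarrow> ('v \<Rightarrow> 'v) \<Rightarrow> ('v \<Rightarrow> 'v) \<Rightarrow> 'v \<Rightarrow> 'v" where
  "transport A \<alpha> \<beta> f y = (if y \<in> \<alpha> ` A then \<beta> (f (inv_into A \<alpha> y)) else 0)"

lemma IsosD: assumes "\<alpha> \<in> Isos A A'"
  shows "\<alpha> \<in> Homs A A'" "inj_on \<alpha> A" "\<alpha> ` A = A'" "bij_betw \<alpha> A A'"
  using assms by (auto simp: Isos_def bij_betw_def)

lemma transport_apply: "\<alpha> \<in> Isos A A' \<Longrightarrow> x \<in> A \<Longrightarrow> transport A \<alpha> \<beta> f (\<alpha> x) = \<beta> (f x)"
  using IsosD(2)[of \<alpha> A A'] by (simp add: transport_def)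

lemma transport_Homs:
  assumes \<alpha>: "\<alpha> \<in> Isos A A'" and \<beta>: "\<beta> \<in> Homs B B'" and f: "f \<in> Homs A B" and A: "subspace A"
  shows "transport A \<alpha> \<beta> f \<in> Homs A' B'"
proof (rule HomsI)
  fix x assume "x \<in> A'"
  then obtain a where a: "a \<in> A" "x = \<alpha> a" using IsosD(3)[OF \<alpha>] by blast
  then show "transport A \<alpha> \<beta> f x \<in> B'"
    using transport_apply[OF \<alpha> a(1)] Homs_mem[OF \<beta>] Homs_mem[OF f] by simp
  fix y assume "y \<in> A'"
  then obtain b where b: "b \<in> A" "y = \<alpha> b" using IsosD(3)[OF \<alpha>] by blast
  have "x + y = \<alpha> (a + b)" using a b Homs_add[OF IsosD(1)[OF \<alpha>]] by simp
  then have "transport A \<alpha> \<beta> f (x + y) = \<beta> (f (a + b))"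
    using transport_apply[OF \<alpha>] subspace_add[OF A a(1) b(1)] by simp
  also have "\<dots> = \<beta> (f a) + \<beta> (f b)"
    using Homs_add[OF f a(1) b(1)] Homs_add[OF \<beta>] Homs_mem[OF f] a b by simp
  finally show "transport A \<alpha> \<beta> f (x + y) = transport A \<alpha> \<beta> f x + transport A \<alpha> \<beta> f y"
    using a b transport_apply[OF \<alpha>] by simp
next
  fix x assume "x \<notin> A'"
  then show "transport A \<alpha> \<beta> f x = 0" using IsosD(3)[OF \<alpha>] by (simp add: transport_def)
qed

text \<open>\<open>inv_into\<close> is cut off to 0 outside A', as membership in \<open>Homs\<close>
  demands.\<close>

abbreviation iso_inv :: "'v set \<Rightarrow> 'v set \<Rightarrow> ('v \<Rightarrow> 'v) \<Rightarrow> 'v \<Rightarrow> 'v" where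
  "iso_inv A A' \<alpha> \<equiv> rst A' (inv_into A \<alpha>)"

lemma iso_inv_left: "\<alpha> \<in> Isos A A' \<Longrightarrow> x \<in> A \<Longrightarrow> iso_inv A A' \<alpha> (\<alpha> x) = x"
  by (auto simp: Isos_def bij_betw_def rst_def)

lemma iso_inv_right: "\<alpha> \<in> Isos A A' \<Longrightarrow> x \<in> A' \<Longrightarrow> \<alpha> (iso_inv A A' \<alpha> x) = x"
  by (auto simp: Isos_def bij_betw_def rst_def f_inv_into_f)

lemma Isos_inv:
  assumes \<alpha>: "\<alpha> \<in> Isos A A'" and A: "subspace A" shows "iso_inv A A' \<alpha> \<in> Isos A' A"
proof -
  have "iso_inv A A' \<alpha> \<in> Homs A' A"
  proof (rule HomsI)
    fix x assume "x \<in> A'"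
    then obtain a where a: "a \<in> A" "x = \<alpha> a" using IsosD(3)[OF \<alpha>] by blast
    then show "iso_inv A A' \<alpha> x \<in> A" using iso_inv_left[OF \<alpha>] by simp
    fix y assume "y \<in> A'"
    then obtain b where b: "b \<in> A" "y = \<alpha> b" using IsosD(3)[OF \<alpha>] by blast
    have "x + y = \<alpha> (a + b)" using a b Homs_add[OF IsosD(1)[OF \<alpha>]] by simp
    then show "iso_inv A A' \<alpha> (x + y) = iso_inv A A' \<alpha> x + iso_inv A A' \<alpha> y"
      using iso_inv_left[OF \<alpha>] a b subspace_add[OF A a(1) b(1)] by simp
  qed (simp add: rst_def)
  moreover have "bij_betw (iso_inv A A' \<alpha>) A' A"
    using bij_betw_inv_into[OF IsosD(4)[OF \<alpha>]] by (rule bij_betw_cong[THEN iffD1, rotated]) (simp add: rst_def)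
  ultimately show ?thesis by (simp add: Isos_def)
qed

lemma transport_bij:
  assumes \<alpha>: "\<alpha> \<in> Isos A A'" and \<beta>: "\<beta> \<in> Isos B B'" and A: "subspace A" and B: "subspace B" and A': "subspace A'"
  shows "bij_betw (transport A \<alpha> \<beta>) (Homs A B) (Homs A' B')"
proof -
  let ?\<alpha> = "iso_inv A A' \<alpha>" and ?\<beta> = "iso_inv B B' \<beta>"
  note i = Isos_inv[OF \<alpha> A] Isos_inv[OF \<beta> B]
  have T1: "transport A \<alpha> \<beta> f \<in> Homs A' B'" if "f \<in> Homs A B" for f
    by (rule transport_Homs[OF \<alpha> IsosD(1)[OF \<beta>] that A])
  have T2: "transport A' ?\<alpha> ?\<beta> f \<in> Homs A B" if "f \<in> Homs A' B'" for f
    by (rule transport_Homs[OF i(1) IsosD(1)[OF i(2)] that A'])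
  show ?thesis
  proof (rule bij_betw_byWitness[where f' = "transport A' ?\<alpha> ?\<beta>"])
    show "\<forall>f\<in>Homs A B. transport A' ?\<alpha> ?\<beta> (transport A \<alpha> \<beta> f) = f"
    proof
      fix f assume f: "f \<in> Homs A B"
      have "transport A' ?\<alpha> ?\<beta> (transport A \<alpha> \<beta> f) x = f x" if "x \<in> A" for x
      proof -
        have "transport A' ?\<alpha> ?\<beta> (transport A \<alpha> \<beta> f) x = ?\<beta> (transport A \<alpha> \<beta> f (\<alpha> x))"
          using transport_apply[OF i(1), of "\<alpha> x"] iso_inv_left[OF \<alpha> that] Homs_mem[OF IsosD(1)[OF \<alpha>] that] by simp
        then show ?thesis using transport_apply[OF \<alpha> that] iso_inv_left[OF \<beta>] Homs_mem[OF f that] by simp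
      qed
      then show "transport A' ?\<alpha> ?\<beta> (transport A \<alpha> \<beta> f) = f" by (rule Homs_eqI[OF T2[OF T1[OF f]] f])
    qed
    show "\<forall>f\<in>Homs A' B'. transport A \<alpha> \<beta> (transport A' ?\<alpha> ?\<beta> f) = f"
    proof
      fix f assume f: "f \<in> Homs A' B'"
      have "transport A \<alpha> \<beta> (transport A' ?\<alpha> ?\<beta> f) x = f x" if "x \<in> A'" for x
      proof -
        have "transport A \<alpha> \<beta> (transport A' ?\<alpha> ?\<beta> f) x = \<beta> (transport A' ?\<alpha> ?\<beta> f (?\<alpha> x))"
          using transport_apply[OF \<alpha>, of "?\<alpha> x"] iso_inv_right[OF \<alpha> that] Homs_mem[OF IsosD(1)[OF i(1)] that] by simp
        then show ?thesis using transport_apply[OF i(1) that] iso_inv_right[OF \<beta>] Homs_mem[OF f that] by simp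
      qed
      then show "transport A \<alpha> \<beta> (transport A' ?\<alpha> ?\<beta> f) = f" by (rule Homs_eqI[OF T1[OF T2[OF f]] f])
    qed
  qed (use T1 T2 in auto)
qed

lemma card_Isos_transport:
  assumes \<alpha>: "\<alpha> \<in> Isos A A'" and \<beta>: "\<beta> \<in> Isos B B'" and A: "subspace A" and B: "subspace B" and A': "subspace A'"
  shows "card (Isos A B) = card (Isos A' B')"
proof (rule bij_betw_same_card)
  have *: "bij_betw (transport A \<alpha> \<beta> f) A' B' \<longleftrightarrow> bij_betw f A B" if f: "f \<in> Homs A B" for f
  proof -
    have "bij_betw f A B \<longleftrightarrow> bij_betw (\<beta> \<circ> f) A B'"
      by (rule bij_betw_comp_iff2[OF IsosD(4)[OF \<beta>]]) (use Homs_mem[OF f] in auto)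
    also have "\<dots> \<longleftrightarrow> bij_betw (transport A \<alpha> \<beta> f \<circ> \<alpha>) A B'"
      using transport_apply[OF \<alpha>] by (intro bij_betw_cong) simp
    also have "\<dots> \<longleftrightarrow> bij_betw (transport A \<alpha> \<beta> f) A' B'"
      by (rule bij_betw_comp_iff[OF IsosD(4)[OF \<alpha>], symmetric])
    finally show ?thesis by simp
  qed
  show "bij_betw (transport A \<alpha> \<beta>) (Isos A B) (Isos A' B')"
  proof (rule bij_betw_subset[OF transport_bij[OF assms]])
    show "Isos A B \<subseteq> Homs A B" using Isos_subset_Monos Monos_subset by blast
    show "transport A \<alpha> \<beta> ` Isos A B = Isos A' B'"
    proof safe
      fix f assume "f \<in> Isos A B"
      then show "transport A \<alpha> \<beta> f \<in> Isos A' B'"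
        using *[of f] transport_Homs[OF \<alpha> IsosD(1)[OF \<beta>] _ A, of f] by (simp add: Isos_def)
    next
      fix g assume g: "g \<in> Isos A' B'"
      then obtain f where "f \<in> Homs A B" "g = transport A \<alpha> \<beta> f"
        using bij_betw_imp_surj_on[OF transport_bij[OF assms]] IsosD(1) by blast
      then show "g \<in> transport A \<alpha> \<beta> ` Isos A B" using g * by (auto simp: Isos_def)
    qed
  qed
qed

text \<open>One implication suffices: applied to the inverse isomorphism it gives the equivalence
  \<open>iso_invariantD\<close>.\<close>

definition iso_invariant :: "('v set \<Rightarrow> ('v \<Rightarrow> 'v) \<Rightarrow> bool) \<Rightarrow> bool" where
  "iso_invariant P \<longleftrightarrow> (\<forall>N N' \<theta> f f'. subspace N \<longrightarrow> subspace N' \<longrightarrow> \<theta> \<in> Isos N N' \<longrightarrow>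
     f \<in> Homs N N \<longrightarrow> f' \<in> Homs N' N' \<longrightarrow> (\<forall>x\<in>N. \<theta> (f x) = f' (\<theta> x)) \<longrightarrow> P N f \<longrightarrow> P N' f')"

lemma iso_invariantE:
  "iso_invariant P \<Longrightarrow> subspace N \<Longrightarrow> subspace N' \<Longrightarrow> \<theta> \<in> Isos N N' \<Longrightarrow> f \<in> Homs N N \<Longrightarrow>
    f' \<in> Homs N' N' \<Longrightarrow> (\<And>x. x \<in> N \<Longrightarrow> \<theta> (f x) = f' (\<theta> x)) \<Longrightarrow> P N f \<Longrightarrow> P N' f'"
  by (rule iso_invariant_def[THEN iffD1, rule_format])

lemma iso_invariantD:
  assumes P: "iso_invariant P" and "subspace N" "subspace N'" and \<theta>: "\<theta> \<in> Isos N N'"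
    and f: "f \<in> Homs N N" and f': "f' \<in> Homs N' N'" and comm: "\<And>x. x \<in> N \<Longrightarrow> \<theta> (f x) = f' (\<theta> x)"
  shows "P N f \<longleftrightarrow> P N' f'"
proof
  assume "P N f"
  then show "P N' f'" using iso_invariantE[OF P assms(2,3) \<theta> f f'] comm by blast
next
  assume P': "P N' f'"
  let ?\<theta> = "iso_inv N N' \<theta>"
  have "?\<theta> (f' y) = f (?\<theta> y)" if "y \<in> N'" for y
  proof -
    obtain x where x: "x \<in> N" "y = \<theta> x" using \<open>y \<in> N'\<close> IsosD(3)[OF \<theta>] by blast
    then show ?thesis using comm[OF x(1)] iso_inv_left[OF \<theta>] Homs_mem[OF f] by metis
  qed
  then show "P N f" using iso_invariantE[OF P assms(3,2) Isos_inv[OF \<theta> assms(2)] f' f _ P'] by blast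
qed

text \<open>Allows a count over an abstract summand to be replaced by the count over the V_s
  isomorphic to it.\<close>

lemma card_iso_invariant:
  assumes P: "iso_invariant P" and N: "subspace N" "subspace N'" and \<theta>: "\<theta> \<in> Isos N N'"
  shows "card {f \<in> Homs N N. P N f} = card {f \<in> Homs N' N'. P N' f}"
proof (rule bij_betw_same_card)
  note B = transport_bij[OF \<theta> \<theta> N(1) N(1) N(2)]
  have T: "transport N \<theta> \<theta> f \<in> Homs N' N'" if "f \<in> Homs N N" for f
    using that B bij_betwE by blast
  have *: "P N' (transport N \<theta> \<theta> f) \<longleftrightarrow> P N f" if "f \<in> Homs N N" for f
    using iso_invariantD[OF P N \<theta> that T[OF that]] transport_apply[OF \<theta>] by metis
  show "bij_betw (transport N \<theta> \<theta>) {f \<in> Homs N N. P N f} {f \<in> Homs N' N'. P N' f}"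
  proof (rule bij_betw_subset[OF B])
    show "transport N \<theta> \<theta> ` {f \<in> Homs N N. P N f} = {f \<in> Homs N' N'. P N' f}"
    proof safe
      fix g assume "g \<in> Homs N' N'" "P N' g"
      then obtain f where "f \<in> Homs N N" "g = transport N \<theta> \<theta> f"
        using bij_betw_imp_surj_on[OF B] by blast
      then show "g \<in> transport N \<theta> \<theta> ` {f \<in> Homs N N. P N f}" using \<open>P N' g\<close> * by auto
    qed (use T * in auto)
  qed auto
qed

end

section \<open>Fitting decompositions\<close>

context int_module
begin

text \<open>The exponent may depend on x; on a finite module there is a common one.\<close>

definition nilp :: "'v set \<Rightarrow> ('v \<Rightarrow> 'v) \<Rightarrow> bool" where
  "nilp K f \<longleftrightarrow> (\<forall>x\<in>K. \<exists>k. (f ^^ k) x = 0)"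

definition fitting :: "'v set \<Rightarrow> ('v \<Rightarrow> 'v) \<Rightarrow> 'v set \<Rightarrow> 'v set \<Rightarrow> bool" where
  "fitting N f K1 K2 \<longleftrightarrow> direct N K1 K2 \<and> f ` K1 \<subseteq> K1 \<and> f ` K2 \<subseteq> K2 \<and> nilp K1 f \<and> inj_on f K2"

definition shift :: "'v set \<Rightarrow> int \<Rightarrow> ('v \<Rightarrow> 'v) \<Rightarrow> 'v \<Rightarrow> 'v" where
  "shift N t f x = (if x \<in> N then f x + t \<star> x else 0)"

lemma funpow_mem: "f ` K \<subseteq> K \<Longrightarrow> x \<in> K \<Longrightarrow> (f ^^ k) x \<in> K"
  by (induction k) auto

lemma funpow_eq_on:
  assumes "f ` K \<subseteq> K" "\<And>x. x \<in> K \<Longrightarrow> f x = g x" "x \<in> K" shows "(f ^^ k) x = (g ^^ k) x"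
proof (induction k)
  case (Suc k) then show ?case using assms(2)[OF funpow_mem[OF assms(1,3), of k]] by simp
qed simp

lemma nilp_cong:
  assumes "f ` K \<subseteq> K" "\<And>x. x \<in> K \<Longrightarrow> f x = g x" shows "nilp K f \<longleftrightarrow> nilp K g"
  unfolding nilp_def using funpow_eq_on[OF assms] by simp

lemma Homs_image: "f \<in> Homs N N' \<Longrightarrow> f ` N \<subseteq> N'"
  by (auto simp: Homs_def)

lemma funpow_Homs:
  assumes f: "f \<in> Homs N N" and N: "subspace N"
  shows "rst N (f ^^ k) \<in> Homs N N"
proof (rule HomsI)
  note M = funpow_mem[OF Homs_image[OF f]]
  fix x assume x: "x \<in> N"
  then show "rst N (f ^^ k) x \<in> N" using M by (simp add: rst_def)
  fix y assume y: "y \<in> N"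
  have "(f ^^ k) (x + y) = (f ^^ k) x + (f ^^ k) y"
    by (induction k) (use M x y Homs_add[OF f] in auto)
  then show "rst N (f ^^ k) (x + y) = rst N (f ^^ k) x + rst N (f ^^ k) y"
    using x y N by (simp add: rst_def subspace_add)
qed (simp add: rst_def)

lemma funpow_add_Homs:
  "f \<in> Homs N N \<Longrightarrow> subspace N \<Longrightarrow> x \<in> N \<Longrightarrow> y \<in> N \<Longrightarrow> (f ^^ k) (x + y) = (f ^^ k) x + (f ^^ k) y"
  using Homs_add[OF funpow_Homs, of f N x y k] by (simp add: rst_def subspace_add)

lemma funpow_diff_Homs:
  "f \<in> Homs N N \<Longrightarrow> subspace N \<Longrightarrow> x \<in> N \<Longrightarrow> y \<in> N \<Longrightarrow> (f ^^ k) (x - y) = (f ^^ k) x - (f ^^ k) y"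
  using Homs_diff[OF funpow_Homs, of f N x y k] by (simp add: rst_def subspace_diff)

lemma funpow_scale_Homs:
  "f \<in> Homs N N \<Longrightarrow> subspace N \<Longrightarrow> x \<in> N \<Longrightarrow> (f ^^ k) (c \<star> x) = c \<star> (f ^^ k) x"
  using Homs_scale[OF funpow_Homs, of f N x k c] by (simp add: rst_def subspace_scale)

lemma funpow_0_Homs: "f \<in> Homs N N \<Longrightarrow> subspace N \<Longrightarrow> (f ^^ k) 0 = 0"
  using Homs_0[OF funpow_Homs, of f N k] by (simp add: rst_def subspace_0)

lemma funpow_surj_on: assumes "f ` K = K" shows "(f ^^ k) ` K = K"
proof (induction k)
  case (Suc k)
  have "(f ^^ Suc k) ` K = f ` ((f ^^ k) ` K)" by (simp add: image_image)
  then show ?case using Suc assms by simp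
qed simp

lemma finite_Isos: "finite N \<Longrightarrow> finite N' \<Longrightarrow> finite (Isos N N')"
  by (rule finite_subset[OF _ finite_Homs[of N N']]) (auto simp: Isos_def)

lemma finite_direct_pairs: assumes "finite N" shows "finite {(K1, K2). direct N K1 K2}"
proof (rule finite_subset)
  show "{(K1, K2). direct N K1 K2} \<subseteq> Pow N \<times> Pow N"
    by (auto dest: subsetD[OF direct_subsets(1)] subsetD[OF direct_subsets(2)])
qed (use assms in simp)

text \<open>The images of the powers of f decrease and, N being finite, become stationary at some
  exponent M. Then the kernel and the image of f^M are the two summands.\<close>

lemma ex_fitting:
  assumes f: "f \<in> Homs N N" and N: "subspace N" "finite N"
  shows "\<exists>K1 K2. fitting N f K1 K2"
proof -
  define I where "I k = (f ^^ k) ` N" for k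
  have fin: "finite (I k)" for k unfolding I_def using N by simp
  have I_Suc: "I (Suc k) = f ` I k" for k unfolding I_def by (simp add: image_comp)
  have I_sub: "I (Suc k) \<subseteq> I k" for k
    unfolding I_def funpow_Suc_right image_comp[symmetric] using Homs_image[OF f] by blast
  have "\<exists>M. I (Suc M) = I M"
  proof (rule ccontr)
    assume "\<nexists>M. I (Suc M) = I M"
    then have "card (I (Suc k)) < card (I k)" for k
      using psubset_card_mono[OF fin] I_sub by blast
    then have "card (I k) + k \<le> card (I 0)" for k
      by (induction k) (auto, metis Suc_leI add_Suc_right le_trans add_less_mono1 )
    from this[of "Suc (card (I 0))"] show False by simp
  qed
  then obtain M where M: "I (Suc M) = I M" by blast
  define K1 where "K1 = {x \<in> N. (f ^^ M) x = 0}"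
  define K2 where "K2 = I M"
  have fK2: "f ` K2 = K2" using M I_Suc unfolding K2_def by simp
  have K2N: "K2 \<subseteq> N" unfolding K2_def I_def using funpow_mem[OF Homs_image[OF f]] by blast
  have finK2: "finite K2" unfolding K2_def by (rule fin)
  have injM: "inj_on (f ^^ M) K2"
    by (rule eq_card_imp_inj_on[OF finK2]) (simp add: funpow_surj_on[OF fK2])
  have sK1: "subspace K1"
    unfolding K1_def by (rule subspaceI)
      (use N subspace_0 in \<open>auto simp: subspace_add subspace_scale funpow_add_Homs[OF f N(1)]
        funpow_scale_Homs[OF f N(1)] funpow_0_Homs[OF f N(1)]\<close>)
  have sK2: "subspace K2"
  proof -
    have "rst N (f ^^ M) ` N = K2" unfolding K2_def I_def by (auto simp: rst_def)
    then show ?thesis using subspace_image[OF funpow_Homs[OF f N(1), of M] N(1) N(1)] by simp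
  qed
  have "K1 \<inter> K2 = {0}"
  proof -
    have "x = 0" if "x \<in> K1" "x \<in> K2" for x
      using inj_onD[OF injM _ that(2) subspace_0[OF sK2]] that(1) funpow_0_Homs[OF f N(1)]
      by (simp add: K1_def)
    then show ?thesis using subspace_0[OF sK1] subspace_0[OF sK2] by blast
  qed
  moreover have "N = {y + z | y z. y \<in> K1 \<and> z \<in> K2}"
  proof (intro equalityI subsetI)
    fix x assume x: "x \<in> N"
    \<comment> \<open>Since f^M permutes K2, some y in K2 has the same image under f^M as x; the
      difference x - y lies in the kernel.\<close>
    then have "(f ^^ M) x \<in> (f ^^ M) ` K2" using funpow_surj_on[OF fK2] by (auto simp: K2_def I_def)
    then obtain y where y: "y \<in> K2" "(f ^^ M) x = (f ^^ M) y" by auto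
    then have "x - y \<in> K1" using x K2N funpow_diff_Homs[OF f N(1), of x y M] subspace_diff[OF N(1)]
      unfolding K1_def by auto
    moreover have "x = (x - y) + y" by simp
    ultimately show "x \<in> {y + z | y z. y \<in> K1 \<and> z \<in> K2}" using y by blast
  next
    fix x assume "x \<in> {y + z | y z. y \<in> K1 \<and> z \<in> K2}"
    then show "x \<in> N" using K2N subspace_add[OF N(1)] unfolding K1_def by auto
  qed
  moreover have "f ` K1 \<subseteq> K1"
    unfolding K1_def using Homs_mem[OF f] Homs_0[OF f N(1)]
    by (auto simp: funpow_swap1[symmetric])
  moreover have "nilp K1 f" unfolding nilp_def K1_def by blast
  moreover have "inj_on f K2" by (rule eq_card_imp_inj_on[OF finK2]) (simp add: fK2)
  ultimately have "fitting N f K1 K2" unfolding fitting_def direct_def using sK1 sK2 fK2 by simp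
  then show ?thesis by blast
qed

text \<open>Describes both summands by f alone. Hence each f has just one Fitting decomposition
  (\<open>fitting_eq\<close>), and sums over decompositions count nothing twice.\<close>

lemma fitting_unique:
  assumes F: "fitting N f K1 K2" and f: "f \<in> Homs N N" and N: "finite N"
  shows "K1 = {x \<in> N. \<exists>k. (f ^^ k) x = 0}" "K2 = {x \<in> N. \<forall>k. x \<in> (f ^^ k) ` N}"
proof -
  have D: "direct N K1 K2" and st: "f ` K1 \<subseteq> K1" "f ` K2 \<subseteq> K2" and nil: "nilp K1 f" and inj: "inj_on f K2"
    using F unfolding fitting_def by auto
  note S = direct_subspace[OF D] direct_subspaces[OF D] and sub = direct_subsets[OF D]
  have fin: "finite K1" "finite K2" using sub N finite_subset by auto
  have fK2: "f ` K2 = K2" using st(2) inj fin(2) by (simp add: endo_inj_surj)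
  have injk: "inj_on (f ^^ k) K2" for k
    by (rule eq_card_imp_inj_on[OF fin(2)]) (simp add: funpow_surj_on[OF fK2])
  have mono: "(f ^^ (k + j)) y = 0" if "(f ^^ k) y = 0" for y k j
    using that funpow_0_Homs[OF f S(1)] by (simp add: add.commute[of k] funpow_add)
  show "K1 = {x \<in> N. \<exists>k. (f ^^ k) x = 0}"
  proof (intro equalityI subsetI)
    fix x assume "x \<in> {x \<in> N. \<exists>k. (f ^^ k) x = 0}"
    then obtain k where x: "x \<in> N" "(f ^^ k) x = 0" by blast
    then obtain y z where yz: "y \<in> K1" "z \<in> K2" "x = y + z" using direct_obtain[OF D] by blast
    then obtain j where j: "(f ^^ j) y = 0" using nil unfolding nilp_def by blast
    have "(f ^^ (k + j)) x = (f ^^ (k + j)) y + (f ^^ (k + j)) z"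
      using funpow_add_Homs[OF f S(1)] yz sub by blast
    then have "(f ^^ (k + j)) z = (f ^^ (k + j)) 0"
      using mono[OF x(2), of j] mono[OF j, of k] funpow_0_Homs[OF f S(1)] by (simp add: add.commute)
    then have "z = 0" using inj_onD[OF injk _ yz(2) subspace_0[OF S(3)]] by blast
    then show "x \<in> K1" using yz by simp
  qed (use nil sub in \<open>auto simp: nilp_def\<close>)
  obtain e where e: "\<And>y. y \<in> K1 \<Longrightarrow> (f ^^ e y) y = 0" using nil unfolding nilp_def by metis
  \<comment> \<open>The sum of the individual exponents is a common exponent for the finite set
    K1.\<close>
  have M: "(f ^^ (\<Sum>y\<in>K1. e y)) y = 0" if "y \<in> K1" for y
  proof -
    have "e y \<le> (\<Sum>y\<in>K1. e y)" using fin(1) that by (simp add: member_le_sum)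
    then show ?thesis using mono[OF e[OF that], of "(\<Sum>y\<in>K1. e y) - e y"] by simp
  qed
  show "K2 = {x \<in> N. \<forall>k. x \<in> (f ^^ k) ` N}"
  proof (intro equalityI subsetI)
    fix x assume "x \<in> K2"
    then show "x \<in> {x \<in> N. \<forall>k. x \<in> (f ^^ k) ` N}"
      using sub funpow_surj_on[OF fK2] by blast
  next
    fix x assume "x \<in> {x \<in> N. \<forall>k. x \<in> (f ^^ k) ` N}"
    then obtain w where w: "w \<in> N" "x = (f ^^ (\<Sum>y\<in>K1. e y)) w" by blast
    then obtain y z where yz: "y \<in> K1" "z \<in> K2" "w = y + z" using direct_obtain[OF D] by blast
    have "x = (f ^^ (\<Sum>y\<in>K1. e y)) y + (f ^^ (\<Sum>y\<in>K1. e y)) z"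
      unfolding w(2) yz(3) using funpow_add_Homs[OF f S(1)] yz sub by blast
    then show "x \<in> K2" using M[OF yz(1)] funpow_mem[OF st(2) yz(2)] by simp
  qed
qed

lemma fitting_eq:
  assumes "fitting N f K1 K2" "fitting N f K1' K2'" "f \<in> Homs N N" "finite N"
  shows "K1 = K1'" "K2 = K2'"
proof -
  show "K1 = K1'"
    by (rule trans[OF fitting_unique(1)[OF assms(1,3,4)] fitting_unique(1)[OF assms(2,3,4), symmetric]])
  show "K2 = K2'"
    by (rule trans[OF fitting_unique(2)[OF assms(1,3,4)] fitting_unique(2)[OF assms(2,3,4), symmetric]])
qed

lemma shift_Homs: "f \<in> Homs N N \<Longrightarrow> subspace N \<Longrightarrow> shift N t f \<in> Homs N N"
  by (rule HomsI) (auto simp: shift_def subspace_add subspace_scale Homs_mem Homs_add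
      scale_right_distrib algebra_simps)

lemma shift_stable_iff:
  assumes K: "subspace K" "K \<subseteq> N" shows "shift N t f ` K \<subseteq> K \<longleftrightarrow> f ` K \<subseteq> K"
proof -
  have "f x + t \<star> x \<in> K \<longleftrightarrow> f x \<in> K" if "x \<in> K" for x
    using subspace_add[OF K(1), of "f x" "t \<star> x"] subspace_diff[OF K(1), of "f x + t \<star> x" "t \<star> x"]
      subspace_scale[OF K(1) that] by auto
  then show ?thesis using K(2) by (auto simp: shift_def image_subset_iff)
qed

text \<open>A scalar shift does not change which submodules are stable, so the condition separates
  into one on each restriction of f.\<close>

lemma fitting_shift_iff:
  assumes D: "direct N K1 K2" and f: "f \<in> Homs N N"
  shows "fitting N (shift N t f) K1 K2 \<longleftrightarrow> rst K1 f \<in> Homs K1 K1 \<and> rst K2 f \<in> Homs K2 K2 \<and>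
    nilp K1 (shift K1 t (rst K1 f)) \<and> inj_on (shift K2 t (rst K2 f)) K2"
proof -
  note S = direct_subspaces[OF D] and sub = direct_subsets[OF D]
  have H: "rst K f \<in> Homs K K \<longleftrightarrow> f ` K \<subseteq> K" if "subspace K" "K \<subseteq> N" for K
    using rst_Homs[OF f that, of K] Homs_image[of "rst K f" K K] by (auto simp: rst_def)
  have eq: "shift K t (rst K f) x = shift N t f x" if "x \<in> K" "K \<subseteq> N" for K x
    using that by (auto simp: shift_def rst_def)
  have "nilp K1 (shift K1 t (rst K1 f)) \<longleftrightarrow> nilp K1 (shift N t f)" if "f ` K1 \<subseteq> K1"
  proof (rule nilp_cong[symmetric])
    show "shift N t f ` K1 \<subseteq> K1" using that shift_stable_iff[OF S(1) sub(1)] by simp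
  qed (rule eq[symmetric, OF _ sub(1)])
  moreover have "inj_on (shift K2 t (rst K2 f)) K2 \<longleftrightarrow> inj_on (shift N t f) K2"
    by (rule inj_on_cong) (rule eq[OF _ sub(2)])
  ultimately show ?thesis
    unfolding fitting_def using D H[OF S(1) sub(1)] H[OF S(2) sub(2)]
      shift_stable_iff[OF S(1) sub(1)] shift_stable_iff[OF S(2) sub(2)] by auto
qed

text \<open>Restriction to the two summands and \<open>glue\<close> are mutually inverse.\<close>

lemma card_fitting:
  assumes D: "direct N K1 K2"
    and split: "\<And>f. f \<in> Homs N N \<Longrightarrow> P f \<and> fitting N (shift N t f) K1 K2 \<longleftrightarrow>
      rst K1 f \<in> Homs K1 K1 \<and> rst K2 f \<in> Homs K2 K2 \<and> Q1 K1 (rst K1 f) \<and> Q2 K2 (rst K2 f)"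
  shows "card {f \<in> Homs N N. P f \<and> fitting N (shift N t f) K1 K2} =
    card {a \<in> Homs K1 K1. Q1 K1 a} * card {d \<in> Homs K2 K2. Q2 K2 d}"
proof -
  let ?A = "{f \<in> Homs N N. P f \<and> fitting N (shift N t f) K1 K2}"
  let ?B = "{a \<in> Homs K1 K1. Q1 K1 a} \<times> {d \<in> Homs K2 K2. Q2 K2 d}"
  note sub = direct_subsets[OF D]
  have g: "glue K1 K2 a d \<in> Homs N N" if "a \<in> Homs K1 K1" "d \<in> Homs K2 K2" for a d
  proof (rule glue_Homs[OF D _ _ direct_subspace[OF D]])
    show "a \<in> Homs K1 N" "d \<in> Homs K2 N" using that sub by (auto simp: Homs_def)
  qed
  have "bij_betw (\<lambda>f. (rst K1 f, rst K2 f)) ?A ?B"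
  proof (rule bij_betw_byWitness[where f' = "\<lambda>(a, d). glue K1 K2 a d"])
    show "\<forall>f\<in>?A. (\<lambda>(a, d). glue K1 K2 a d) (rst K1 f, rst K2 f) = f"
      using glue_rst[OF D] by auto
    show "\<forall>b\<in>?B. (rst K1 ((\<lambda>(a, d). glue K1 K2 a d) b), rst K2 ((\<lambda>(a, d). glue K1 K2 a d) b)) = b"
      using rst_glue[OF D] by auto
    show "(\<lambda>f. (rst K1 f, rst K2 f)) ` ?A \<subseteq> ?B" using split by auto
    show "(\<lambda>(a, d). glue K1 K2 a d) ` ?B \<subseteq> ?A"
    proof safe
      fix a d assume a: "a \<in> Homs K1 K1" "Q1 K1 a" and d: "d \<in> Homs K2 K2" "Q2 K2 d"
      show "glue K1 K2 a d \<in> Homs N N" using g a d by blast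
      have "P (glue K1 K2 a d) \<and> fitting N (shift N t (glue K1 K2 a d)) K1 K2"
        using split[OF g[OF a(1) d(1)]] rst_glue[OF D a(1) d(1)] a d by simp
      then show "P (glue K1 K2 a d)" "fitting N (shift N t (glue K1 K2 a d)) K1 K2" by auto
    qed
  qed
  then show ?thesis by (simp add: bij_betw_same_card card_cartesian_product)
qed

text \<open>Existence and uniqueness of the Fitting decomposition of f + t partition the
  endomorphisms by their decomposition.\<close>

lemma card_sum_fitting:
  assumes N: "subspace N" "finite N"
    and split: "\<And>f K1 K2. direct N K1 K2 \<Longrightarrow> f \<in> Homs N N \<Longrightarrow> P f \<and> fitting N (shift N t f) K1 K2 \<longleftrightarrow>
      rst K1 f \<in> Homs K1 K1 \<and> rst K2 f \<in> Homs K2 K2 \<and> Q1 K1 (rst K1 f) \<and> Q2 K2 (rst K2 f)"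
  shows "card {f \<in> Homs N N. P f} = (\<Sum>(K1, K2) \<in> {(K1, K2). direct N K1 K2}.
    card {a \<in> Homs K1 K1. Q1 K1 a} * card {d \<in> Homs K2 K2. Q2 K2 d})"
proof -
  let ?D = "{(K1, K2). direct N K1 K2}"
  let ?F = "\<lambda>(K1, K2). {f \<in> Homs N N. P f \<and> fitting N (shift N t f) K1 K2}"
  have fin: "finite ?D" by (rule finite_direct_pairs[OF N(2)])
  have "{f \<in> Homs N N. P f} = (\<Union>x\<in>?D. ?F x)"
  proof (intro equalityI subsetI)
    fix f assume f: "f \<in> {f \<in> Homs N N. P f}"
    then obtain K1 K2 where K: "fitting N (shift N t f) K1 K2"
      using ex_fitting[OF shift_Homs N(1,2)] N(1) by blast
    then have "(K1, K2) \<in> ?D" by (simp add: fitting_def)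
    moreover have "f \<in> ?F (K1, K2)" using K f by simp
    ultimately show "f \<in> (\<Union>x\<in>?D. ?F x)" by (rule UN_I)
  qed auto
  moreover have "card (\<Union>x\<in>?D. ?F x) = (\<Sum>x\<in>?D. card (?F x))"
  proof (rule card_UN_disjoint[OF fin])
    show "\<forall>x\<in>?D. finite (?F x)" using finite_Homs[OF N(2) N(2)] by auto
    have "x = y" if f: "f \<in> ?F x" "f \<in> ?F y" for f x y
    proof -
      obtain K1 K2 K1' K2' where xy: "x = (K1, K2)" "y = (K1', K2')" by (cases x; cases y)
      have F: "fitting N (shift N t f) K1 K2" "fitting N (shift N t f) K1' K2'" "f \<in> Homs N N"
        using f unfolding xy by auto
      show ?thesis unfolding xy
        using fitting_eq[OF F(1,2) shift_Homs[OF F(3) N(1)] N(2)] by blast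
    qed
    then show "\<forall>x\<in>?D. \<forall>y\<in>?D. x \<noteq> y \<longrightarrow> ?F x \<inter> ?F y = {}" by blast
  qed
  moreover have "card (?F x) = (case x of (K1, K2) \<Rightarrow>
      card {a \<in> Homs K1 K1. Q1 K1 a} * card {d \<in> Homs K2 K2. Q2 K2 d})" if "x \<in> ?D" for x
  proof -
    obtain K1 K2 where x: "x = (K1, K2)" "direct N K1 K2" using \<open>x \<in> ?D\<close> by (cases x) auto
    show ?thesis unfolding x(1) using card_fitting[where P = P and ?Q1.0 = Q1 and ?Q2.0 = Q2, OF x(2) split[OF x(2)]] by simp
  qed
  ultimately show ?thesis by simp
qed

end

section \<open>Decompositions of V_n and the convolution of masses\<close>

context torsion_basis
begin

text \<open>Write x = q' v with v in N and project to K1: the component y of v satisfies x = q'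
  y.\<close>

lemma homocyclic_summand:
  assumes N: "homocyclic N" and D: "direct N K1 K2" shows "homocyclic K1"
proof -
  note S = direct_subspaces[OF D] and sub = direct_subsets[OF D]
  have "\<exists>z\<in>K1. x = q' \<star> z" if x: "x \<in> K1" "int p \<star> x = 0" for x
  proof -
    obtain v where v: "v \<in> N" "x = q' \<star> v"
      using N x sub unfolding homocyclic_def by blast
    obtain y z where yz: "y \<in> K1" "z \<in> K2" "v = y + z" using direct_obtain[OF D v(1)] by blast
    have "x + 0 = q' \<star> y + q' \<star> z"
      using v yz by (simp add: scale_right_distrib)
    then have "x = q' \<star> y"
      by (rule direct_unique(1)[OF D, rotated -1])
        (use x yz S in \<open>auto simp: subspace_scale subspace_0\<close>)
    then show ?thesis using yz by blast
  qed
  moreover have "finite K1" using sub N finite_subset unfolding homocyclic_def by blast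
  ultimately show ?thesis using S sub N unfolding homocyclic_def by blast
qed

lemma Isos_card: "\<alpha> \<in> Isos A B \<Longrightarrow> card A = card B"
  using IsosD(4) bij_betw_same_card by blast

lemma card_V_inj: "card (V m) = card (V n) \<Longrightarrow> m = n"
  using p_gt_1 L_pos power_inject_exp[of "p ^ L" m n] one_less_power[of p L] by (simp add: card_V)

lemma homocyclic_card_Iso:
  assumes "homocyclic N" "card N = card (V s)" shows "Isos (V s) N \<noteq> {}"
proof -
  obtain r \<alpha> where \<alpha>: "\<alpha> \<in> Isos (V r) N" using homocyclic_Iso_V[OF assms(1)] by blast
  have "r = s" by (rule card_V_inj) (simp only: Isos_card[OF \<alpha>] assms(2))
  then show ?thesis using \<alpha> by blast
qed

text \<open>The remaining basis vectors e_s, ..., e_(n-1) span a complement; the induction adds one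
  of them at a time.\<close>

lemma V_complement: "s \<le> n \<Longrightarrow> \<exists>C. direct (V n) (V s) C"
proof (induction n rule: dec_induct)
  case base
  have "direct (V s) (V s) {0}" using subspace_V V_zero by (auto simp: direct_def)
  then show ?case by blast
next
  case (step n)
  then obtain C where C: "direct (V n) (V s) C" by blast
  note S = direct_subspaces[OF C] and sub = direct_subsets[OF C]
  let ?C = "{c + k \<star> e n | c k. c \<in> C}"
  have CI: "c + k \<star> e n \<in> ?C" if "c \<in> C" for c k using that by blast
  have "subspace ?C"
  proof (rule subspaceI)
    show "0 \<in> ?C" using CI[OF subspace_0[OF S(2)], of 0] by simp
    fix x y assume "x \<in> ?C" "y \<in> ?C"
    then obtain c k c' k' where *: "x = c + k \<star> e n" "c \<in> C" "y = c' + k' \<star> e n" "c' \<in> C" by auto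
    then have "x + y = (c + c') + (k + k') \<star> e n" by (simp add: scale_left_distrib algebra_simps)
    then show "x + y \<in> ?C" using CI[OF subspace_add[OF S(2) *(2,4)]] by simp
  next
    fix d x assume "x \<in> ?C"
    then obtain c k where *: "x = c + k \<star> e n" "c \<in> C" by auto
    then have "d \<star> x = d \<star> c + (d * k) \<star> e n" by (simp add: scale_right_distrib)
    then show "d \<star> x \<in> ?C" using CI[OF subspace_scale[OF S(2) *(2)]] by simp
  qed
  moreover have "V s \<inter> ?C = {0}"
  proof -
    have "x = 0" if x: "x \<in> V s" and "x \<in> ?C" for x
    proof -
      obtain c k where c: "x = c + k \<star> e n" "c \<in> C" using \<open>x \<in> ?C\<close> by auto
      have "(c - x) + k \<star> e n = 0" using c by simp
      moreover have "c - x \<in> V n" using c x sub V_diff by blast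
      ultimately have "q dvd k" using V_indep by blast
      then have "x = c" using scale_e_eq_0 c by simp
      then show ?thesis using C x c unfolding direct_def by blast
    qed
    moreover have "0 \<in> ?C" using CI[OF subspace_0[OF S(2)], of 0] by simp
    ultimately show ?thesis using subspace_0[OF S(1)] by blast
  qed
  moreover have "V (Suc n) = {y + z | y z. y \<in> V s \<and> z \<in> ?C}"
  proof (intro equalityI subsetI)
    fix x assume "x \<in> V (Suc n)"
    then obtain v k where v: "x = v + k \<star> e n" "v \<in> V n" unfolding V_Suc by blast
    then obtain y z where yz: "y \<in> V s" "z \<in> C" "v = y + z" using direct_obtain[OF C] by blast
    then have "x = y + (z + k \<star> e n)" using v by (simp add: add.assoc)
    then show "x \<in> {y + z | y z. y \<in> V s \<and> z \<in> ?C}" using yz CI by blast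
  next
    fix x assume "x \<in> {y + z | y z. y \<in> V s \<and> z \<in> ?C}"
    then obtain y z k where "y \<in> V s" "z \<in> C" "x = (y + z) + k \<star> e n" by (auto simp: add.assoc)
    then show "x \<in> V (Suc n)" using V_SucI direct_sumI[OF C] by simp
  qed
  ultimately show ?case unfolding direct_def using S(1) by blast
qed

abbreviation End :: "nat \<Rightarrow> ('v \<Rightarrow> 'v) set" where "End n \<equiv> Homs (V n) (V n)"

abbreviation Aut :: "nat \<Rightarrow> ('v \<Rightarrow> 'v) set" where "Aut n \<equiv> Isos (V n) (V n)"

text \<open>Fixing the cardinality of K1 fixes its rank and, for s <= n, the isomorphism types of
  both summands (\<open>summand_pair_Isos\<close>).\<close>

abbreviation summand_pairs :: "nat \<Rightarrow> nat \<Rightarrow> ('v set \<times> 'v set) set" where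
  "summand_pairs n s \<equiv> {(K1, K2). direct (V n) K1 K2 \<and> card K1 = card (V s)}"

lemma summand_pair_Isos:
  assumes "(K1, K2) \<in> summand_pairs n s" "s \<le> n"
  shows "Isos (V s) K1 \<noteq> {}" "Isos (V (n - s)) K2 \<noteq> {}"
proof -
  have D: "direct (V n) K1 K2" and c: "card K1 = card (V s)" using assms by auto
  note h1 = homocyclic_summand[OF homocyclic_V D]
    and h2 = homocyclic_summand[OF homocyclic_V direct_sym[OF D]]
  show "Isos (V s) K1 \<noteq> {}" by (rule homocyclic_card_Iso[OF h1 c])
  have "card (V n) = card (V s) * card (V (n - s))"
    using assms(2) by (simp add: card_V flip: power_add)
  moreover have "card (V s) > 0" using p_gt_1 by (simp add: card_V)
  ultimately have "card K2 = card (V (n - s))" using card_direct[OF D] c by simp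
  then show "Isos (V (n - s)) K2 \<noteq> {}" by (rule homocyclic_card_Iso[OF h2])
qed

lemma direct_image:
  assumes D: "direct N K1 K2" and \<theta>: "\<theta> \<in> Isos N N'" shows "direct N' (\<theta> ` K1) (\<theta> ` K2)"
proof -
  note S = direct_subspace[OF D] direct_subspaces[OF D] and sub = direct_subsets[OF D]
  note \<theta>' = IsosD[OF \<theta>]
  have "\<theta> ` K1 \<inter> \<theta> ` K2 = \<theta> ` (K1 \<inter> K2)"
    using inj_on_image_Int[OF \<theta>'(2) sub] by simp
  also have "K1 \<inter> K2 = {0}" using D by (simp add: direct_def)
  also have "\<theta> ` {0} = {0}" using Homs_0[OF \<theta>'(1) S(1)] by simp
  finally have "\<theta> ` K1 \<inter> \<theta> ` K2 = {0}" .
  moreover have "N' = {y + z | y z. y \<in> \<theta> ` K1 \<and> z \<in> \<theta> ` K2}"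
  proof (intro equalityI subsetI)
    fix x assume "x \<in> N'"
    then obtain u where u: "u \<in> N" "x = \<theta> u" using \<theta>'(3) by blast
    then obtain y z where yz: "y \<in> K1" "z \<in> K2" "u = y + z" using direct_obtain[OF D] by blast
    then have "x = \<theta> y + \<theta> z" using u Homs_add[OF \<theta>'(1)] sub by blast
    then show "x \<in> {y + z | y z. y \<in> \<theta> ` K1 \<and> z \<in> \<theta> ` K2}" using yz by blast
  next
    fix x assume "x \<in> {y + z | y z. y \<in> \<theta> ` K1 \<and> z \<in> \<theta> ` K2}"
    then obtain y z where yz: "y \<in> K1" "z \<in> K2" "x = \<theta> y + \<theta> z" by blast
    then have "x = \<theta> (y + z)" using Homs_add[OF \<theta>'(1), of y z] sub by (simp add: subset_iff)
    then show "x \<in> N'" using Homs_mem[OF \<theta>'(1) direct_sumI[OF D yz(1,2)]] by simp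
  qed
  ultimately show ?thesis
    unfolding direct_def using subspace_image[OF \<theta>'(1) S(1)] S sub by simp
qed

lemma id_Aut: "rst (V n) id \<in> Aut n"
  using subspace_V by (auto simp: Isos_def bij_betw_def inj_on_def rst_def subspace_add intro!: HomsI)

text \<open>An automorphism that carries (V_s, C) to (K1, K2) amounts to an arbitrary pair of
  isomorphisms between the summands, glued together.\<close>

lemma card_Aut_split:
  assumes D: "direct (V n) (V s) C" and K: "(K1, K2) \<in> summand_pairs n s" and s: "s \<le> n"
  shows "card {\<theta> \<in> Aut n. \<theta> ` V s = K1 \<and> \<theta> ` C = K2} =
    card (Aut s) * card (Aut (n - s))"
proof -
  let ?A = "{\<theta> \<in> Aut n. \<theta> ` V s = K1 \<and> \<theta> ` C = K2}"
  let ?B = "Isos (V s) K1 \<times> Isos C K2"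
  have D': "direct (V n) K1 K2" using K by auto
  note S = direct_subspaces[OF D] and sub = direct_subsets[OF D]
  note S' = direct_subspaces[OF D'] and sub' = direct_subsets[OF D']
  have glueI: "glue (V s) C a d \<in> ?A" if a: "a \<in> Isos (V s) K1" and d: "d \<in> Isos C K2" for a d
  proof -
    note a' = IsosD[OF a] and d' = IsosD[OF d]
    have aH: "a \<in> Homs (V s) (V n)" and dH: "d \<in> Homs C (V n)"
      using a'(1) d'(1) sub' by (auto simp: Homs_def)
    have H: "glue (V s) C a d \<in> End n" by (rule glue_Homs[OF D aH dH subspace_V])
    have "inj_on (glue (V s) C a d) (V n)"
      unfolding Homs_inj_iff[OF H subspace_V]
    proof (intro ballI impI)
      fix x assume "x \<in> V n" and 0: "glue (V s) C a d x = 0"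
      then obtain y z where yz: "y \<in> V s" "z \<in> C" "x = y + z" using direct_obtain[OF D] by blast
      have eq: "a y + d z = 0 + 0" using 0 glue_eq[OF D yz(1,2), of a d] yz(3) by simp
      have "a y = 0" "d z = 0"
        using direct_unique[OF D' Homs_mem[OF a'(1) yz(1)] subspace_0[OF S'(1)]
          Homs_mem[OF d'(1) yz(2)] subspace_0[OF S'(2)] eq] by auto
      then have "y = 0" "z = 0" using Homs_inj_iff[OF a'(1) S(1)] Homs_inj_iff[OF d'(1) S(2)] a'(2) d'(2) yz
        by auto
      then show "x = 0" using yz by simp
    qed
    then have "glue (V s) C a d \<in> Aut n" unfolding Isos_V Monos_def using H by simp
    moreover have "glue (V s) C a d ` V s = K1" "glue (V s) C a d ` C = K2"
      using glue_left[OF D dH] glue_right[OF D aH] a'(3) d'(3) by (auto simp: image_def)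
    ultimately show ?thesis by simp
  qed
  have "bij_betw (\<lambda>\<theta>. (rst (V s) \<theta>, rst C \<theta>)) ?A ?B"
  proof (rule bij_betw_byWitness[where f' = "\<lambda>(a, d). glue (V s) C a d"])
    show "\<forall>\<theta>\<in>?A. (\<lambda>(a, d). glue (V s) C a d) (rst (V s) \<theta>, rst C \<theta>) = \<theta>"
      by (auto intro!: glue_rst[OF D] dest: IsosD(1))
    show "\<forall>b\<in>?B. (rst (V s) ((\<lambda>(a, d). glue (V s) C a d) b), rst C ((\<lambda>(a, d). glue (V s) C a d) b)) = b"
      using rst_glue[OF D IsosD(1) IsosD(1)] by auto
    show "(\<lambda>(a, d). glue (V s) C a d) ` ?B \<subseteq> ?A"
      using glueI by (intro image_subsetI) (simp only: mem_Times_iff split_beta)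
    show "(\<lambda>\<theta>. (rst (V s) \<theta>, rst C \<theta>)) ` ?A \<subseteq> ?B"
    proof safe
      fix \<theta> assume \<theta>: "\<theta> \<in> Aut n" and K12: "K1 = \<theta> ` V s" "K2 = \<theta> ` C"
      have R: "rst K \<theta> \<in> Isos K (\<theta> ` K)" if "subspace K" "K \<subseteq> V n" for K
      proof -
        have "rst K \<theta> \<in> Homs K (\<theta> ` K)" by (rule rst_Homs[OF IsosD(1)[OF \<theta>] that]) simp
        moreover have "bij_betw \<theta> K (\<theta> ` K)"
          using inj_on_subset[OF IsosD(2)[OF \<theta>] that(2)] by (simp add: bij_betw_def)
        then have "bij_betw (rst K \<theta>) K (\<theta> ` K)"
          by (rule bij_betw_cong[THEN iffD1, rotated]) (simp add: rst_def)
        ultimately show ?thesis by (simp add: Isos_def)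
      qed
      show "rst (V s) \<theta> \<in> Isos (V s) (\<theta> ` V s)" by (rule R[OF S(1) sub(1)])
      show "rst C \<theta> \<in> Isos C (\<theta> ` C)" by (rule R[OF S(2) sub(2)])
    qed
  qed
  then have "card ?A = card (Isos (V s) K1) * card (Isos C K2)"
    by (simp add: bij_betw_same_card card_cartesian_product)
  moreover have "(V s, C) \<in> summand_pairs n s" using D by simp
  then obtain \<gamma> where \<gamma>: "\<gamma> \<in> Isos (V (n - s)) C" using summand_pair_Isos(2)[OF _ s] by blast
  obtain \<alpha> where \<alpha>: "\<alpha> \<in> Isos (V s) K1" using summand_pair_Isos(1)[OF K s] by blast
  obtain \<beta> where \<beta>: "\<beta> \<in> Isos (V (n - s)) K2" using summand_pair_Isos(2)[OF K s] by blast
  have "card (Aut s) = card (Isos (V s) K1)"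
    by (rule card_Isos_transport[OF id_Aut \<alpha> subspace_V subspace_V subspace_V])
  moreover have "card (Aut (n - s)) = card (Isos C K2)"
    by (rule card_Isos_transport[OF \<gamma> \<beta> subspace_V subspace_V S(2)])
  ultimately show ?thesis by simp
qed

text \<open>Orbit-stabiliser: Aut V_n acts transitively on the decompositions of type (s, n - s),
  with stabilisers of order |Aut V_s| |Aut V_(n-s)|. The proof partitions Aut V_n by the image of
  one fixed decomposition.\<close>

lemma card_summand_pairs:
  assumes s: "s \<le> n"
  shows "card (summand_pairs n s) * (card (Aut s) * card (Aut (n - s))) =
    card (Aut n)"
proof -
  obtain C where D: "direct (V n) (V s) C" using V_complement[OF s] by blast
  let ?F = "\<lambda>(K1, K2). {\<theta> \<in> Aut n. \<theta> ` V s = K1 \<and> \<theta> ` C = K2}"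
  have fin: "finite (summand_pairs n s)"
    by (rule finite_subset[OF _ finite_direct_pairs[OF finite_V]]) auto
  have finI: "finite (Aut n)" by (intro finite_Isos finite_V)
  have "Aut n = (\<Union>x\<in>summand_pairs n s. ?F x)"
  proof (intro equalityI subsetI)
    fix \<theta> assume \<theta>: "\<theta> \<in> Aut n"
    have "card (\<theta> ` V s) = card (V s)"
      using card_image[OF inj_on_subset[OF IsosD(2)[OF \<theta>] direct_subsets(1)[OF D]]] .
    then have "(\<theta> ` V s, \<theta> ` C) \<in> summand_pairs n s" using direct_image[OF D \<theta>] by simp
    moreover have "\<theta> \<in> ?F (\<theta> ` V s, \<theta> ` C)" using \<theta> by simp
    ultimately show "\<theta> \<in> (\<Union>x\<in>summand_pairs n s. ?F x)" by (rule UN_I)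
  qed auto
  moreover have "card (\<Union>x\<in>summand_pairs n s. ?F x) = (\<Sum>x\<in>summand_pairs n s. card (?F x))"
    by (rule card_UN_disjoint[OF fin]) (use finI in auto)
  moreover have "card (?F x) = card (Aut s) * card (Aut (n - s))"
    if "x \<in> summand_pairs n s" for x
    using card_Aut_split[OF D _ s] that by (cases x) simp
  ultimately show ?thesis by simp
qed

definition mass :: "('v set \<Rightarrow> ('v \<Rightarrow> 'v) \<Rightarrow> bool) \<Rightarrow> nat \<Rightarrow> real" where
  "mass P n = real (card {f \<in> End n. P (V n) f}) / real (card (Aut n))"

lemma card_Isos_pos: "card (Aut n) > 0"
proof -
  have "finite (Aut n)" by (intro finite_Isos finite_V)
  then show ?thesis using id_Aut card_gt_0_iff by blast
qed

text \<open>The decompositions are grouped by the rank s of K1. Within a group all contribute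
  equally, by invariance, and \<open>card_summand_pairs\<close> turns their number into exactly the
  ratio of the weights.\<close>

theorem mass_convolution:
  assumes inv: "iso_invariant Q1" "iso_invariant Q2"
    and split: "\<And>f K1 K2. direct (V n) K1 K2 \<Longrightarrow> f \<in> End n \<Longrightarrow>
      P (V n) f \<and> fitting (V n) (shift (V n) t f) K1 K2 \<longleftrightarrow>
      rst K1 f \<in> Homs K1 K1 \<and> rst K2 f \<in> Homs K2 K2 \<and> Q1 K1 (rst K1 f) \<and> Q2 K2 (rst K2 f)"
  shows "mass P n = (\<Sum>s\<le>n. mass Q1 s * mass Q2 (n - s))"
proof -
  let ?D = "{(K1, K2). direct (V n) K1 K2}"
  let ?g = "\<lambda>(K1, K2). card {a \<in> Homs K1 K1. Q1 K1 a} * card {d \<in> Homs K2 K2. Q2 K2 d}"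
  let ?c = "\<lambda>Q s. card {a \<in> End s. Q (V s) a}"
  let ?A = "\<lambda>s. card (Aut s)"
  have finD: "finite ?D" by (rule finite_direct_pairs[OF finite_V])
  then have fin: "finite (summand_pairs n s)" for s by (rule finite_subset[rotated]) auto
  \<comment> \<open>The first summand is homocyclic, hence isomorphic to some V_s; comparing
    cardinalities gives s <= n.\<close>
  have D_eq: "?D = (\<Union>s\<in>{..n}. summand_pairs n s)"
  proof (intro equalityI subsetI)
    fix x assume "x \<in> ?D"
    then obtain K1 K2 where x: "x = (K1, K2)" "direct (V n) K1 K2" by auto
    obtain s \<alpha> where "\<alpha> \<in> Isos (V s) K1"
      using homocyclic_Iso_V[OF homocyclic_summand[OF homocyclic_V x(2)]] by blast
    then have c: "card K1 = card (V s)" using Isos_card by metis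
    have "card (V s) \<le> card (V n)" using c card_mono[OF finite_V direct_subsets(1)[OF x(2)]] by simp
    then have "s \<le> n"
      using p_gt_1 L_pos power_le_imp_le_exp[of "p ^ L" s n] one_less_power[of p L] by (simp add: card_V)
    then show "x \<in> (\<Union>s\<in>{..n}. summand_pairs n s)" using x c by auto
  qed auto
  have "card {f \<in> End n. P (V n) f} = (\<Sum>x\<in>?D. ?g x)"
    using card_sum_fitting[OF subspace_V finite_V split] by simp
  also have "\<dots> = (\<Sum>s\<le>n. \<Sum>x\<in>summand_pairs n s. ?g x)"
    unfolding D_eq
  proof (rule sum.UNION_disjoint)
    have "summand_pairs n s \<inter> summand_pairs n s' = {}" if "s \<noteq> s'" for s s'
      using that card_V_inj[of s s'] by auto
    then show "\<forall>s\<in>{..n}. \<forall>s'\<in>{..n}. s \<noteq> s' \<longrightarrow> summand_pairs n s \<inter> summand_pairs n s' = {}"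
      by blast
  qed (use fin in auto)
  also have "\<dots> = (\<Sum>s\<le>n. card (summand_pairs n s) * (?c Q1 s * ?c Q2 (n - s)))"
  proof (rule sum.cong[OF refl])
    fix s assume "s \<in> {..n}"
    then have s: "s \<le> n" by simp
    have "?g x = ?c Q1 s * ?c Q2 (n - s)" if x: "x \<in> summand_pairs n s" for x
    proof -
      obtain K1 K2 where K: "x = (K1, K2)" "(K1, K2) \<in> summand_pairs n s" using x by (cases x) auto
      have D: "direct (V n) K1 K2" using K(2) by simp
      obtain \<alpha> \<beta> where "\<alpha> \<in> Isos (V s) K1" "\<beta> \<in> Isos (V (n - s)) K2"
        using summand_pair_Isos[OF K(2) s] by blast
      then show ?thesis
        using card_iso_invariant[OF inv(1) subspace_V direct_subspaces(1)[OF D]]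
          card_iso_invariant[OF inv(2) subspace_V direct_subspaces(2)[OF D]] K(1) by simp
    qed
    then show "(\<Sum>x\<in>summand_pairs n s. ?g x) = card (summand_pairs n s) * (?c Q1 s * ?c Q2 (n - s))"
      by simp
  qed
  finally have "mass P n = (\<Sum>s\<le>n. real (card (summand_pairs n s)) * (real (?c Q1 s) * real (?c Q2 (n - s)))) / real (?A n)"
    unfolding mass_def by simp
  also have "\<dots> = (\<Sum>s\<le>n. mass Q1 s * mass Q2 (n - s))"
    unfolding sum_divide_distrib
  proof (rule sum.cong[OF refl])
    fix s assume "s \<in> {..n}"
    then have "real (card (summand_pairs n s)) * (real (?A s) * real (?A (n - s))) = real (?A n)"
      using card_summand_pairs[of s n] by (simp flip: of_nat_mult)
    then show "real (card (summand_pairs n s)) * (real (?c Q1 s) * real (?c Q2 (n - s))) / real (?A n) =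
        mass Q1 s * mass Q2 (n - s)"
      unfolding mass_def using card_Isos_pos[of s] card_Isos_pos[of "n - s"] card_Isos_pos[of n]
      by (simp add: field_simps) 
  qed
  finally show ?thesis .
qed

end

section \<open>Conditions on the cokernels of shifts\<close>

context torsion_basis
begin

text \<open>\<open>K / g K \<cong> H\<close>, expressed by the map \<open>K \<rightarrow> H\<close> that induces the isomorphism.\<close>

definition has_cok :: "'v set \<Rightarrow> ('v \<Rightarrow> 'v) \<Rightarrow> 'h monoid \<Rightarrow> bool" where
  "has_cok K g H \<longleftrightarrow> (\<exists>\<psi>. (\<forall>x\<in>K. \<forall>y\<in>K. \<psi> (x + y) = \<psi> x \<otimes>\<^bsub>H\<^esub> \<psi> y) \<and>
     \<psi> ` K = carrier H \<and> (\<forall>x\<in>K. \<psi> x = \<one>\<^bsub>H\<^esub> \<longleftrightarrow> x \<in> g ` K))"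

lemma has_cok_cong: "(\<And>x. x \<in> K \<Longrightarrow> f x = g x) \<Longrightarrow> has_cok K f H \<longleftrightarrow> has_cok K g H"
  unfolding has_cok_def by (simp cong: image_cong)

lemma shift_rst: "x \<in> K \<Longrightarrow> K \<subseteq> N \<Longrightarrow> shift K t (rst K f) x = shift N t f x"
  by (auto simp: shift_def rst_def)

lemma bezout_scale:
  assumes "\<not> int p dvd c" "int p \<star> x = 0" "c \<star> x = 0" shows "x = 0"
proof -
  obtain a where a: "q dvd a * c - 1" using ex_inverse_mod_q[OF assms(1)] by blast
  have "q \<star> x = q' \<star> (int p \<star> x)" unfolding scale_scale q_eq by (simp only: mult.commute)
  then have "x = (a * c) \<star> x" using torsion_mod[of x "a * c" 1] a assms(2) by simp
  also have "\<dots> = a \<star> (c \<star> x)" by simp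
  finally show ?thesis using assms(3) by simp
qed

lemma not_dvd_power: "\<not> int p dvd c \<Longrightarrow> \<not> int p dvd c ^ k"
  using prime_p by (metis prime_dvd_power prime_nat_int_transfer)

text \<open>On the kernel of f + i the map f + j is multiplication by j - i, which is a unit modulo
  p; no power of it kills a nonzero element of the p-torsion.\<close>

lemma nilp_shift_inj:
  assumes f: "f \<in> Homs K K" and K: "subspace K" "\<And>z. z \<in> K \<Longrightarrow> q \<star> z = 0"
    and nil: "nilp K (shift K j f)" and ij: "\<not> int p dvd i - j"
  shows "inj_on (shift K i f) K"
proof -
  note S = shift_Homs[OF f K(1)]
  have "\<forall>x\<in>ptor K. shift K i f x = 0 \<longrightarrow> x = 0"
  proof (intro ballI impI)
    fix x assume x: "x \<in> ptor K" "shift K i f x = 0"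
    have e: "shift K j f x = (j - i) \<star> x"
      using x by (simp add: shift_def scale_left_diff_distrib eq_neg_iff_add_eq_0[symmetric])
    have pow: "(shift K j f ^^ k) x = (j - i) ^ k \<star> x" for k
    proof (induction k)
      case (Suc k)
      have "shift K j f ((j - i) ^ k \<star> x) = (j - i) ^ k \<star> shift K j f x"
        using Homs_scale[OF S K(1)] x by blast
      then show ?case using Suc e by (simp add: mult.commute)
    qed simp
    obtain k where "(shift K j f ^^ k) x = 0" using nil x unfolding nilp_def by blast
    then have "(j - i) ^ k \<star> x = 0" using pow by simp
    moreover have "\<not> int p dvd (j - i) ^ k" using ij not_dvd_power by (metis dvd_diff_commute)
    ultimately show "x = 0" using bezout_scale x by blast
  qed
  then show ?thesis using Homs_inj_iff_ptor[OF S K] by blast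
qed

text \<open>The two shifts coincide on the p-torsion, where injectivity is decided.\<close>

lemma shift_inj_cong:
  assumes f: "f \<in> Homs K K" and K: "subspace K" "\<And>z. z \<in> K \<Longrightarrow> q \<star> z = 0"
    and ij: "int p dvd i - j" and inj: "inj_on (shift K j f) K"
  shows "inj_on (shift K i f) K"
proof -
  have "shift K i f x = shift K j f x" if "x \<in> ptor K" for x
  proof -
    obtain c where "i - j = int p * c" using ij by (elim dvdE)
    then have "i = j + c * int p" by (simp add: algebra_simps)
    then have "i \<star> x = j \<star> x + c \<star> (int p \<star> x)" by (simp add: scale_left_distrib)
    also have "int p \<star> x = 0" using that by blast
    finally show ?thesis using that by (simp add: shift_def)
  qed
  then show ?thesis
    using inj Homs_inj_iff_ptor[OF shift_Homs[OF f K(1)] K] by simp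
qed

lemma inj_on_direct_iff:
  assumes D: "direct N K1 K2" and g: "g \<in> Homs N N" and st: "g ` K1 \<subseteq> K1" "g ` K2 \<subseteq> K2"
  shows "inj_on g N \<longleftrightarrow> inj_on g K1 \<and> inj_on g K2"
proof
  assume "inj_on g N"
  then show "inj_on g K1 \<and> inj_on g K2" using direct_subsets[OF D] inj_on_subset by blast
next
  assume inj: "inj_on g K1 \<and> inj_on g K2"
  note S = direct_subspace[OF D] direct_subspaces[OF D] and sub = direct_subsets[OF D]
  show "inj_on g N"
    unfolding Homs_inj_iff[OF g S(1)]
  proof (intro ballI impI)
    fix x assume "x \<in> N" and 0: "g x = 0"
    then obtain y z where yz: "y \<in> K1" "z \<in> K2" "x = y + z" using direct_obtain[OF D] by blast
    have "y \<in> N" "z \<in> N" using yz sub by auto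
    then have eq: "g y + g z = 0 + 0" using 0 yz Homs_add[OF g] by simp
    have m: "g y \<in> K1" "g z \<in> K2" using st yz by auto
    have "g y = 0" "g z = 0"
      using direct_unique[OF D m(1) subspace_0[OF S(2)] m(2) subspace_0[OF S(3)] eq] by auto
    then have "y = 0" "z = 0"
      using inj yz S subspace_0 Homs_0[OF g S(1)] by (metis inj_onD)+
    then show "x = 0" using yz by simp
  qed
qed

text \<open>On the finite module K2 the injective map g is onto, so K2 adds nothing to the cokernel.
  Maps to H are carried over by restriction to K1 and by composition with the projection onto
  K1.\<close>

lemma has_cok_direct:
  assumes H: "group H" and D: "direct N K1 K2" and g: "g \<in> Homs N N"
    and st: "g ` K1 \<subseteq> K1" "g ` K2 \<subseteq> K2" and inj: "inj_on g K2" and fin: "finite N"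
  shows "has_cok N g H \<longleftrightarrow> has_cok K1 g H"
proof -
  interpret H: group H by (rule H)
  note S = direct_subspace[OF D] direct_subspaces[OF D] and sub = direct_subsets[OF D]
  have gK2: "g ` K2 = K2"
    using st(2) inj finite_subset[OF sub(2) fin] by (simp add: endo_inj_surj)
  have one: "\<psi> 0 = \<one>\<^bsub>H\<^esub>" if "\<forall>x\<in>K. \<forall>y\<in>K. \<psi> (x + y) = \<psi> x \<otimes>\<^bsub>H\<^esub> \<psi> y" "\<psi> ` K = carrier H" "subspace K" for \<psi> K
  proof -
    have "0 \<in> K" using that subspace_0 by blast
    moreover from this have "\<psi> 0 = \<psi> 0 \<otimes>\<^bsub>H\<^esub> \<psi> 0" using that(1) by (metis add.right_neutral)
    moreover have "\<psi> 0 \<in> carrier H" using that \<open>0 \<in> K\<close> by blast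
    ultimately show ?thesis using H.l_cancel_one' by metis
  qed
  define \<pi> where "\<pi> = glue K1 K2 (rst K1 id) (\<lambda>_. 0)"
  have \<pi>: "\<pi> \<in> Homs N K1"
    unfolding \<pi>_def using S subspace_0[OF S(2)]
    by (intro glue_Homs[OF D]) (auto intro!: HomsI simp: rst_def subspace_add)
  have \<pi>_eq: "\<pi> (y + z) = y" if "y \<in> K1" "z \<in> K2" for y z
    unfolding \<pi>_def using glue_eq[OF D that] that by (simp add: rst_def)
  have \<pi>_id: "\<pi> y = y" if "y \<in> K1" for y using \<pi>_eq[OF that subspace_0[OF S(3)]] by simp
  have \<pi>_diff: "x - \<pi> x \<in> K2" if "x \<in> N" for x
    using direct_obtain[OF D that] \<pi>_eq by (metis add_diff_cancel_left')
  \<comment> \<open>Only the K1-component decides membership in the image of g, because the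
    K2-component always lies in it.\<close>
  have img: "x \<in> g ` N \<longleftrightarrow> \<pi> x \<in> g ` K1" if x: "x \<in> N" for x
  proof
    assume "x \<in> g ` N"
    then obtain u where "u \<in> N" "x = g u" by blast
    then obtain a b where ab: "a \<in> K1" "b \<in> K2" "x = g (a + b)" using direct_obtain[OF D] by metis
    then have "x = g a + g b" using Homs_add[OF g, of a b] sub by auto
    then have "\<pi> x = g a" using \<pi>_eq st ab by blast
    then show "\<pi> x \<in> g ` K1" using ab by blast
  next
    assume "\<pi> x \<in> g ` K1"
    then obtain a where a: "a \<in> K1" "\<pi> x = g a" by blast
    obtain b where b: "b \<in> K2" "x - \<pi> x = g b" using \<pi>_diff[OF x] gK2 by blast
    have "a \<in> N" "b \<in> N" using a b sub by auto
    then have "g (a + b) = g a + g b" "a + b \<in> N"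
      using Homs_add[OF g] subspace_add[OF S(1)] by auto
    moreover have "x = \<pi> x + (x - \<pi> x)" by simp
    ultimately show "x \<in> g ` N" using a b by (metis image_eqI)
  qed
  show ?thesis
  proof
    assume "has_cok N g H"
    then obtain \<psi> where \<psi>: "\<forall>x\<in>N. \<forall>y\<in>N. \<psi> (x + y) = \<psi> x \<otimes>\<^bsub>H\<^esub> \<psi> y" "\<psi> ` N = carrier H"
      "\<forall>x\<in>N. \<psi> x = \<one>\<^bsub>H\<^esub> \<longleftrightarrow> x \<in> g ` N" unfolding has_cok_def by blast
    have z1: "\<psi> z = \<one>\<^bsub>H\<^esub>" if "z \<in> K2" for z using \<psi>(3) gK2 sub that by blast
    have "\<psi> ` K1 = carrier H"
    proof (intro equalityI subsetI)
      fix h assume "h \<in> carrier H"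
      then obtain x where x: "x \<in> N" "h = \<psi> x" using \<psi>(2) by blast
      then obtain y z where yz: "y \<in> K1" "z \<in> K2" "x = y + z" using direct_obtain[OF D] by blast
      have "y \<in> N" "z \<in> N" using yz sub by auto
      then have "h = \<psi> y \<otimes>\<^bsub>H\<^esub> \<one>\<^bsub>H\<^esub>" using \<psi>(1) z1[OF yz(2)] x yz by simp
      moreover have "\<psi> y \<in> carrier H" using \<psi>(2) \<open>y \<in> N\<close> by blast
      ultimately show "h \<in> \<psi> ` K1" using yz by simp
    qed (use \<psi>(2) sub in blast)
    moreover have "\<forall>x\<in>K1. \<forall>y\<in>K1. \<psi> (x + y) = \<psi> x \<otimes>\<^bsub>H\<^esub> \<psi> y" using \<psi>(1) sub by blast
    moreover have "\<forall>x\<in>K1. \<psi> x = \<one>\<^bsub>H\<^esub> \<longleftrightarrow> x \<in> g ` K1" using \<psi>(3) sub img \<pi>_id by (metis subsetD)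
    ultimately show "has_cok K1 g H" unfolding has_cok_def by blast
  next
    assume "has_cok K1 g H"
    then obtain \<psi> where \<psi>: "\<forall>x\<in>K1. \<forall>y\<in>K1. \<psi> (x + y) = \<psi> x \<otimes>\<^bsub>H\<^esub> \<psi> y" "\<psi> ` K1 = carrier H"
      "\<forall>x\<in>K1. \<psi> x = \<one>\<^bsub>H\<^esub> \<longleftrightarrow> x \<in> g ` K1" unfolding has_cok_def by blast
    have "\<forall>x\<in>N. \<forall>y\<in>N. (\<psi> \<circ> \<pi>) (x + y) = (\<psi> \<circ> \<pi>) x \<otimes>\<^bsub>H\<^esub> (\<psi> \<circ> \<pi>) y"
      using \<psi>(1) Homs_add[OF \<pi>] Homs_mem[OF \<pi>] by simp
    moreover have "(\<psi> \<circ> \<pi>) ` N = carrier H"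
    proof -
      have "\<pi> ` N = K1" using \<pi>_id Homs_mem[OF \<pi>] sub by (auto simp: image_iff) (metis subsetD)
      then show ?thesis using \<psi>(2) by (metis image_comp)
    qed
    moreover have "\<forall>x\<in>N. (\<psi> \<circ> \<pi>) x = \<one>\<^bsub>H\<^esub> \<longleftrightarrow> x \<in> g ` N" using \<psi>(3) img Homs_mem[OF \<pi>] by simp
    ultimately show "has_cok N g H" unfolding has_cok_def by blast
  qed
qed

lemma iso_invariant_ball:
  assumes P: "\<And>j. j \<in> A \<Longrightarrow> iso_invariant (P j)"
  shows "iso_invariant (\<lambda>K f. \<forall>j\<in>A. P j K f)"
  unfolding iso_invariant_def
proof (intro allI impI ballI)
  fix N N' \<theta> f f' j
  assume *: "subspace N" "subspace N'" "\<theta> \<in> Isos N N'" "f \<in> Homs N N" "f' \<in> Homs N' N'"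
    "\<forall>x\<in>N. \<theta> (f x) = f' (\<theta> x)" "\<forall>j\<in>A. P j N f" "j \<in> A"
  show "P j N' f'"
    by (rule iso_invariantE[OF P[OF *(8)] *(1-5)]) (use * in auto)
qed

lemma iso_invariant_conj:
  assumes P: "iso_invariant P" and Q: "iso_invariant Q"
  shows "iso_invariant (\<lambda>K f. P K f \<and> Q K f)"
  unfolding iso_invariant_def
proof (intro allI impI)
  fix N N' \<theta> f f'
  assume *: "subspace N" "subspace N'" "\<theta> \<in> Isos N N'" "f \<in> Homs N N" "f' \<in> Homs N' N'"
    "\<forall>x\<in>N. \<theta> (f x) = f' (\<theta> x)" "P N f \<and> Q N f"
  have "P N' f'" by (rule iso_invariantE[OF P *(1-5)]) (use * in auto)
  moreover have "Q N' f'" by (rule iso_invariantE[OF Q *(1-5)]) (use * in auto)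
  ultimately show "P N' f' \<and> Q N' f'" by blast
qed

lemma iso_invariant_shift:
  assumes P: "iso_invariant P" shows "iso_invariant (\<lambda>K f. P K (shift K t f))"
  unfolding iso_invariant_def
proof (intro allI impI)
  fix N N' \<theta> f f'
  assume *: "subspace N" "subspace N'" "\<theta> \<in> Isos N N'" "f \<in> Homs N N" "f' \<in> Homs N' N'"
    "\<forall>x\<in>N. \<theta> (f x) = f' (\<theta> x)" "P N (shift N t f)"
  show "P N' (shift N' t f')"
  proof (rule iso_invariantE[where P = P and \<theta> = \<theta> and f = "shift N t f" and N = N, OF P *(1,2,3)])
    show "shift N t f \<in> Homs N N" "shift N' t f' \<in> Homs N' N'"
      using shift_Homs *(1,2,4,5) by blast+
    show "P N (shift N t f)" by (rule *(7))
    fix x assume x: "x \<in> N"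
    note \<theta> = IsosD(1)[OF *(3)]
    have "\<theta> (f x + t \<star> x) = \<theta> (f x) + \<theta> (t \<star> x)"
      by (rule Homs_add[OF \<theta> Homs_mem[OF *(4) x] subspace_scale[OF *(1) x]])
    also have "\<theta> (t \<star> x) = t \<star> \<theta> x" by (rule Homs_scale[OF \<theta> *(1) x])
    finally have "\<theta> (shift N t f x) = \<theta> (f x) + t \<star> \<theta> x" using x by (simp add: shift_def)
    then show "\<theta> (shift N t f x) = shift N' t f' (\<theta> x)"
      using x *(6) Homs_mem[OF \<theta> x] by (simp add: shift_def)
  qed
qed

lemma iso_invariant_nilp: "iso_invariant nilp"
  unfolding iso_invariant_def
proof (intro allI impI)
  fix N N' \<theta> f f'
  assume *: "subspace N" "subspace N'" "\<theta> \<in> Isos N N'" "f \<in> Homs N N" "f' \<in> Homs N' N'"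
    "\<forall>x\<in>N. \<theta> (f x) = f' (\<theta> x)" "nilp N f"
  have pow: "(f' ^^ k) (\<theta> x) = \<theta> ((f ^^ k) x)" if "x \<in> N" for x k
    by (induction k) (use *(6) funpow_mem[OF Homs_image[OF *(4)] that] in auto)
  show "nilp N' f'" unfolding nilp_def
  proof
    fix y assume "y \<in> N'"
    then obtain x where x: "x \<in> N" "y = \<theta> x" using IsosD(3)[OF *(3)] by blast
    then obtain k where "(f ^^ k) x = 0" using *(7) unfolding nilp_def by blast
    then show "\<exists>k. (f' ^^ k) y = 0" using pow[OF x(1)] x Homs_0[OF IsosD(1)[OF *(3)] *(1)] by metis
  qed
qed

lemma iso_invariant_inj: "iso_invariant (\<lambda>K f. inj_on f K)"
  unfolding iso_invariant_def
proof (intro allI impI)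
  fix N N' \<theta> f f'
  assume *: "subspace N" "subspace N'" "\<theta> \<in> Isos N N'" "f \<in> Homs N N" "f' \<in> Homs N' N'"
    "\<forall>x\<in>N. \<theta> (f x) = f' (\<theta> x)" "inj_on f N"
  have "inj_on (\<theta> \<circ> f) N"
    using *(7) inj_on_subset[OF IsosD(2)[OF *(3)] Homs_image[OF *(4)]] by (rule comp_inj_on)
  then have "inj_on (f' \<circ> \<theta>) N" using *(6) by (simp cong: inj_on_cong)
  then show "inj_on f' N'" using inj_on_imageI[of f' \<theta> N] IsosD(3)[OF *(3)] by simp
qed

lemma iso_invariant_has_cok: "iso_invariant (\<lambda>K f. has_cok K f H)"
  unfolding iso_invariant_def
proof (intro allI impI)
  fix N N' \<theta> f f'
  assume *: "subspace N" "subspace N'" "\<theta> \<in> Isos N N'" "f \<in> Homs N N" "f' \<in> Homs N' N'"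
    "\<forall>x\<in>N. \<theta> (f x) = f' (\<theta> x)" "has_cok N f H"
  obtain \<psi> where \<psi>: "\<forall>x\<in>N. \<forall>y\<in>N. \<psi> (x + y) = \<psi> x \<otimes>\<^bsub>H\<^esub> \<psi> y" "\<psi> ` N = carrier H"
      "\<forall>x\<in>N. \<psi> x = \<one>\<^bsub>H\<^esub> \<longleftrightarrow> x \<in> f ` N" using *(7) unfolding has_cok_def by blast
  define \<eta> where "\<eta> = iso_inv N N' \<theta>"
  have \<eta>: "\<eta> \<in> Isos N' N" unfolding \<eta>_def by (rule Isos_inv[OF *(3,1)])
  have \<theta>\<eta>: "\<theta> (\<eta> y) = y" if "y \<in> N'" for y
    unfolding \<eta>_def by (rule iso_inv_right[OF *(3) that])
  have mem: "y \<in> f' ` N' \<longleftrightarrow> \<eta> y \<in> f ` N" if y: "y \<in> N'" for y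
  proof -
    have "f' ` N' = \<theta> ` f ` N" using *(6) IsosD(3)[OF *(3)] by (simp add: image_image flip: IsosD(3)[OF *(3)] cong: image_cong)
    then have "y \<in> f' ` N' \<longleftrightarrow> \<theta> (\<eta> y) \<in> \<theta> ` f ` N" using \<theta>\<eta>[OF y] by simp
    also have "\<dots> \<longleftrightarrow> \<eta> y \<in> f ` N"
      using IsosD(2)[OF *(3)] Homs_mem[OF IsosD(1)[OF \<eta>] y] Homs_image[OF *(4)] by (rule inj_on_image_mem_iff)
    finally show ?thesis .
  qed
  have "\<forall>x\<in>N'. \<forall>y\<in>N'. (\<psi> \<circ> \<eta>) (x + y) = (\<psi> \<circ> \<eta>) x \<otimes>\<^bsub>H\<^esub> (\<psi> \<circ> \<eta>) y"
    using \<psi>(1) Homs_add[OF IsosD(1)[OF \<eta>]] Homs_mem[OF IsosD(1)[OF \<eta>]] by simp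
  moreover have "(\<psi> \<circ> \<eta>) ` N' = carrier H"
    using \<psi>(2) IsosD(3)[OF \<eta>] by (metis image_comp)
  moreover have "\<forall>x\<in>N'. (\<psi> \<circ> \<eta>) x = \<one>\<^bsub>H\<^esub> \<longleftrightarrow> x \<in> f' ` N'"
    using \<psi>(3) mem Homs_mem[OF IsosD(1)[OF \<eta>]] by simp
  ultimately show "has_cok N' f' H" unfolding has_cok_def by blast
qed

text \<open>What is used about conditions on \<open>cok (f + t')\<close> with \<open>t' \<equiv> t\<close> modulo \<open>p\<close>: they do not see
  the part of the module on which \<open>f + t\<close> is invertible.\<close>

definition local_condition :: "int \<Rightarrow> ('v set \<Rightarrow> ('v \<Rightarrow> 'v) \<Rightarrow> bool) \<Rightarrow> bool" where
  "local_condition t P \<longleftrightarrow> iso_invariant P \<and> (\<forall>N K1 K2 f. homocyclic N \<longrightarrow> direct N K1 K2 \<longrightarrow>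
     f \<in> Homs N N \<longrightarrow> rst K1 f \<in> Homs K1 K1 \<longrightarrow> rst K2 f \<in> Homs K2 K2 \<longrightarrow>
     inj_on (shift K2 t (rst K2 f)) K2 \<longrightarrow> (P N f \<longleftrightarrow> P K1 (rst K1 f)))"

lemma local_conditionD:
  assumes "local_condition t P" "homocyclic N" "direct N K1 K2" "f \<in> Homs N N"
    "rst K1 f \<in> Homs K1 K1" "rst K2 f \<in> Homs K2 K2" "inj_on (shift K2 t (rst K2 f)) K2"
  shows "P N f \<longleftrightarrow> P K1 (rst K1 f)"
  using assms unfolding local_condition_def by simp

lemma local_condition_True: "local_condition t (\<lambda>_ _. True)"
  by (simp add: local_condition_def iso_invariant_def)

text \<open>Injectivity of f + t on K2 gives that of f + Y i for every Y i congruent to t, and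
  \<open>has_cok_direct\<close> then discards K2.\<close>

lemma local_condition_has_cok:
  assumes H: "\<And>i. i \<in> I \<Longrightarrow> group (H i)" and Y: "\<And>i. i \<in> I \<Longrightarrow> int p dvd Y i - t"
  shows "local_condition t (\<lambda>K f. \<forall>i\<in>I. has_cok K (shift K (Y i) f) (H i))"
  unfolding local_condition_def
proof (intro conjI allI impI)
  show "iso_invariant (\<lambda>K f. \<forall>i\<in>I. has_cok K (shift K (Y i) f) (H i))"
    by (intro iso_invariant_ball iso_invariant_shift iso_invariant_has_cok)
  fix N K1 K2 f
  assume N: "homocyclic N" and D: "direct N K1 K2" and f: "f \<in> Homs N N"
    and r: "rst K1 f \<in> Homs K1 K1" "rst K2 f \<in> Homs K2 K2"
    and inj: "inj_on (shift K2 t (rst K2 f)) K2"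
  note S = direct_subspace[OF D] direct_subspaces[OF D] and sub = direct_subsets[OF D]
  have N': "finite N" "\<And>z. z \<in> N \<Longrightarrow> q \<star> z = 0" using N by (auto simp: homocyclic_def)
  have "has_cok N (shift N (Y i) f) (H i) \<longleftrightarrow> has_cok K1 (shift K1 (Y i) (rst K1 f)) (H i)" if i: "i \<in> I" for i
  proof -
    have e: "shift K (Y i) (rst K f) x = shift N (Y i) f x" if "x \<in> K" "K \<subseteq> N" for K x
      by (rule shift_rst[OF that])
    have "inj_on (shift K2 (Y i) (rst K2 f)) K2"
      using N'(2) sub(2) by (intro shift_inj_cong[OF r(2) S(3) _ Y[OF i] inj]) blast
    then have "inj_on (shift N (Y i) f) K2" using e[OF _ sub(2)] by (simp cong: inj_on_cong)
    moreover have "shift N (Y i) f ` K \<subseteq> K" if "rst K f \<in> Homs K K" "subspace K" "K \<subseteq> N" for K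
      using Homs_image[OF shift_Homs[OF that(1,2), of "Y i"]] e[OF _ that(3)] by (auto simp: image_subset_iff)
    ultimately have "has_cok N (shift N (Y i) f) (H i) \<longleftrightarrow> has_cok K1 (shift N (Y i) f) (H i)"
      using r S sub by (intro has_cok_direct[OF H[OF i] D shift_Homs[OF f S(1)] _ _ _ N'(1)]) auto
    also have "\<dots> \<longleftrightarrow> has_cok K1 (shift K1 (Y i) (rst K1 f)) (H i)"
      by (rule has_cok_cong) (rule e[OF _ sub(1), symmetric])
    finally show ?thesis .
  qed
  then show "(\<forall>i\<in>I. has_cok N (shift N (Y i) f) (H i)) \<longleftrightarrow>
    (\<forall>i\<in>I. has_cok K1 (shift K1 (Y i) (rst K1 f)) (H i))" by simp
qed

lemma rst_stable: "f \<in> Homs N N \<Longrightarrow> rst K f \<in> Homs K K \<Longrightarrow> f ` K \<subseteq> K"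
  using Homs_image[of "rst K f" K K] by (auto simp: rst_def)

lemma shift_inj_direct_iff:
  assumes D: "direct N K1 K2" and f: "f \<in> Homs N N"
    and r: "rst K1 f \<in> Homs K1 K1" "rst K2 f \<in> Homs K2 K2"
  shows "inj_on (shift N t f) N \<longleftrightarrow>
    inj_on (shift K1 t (rst K1 f)) K1 \<and> inj_on (shift K2 t (rst K2 f)) K2"
proof -
  note S = direct_subspace[OF D] direct_subspaces[OF D] and sub = direct_subsets[OF D]
  have "inj_on (shift K t (rst K f)) K \<longleftrightarrow> inj_on (shift N t f) K" if "K \<subseteq> N" for K
    by (rule inj_on_cong) (rule shift_rst[OF _ that])
  moreover have "shift N t f ` K1 \<subseteq> K1" "shift N t f ` K2 \<subseteq> K2"
    using shift_stable_iff[OF S(2) sub(1)] shift_stable_iff[OF S(3) sub(2)] rst_stable[OF f] r by auto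
  ultimately show ?thesis using inj_on_direct_iff[OF D shift_Homs[OF f S(1)]] sub by simp
qed

text \<open>The conditions at the classes in \<open>S\<close> have been split off: there only invertibility is left.\<close>

definition pending :: "(int \<Rightarrow> 'v set \<Rightarrow> ('v \<Rightarrow> 'v) \<Rightarrow> bool) \<Rightarrow> int set \<Rightarrow> int set \<Rightarrow> 'v set \<Rightarrow> ('v \<Rightarrow> 'v) \<Rightarrow> bool" where
  "pending E J S K f \<longleftrightarrow> (\<forall>j\<in>S. inj_on (shift K j f) K) \<and> (\<forall>j\<in>J - S. E j K f)"

definition nilpotent_at :: "(int \<Rightarrow> 'v set \<Rightarrow> ('v \<Rightarrow> 'v) \<Rightarrow> bool) \<Rightarrow> int \<Rightarrow> 'v set \<Rightarrow> ('v \<Rightarrow> 'v) \<Rightarrow> bool" where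
  "nilpotent_at E j K f \<longleftrightarrow> nilp K (shift K j f) \<and> E j K f"

text \<open>Split off the part K1 on which f + j is nilpotent. All shifts from other classes are
  injective there, so their conditions only see K2. The condition at j only sees K1 and leaves on K2
  the invertibility of f + j.\<close>

lemma mass_pending:
  assumes E: "\<And>j. j \<in> J \<Longrightarrow> local_condition j (E j)"
    and J: "\<And>i j. i \<in> J \<Longrightarrow> j \<in> J \<Longrightarrow> i \<noteq> j \<Longrightarrow> \<not> int p dvd i - j"
    and S: "S \<subseteq> J" and j: "j \<in> J" "j \<notin> S"
  shows "mass (pending E J S) n = (\<Sum>s\<le>n. mass (nilpotent_at E j) s * mass (pending E J (insert j S)) (n - s))"
proof (rule mass_convolution[where t = j])
  have inv: "iso_invariant (E i)" if "i \<in> J" for i using E[OF that] unfolding local_condition_def by blast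
  have shiftB: "iso_invariant (\<lambda>K f. inj_on (shift K i f) K)" for i
    by (rule iso_invariant_shift[OF iso_invariant_inj])
  show "iso_invariant (nilpotent_at E j)"
    unfolding nilpotent_at_def
    by (intro iso_invariant_conj iso_invariant_shift[OF iso_invariant_nilp] inv j)
  show "iso_invariant (pending E J (insert j S))"
    unfolding pending_def by (intro iso_invariant_conj iso_invariant_ball shiftB inv) auto
  fix f K1 K2 assume D: "direct (V n) K1 K2" and f: "f \<in> End n"
  note Sb = direct_subspaces[OF D] and sub = direct_subsets[OF D]
  have core: "pending E J S (V n) f \<longleftrightarrow> E j K1 (rst K1 f) \<and> pending E J (insert j S) K2 (rst K2 f)"
    if r: "rst K1 f \<in> Homs K1 K1" "rst K2 f \<in> Homs K2 K2" and nil: "nilp K1 (shift K1 j (rst K1 f))"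
      and inj: "inj_on (shift K2 j (rst K2 f)) K2"
  proof -
    have inj1: "inj_on (shift K1 i (rst K1 f)) K1" if "i \<in> J" "i \<noteq> j" for i
      using V_torsion sub(1) by (intro nilp_shift_inj[OF r(1) Sb(1) _ nil J[OF that(1) j(1) that(2)]]) blast
    have 1: "inj_on (shift (V n) i f) (V n) \<longleftrightarrow> inj_on (shift K2 i (rst K2 f)) K2" if "i \<in> J" "i \<noteq> j" for i
      using shift_inj_direct_iff[OF D f r] inj1[OF that] by simp
    have 2: "E i (V n) f \<longleftrightarrow> E i K2 (rst K2 f)" if "i \<in> J" "i \<noteq> j" for i
      by (rule local_conditionD[OF E[OF that(1)] homocyclic_V direct_sym[OF D] f r(2,1) inj1[OF that]])
    have 3: "E j (V n) f \<longleftrightarrow> E j K1 (rst K1 f)"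
      by (rule local_conditionD[OF E[OF j(1)] homocyclic_V D f r inj])
    have "(\<forall>i\<in>S. inj_on (shift (V n) i f) (V n)) \<longleftrightarrow> (\<forall>i\<in>S. inj_on (shift K2 i (rst K2 f)) K2)"
      using 1 S j by (intro ball_cong) auto
    moreover have "(\<forall>i\<in>J - S. E i (V n) f) \<longleftrightarrow> E j (V n) f \<and> (\<forall>i\<in>J - insert j S. E i (V n) f)"
      using j by blast
    moreover have "(\<forall>i\<in>J - insert j S. E i (V n) f) \<longleftrightarrow> (\<forall>i\<in>J - insert j S. E i K2 (rst K2 f))"
      using 2 by (intro ball_cong) auto
    ultimately show ?thesis unfolding pending_def using 3 inj by simp blast
  qed
  show "pending E J S (V n) f \<and> fitting (V n) (shift (V n) j f) K1 K2 \<longleftrightarrow>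
    rst K1 f \<in> Homs K1 K1 \<and> rst K2 f \<in> Homs K2 K2 \<and>
    nilpotent_at E j K1 (rst K1 f) \<and> pending E J (insert j S) K2 (rst K2 f)"
    unfolding fitting_shift_iff[OF D f] nilpotent_at_def using core by (auto simp: pending_def)
qed

text \<open>The classes are split off one at a time, and each convolution is a product of power
  series.\<close>

lemma mass_product:
  assumes E: "\<And>j. j \<in> J \<Longrightarrow> local_condition j (E j)"
    and J: "\<And>i j. i \<in> J \<Longrightarrow> j \<in> J \<Longrightarrow> i \<noteq> j \<Longrightarrow> \<not> int p dvd i - j"
    and fin: "finite J"
  shows "Abs_fps (mass (pending E J {})) = (\<Prod>j\<in>J. Abs_fps (mass (nilpotent_at E j))) * Abs_fps (mass (pending E J J))"
proof -
  have "Abs_fps (mass (pending E J {})) = (\<Prod>j\<in>S. Abs_fps (mass (nilpotent_at E j))) * Abs_fps (mass (pending E J S))"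
    if "finite S" "S \<subseteq> J" for S
    using that
  proof (induction S)
    case (insert j S)
    have "Abs_fps (mass (pending E J S)) = Abs_fps (mass (nilpotent_at E j)) * Abs_fps (mass (pending E J (insert j S)))"
      using mass_pending[OF E J, where S = S and j = j] insert by (intro fps_ext) (simp add: fps_mult_nth atLeast0AtMost)
    then show ?case using insert by (simp add: mult.assoc mult.left_commute)
  qed simp
  then show ?thesis using fin by blast
qed

section \<open>Masses without cokernel conditions\<close>

lemma card_Homs_V_V: "card (End n) = ((p ^ L) ^ n) ^ n"
  using card_Homs_V[OF subspace_V V_torsion] by (simp add: card_V)

lemma card_Isos_V: "real (card (Aut n)) = real (card (End n)) * gl_density (real p) n"
proof -
  have "(\<Prod>i<n. 1 - (1 / real p) ^ (n - i)) = gl_density (real p) n"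
    unfolding gl_density_def
    by (rule prod.reindex_bij_witness[of _ "\<lambda>i. n - i" "\<lambda>i. n - i"]) auto
  then show ?thesis unfolding Isos_V using card_Monos_V[of n n] card_Homs_V_V
    by (simp add: prod.distrib)
qed

lemma real_p_gt_1: "real p > 1" using p_gt_1 by simp

lemma mass_True: "mass (\<lambda>_ _. True) n = 1 / gl_density (real p) n"
  unfolding mass_def using card_Isos_V[of n] card_Isos_pos[of n]
  by (auto simp: divide_simps)

text \<open>Adding t is a bijection onto Aut V_n.\<close>

lemma mass_inj_shift: "mass (\<lambda>K f. inj_on (shift K t f) K) n = 1"
proof -
  have st: "shift (V n) t (shift (V n) (- t) f) = f" "shift (V n) (- t) (shift (V n) t f) = f"
    if "f \<in> End n" for f
    using Homs_outside[OF that] by (auto simp: shift_def fun_eq_iff)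
  have "bij_betw (shift (V n) t) {f \<in> End n. inj_on (shift (V n) t f) (V n)} (Aut n)"
  proof (rule bij_betw_byWitness[where f' = "shift (V n) (- t)"])
    show "shift (V n) t ` {f \<in> End n. inj_on (shift (V n) t f) (V n)} \<subseteq> Aut n"
      unfolding Isos_V Monos_def using shift_Homs[OF _ subspace_V] by auto
    show "shift (V n) (- t) ` Aut n \<subseteq> {f \<in> End n. inj_on (shift (V n) t f) (V n)}"
      unfolding Isos_V Monos_def using shift_Homs[OF _ subspace_V] st by auto
  qed (use st IsosD(1) in auto)
  then have "card {f \<in> End n. inj_on (shift (V n) t f) (V n)} = card (Aut n)"
    by (rule bij_betw_same_card)
  then show ?thesis unfolding mass_def using card_Isos_pos[of n] by simp
qed

text \<open>For a single class and no condition, the nilpotent factor is the only unknown in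
  \<open>mass_product\<close>: the total is \<open>mat_fps\<close> and the remaining factor is the
  geometric series 1 / (1 - u).\<close>

lemma mass_nilpotent:
  "Abs_fps (mass (nilpotent_at (\<lambda>_ _ _. True) j)) = (1 - fps_X) * mat_fps (real p)"
proof -
  let ?T = "\<lambda>(_::int) (_::'v set) (_::'v \<Rightarrow> 'v). True"
  have "Abs_fps (mass (pending ?T {j} {})) =
      (\<Prod>j\<in>{j}. Abs_fps (mass (nilpotent_at ?T j))) * Abs_fps (mass (pending ?T {j} {j}))"
    by (rule mass_product) (auto simp: local_condition_True)
  moreover have "mass (pending ?T {j} {}) = (\<lambda>n. 1 / gl_density (real p) n)"
    using mass_True by (simp add: pending_def fun_eq_iff mass_def)
  moreover have "pending ?T {j} {j} = (\<lambda>K f. inj_on (shift K j f) K)"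
    by (simp add: pending_def fun_eq_iff)
  then have "mass (pending ?T {j} {j}) = (\<lambda>n. 1)" using mass_inj_shift by auto
  ultimately have "mat_fps (real p) = Abs_fps (mass (nilpotent_at ?T j)) * Abs_fps (\<lambda>n. 1)"
    by (simp add: mat_fps_def)
  moreover have "Abs_fps (\<lambda>n. 1) * (1 - fps_X) = (1 :: real fps)"
    by (rule fps_ext) (auto simp: right_diff_distrib)
  ultimately have "mat_fps (real p) * (1 - fps_X) = Abs_fps (mass (nilpotent_at ?T j))"
    by (simp add: mult.assoc)
  then show ?thesis by (simp add: mult.commute)
qed

lemma mass_mono:
  assumes "\<And>K f. P K f \<Longrightarrow> Q K f" shows "mass P n \<le> mass Q n"
proof -
  have "card {f \<in> End n. P (V n) f} \<le> card {f \<in> End n. Q (V n) f}"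
    using assms finite_Homs[OF finite_V finite_V] by (intro card_mono) auto
  then show ?thesis unfolding mass_def by (simp add: divide_right_mono)
qed



theorem convergent_proportion:
  assumes I: "finite I" and H: "\<And>i. i \<in> I \<Longrightarrow> group (H i)"
  shows "convergent (\<lambda>n. real (card {f \<in> End n.
    \<forall>i\<in>I. has_cok (V n) (shift (V n) (Y i) f) (H i)}) / real (card (End n)))"
proof -
  \<comment> \<open>Conditions at shifts congruent modulo p live on the same Fitting summand, so
    they are bundled by residue class into one condition \<open>E j\<close>.\<close>
  define J where "J = (\<lambda>i. Y i mod int p) ` I"
  define E where "E j K f \<longleftrightarrow> (\<forall>i\<in>{i \<in> I. Y i mod int p = j}. has_cok K (shift K (Y i) f) (H i))" for j K f
  let ?T = "\<lambda>(_::int) (_::'v set) (_::'v \<Rightarrow> 'v). True"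
  let ?F = "(1 - fps_X) * mat_fps (real p)"
  have fin: "finite J" unfolding J_def using I by simp
  have dist: "\<not> int p dvd i - j" if ij: "i \<in> J" "j \<in> J" "i \<noteq> j" for i j
  proof -
    have "i mod int p = i" "j mod int p = j" using ij unfolding J_def by auto
    then show ?thesis using ij(3) by (metis mod_eq_dvd_iff)
  qed
  have loc: "local_condition j (E j)" for j
  proof -
    have "int p dvd Y i - j" if "Y i mod int p = j" for i
      using that by (auto simp: minus_mod_eq_mult_div)
    then show ?thesis
      unfolding E_def by (intro local_condition_has_cok) (use H in auto)
  qed
  \<comment> \<open>Once every class is split off, only invertibility is left, so G is the same with
    and without cokernel conditions. This allows the unconditional factorization to determine
    it.\<close>
  have pend: "pending E J J = pending ?T J J" by (simp add: pending_def fun_eq_iff)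
  have "convergent (fps_nth (Abs_fps (mass (pending E J {}))))"
  proof (rule convergent_nth_of_factorization[OF real_p_gt_1])
    show "Abs_fps (mass (pending E J {})) =
        (\<Prod>j\<in>J. Abs_fps (mass (nilpotent_at E j))) * Abs_fps (mass (pending E J J))"
      by (rule mass_product[OF loc dist fin])
    have "Abs_fps (mass (pending ?T J {})) =
        (\<Prod>j\<in>J. Abs_fps (mass (nilpotent_at ?T j))) * Abs_fps (mass (pending ?T J J))"
      by (rule mass_product[OF local_condition_True dist fin])
    moreover have "mass (pending ?T J {}) = (\<lambda>n. 1 / gl_density (real p) n)"
      using mass_True by (simp add: pending_def fun_eq_iff mass_def)
    ultimately show "mat_fps (real p) = ?F ^ card J * Abs_fps (mass (pending E J J))"
      unfolding pend mass_nilpotent by (simp add: mat_fps_def)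
    show "0 \<le> fps_nth (Abs_fps (mass (nilpotent_at E j))) n" for j n
      by (simp add: mass_def)
    show "fps_nth (Abs_fps (mass (nilpotent_at E j))) n \<le> fps_nth ?F n" for j n
      unfolding mass_nilpotent[symmetric, of j] fps_nth_Abs_fps
      by (rule mass_mono) (simp add: nilpotent_at_def)
  qed
  then have "convergent (mass (pending E J {}))" by (simp add: Abs_fps_inverse)
  \<comment> \<open>The factor is |Aut V_n| / |End V_n|, which turns the mass back into a
    proportion.\<close>
  then have "convergent (\<lambda>n. mass (pending E J {}) n * gl_density (real p) n)"
    by (intro convergent_mult convergent_gl_density real_p_gt_1)
  moreover have pe: "pending E J {} K f \<longleftrightarrow> (\<forall>i\<in>I. has_cok K (shift K (Y i) f) (H i))" for K f
    by (auto simp: pending_def E_def J_def)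
  moreover have r: "real (card {f \<in> End n. P (V n) f}) / real (card (End n)) =
      mass P n * gl_density (real p) n" for P n
    unfolding mass_def card_Isos_V using gl_density_pos[OF real_p_gt_1, of n] by simp
  ultimately show ?thesis by (simp only: pe[symmetric] r)
qed

end

section \<open>A torus containing all the groups \<open>(\<int>/q)\<^sup>n\<close>\<close>

text \<open>The exponent \<open>L\<close> depends on the groups \<open>H\<^sub>i\<close>, so \<open>\<int>/p\<^sup>L\<close> cannot be a type. The type
  \<open>(\<real>/\<int>)\<^sup>\<nat>\<close> contains \<open>(\<int>/p\<^sup>L)\<^sup>n\<close> for all \<open>L\<close> and \<open>n\<close> at once.\<close>

quotient_type torus = "nat \<Rightarrow> real" / "\<lambda>x y. \<forall>i. x i - y i \<in> \<int>"
proof (rule equivpI)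
  show "reflp (\<lambda>x y :: nat \<Rightarrow> real. \<forall>i. x i - y i \<in> \<int>)" by (auto simp: reflp_def)
  show "symp (\<lambda>x y :: nat \<Rightarrow> real. \<forall>i. x i - y i \<in> \<int>)"
    by (auto simp: symp_def) (metis Ints_minus minus_diff_eq)
  show "transp (\<lambda>x y :: nat \<Rightarrow> real. \<forall>i. x i - y i \<in> \<int>)"
  proof (rule transpI, intro allI)
    fix x y z :: "nat \<Rightarrow> real" and i
    assume "\<forall>i. x i - y i \<in> \<int>" "\<forall>i. y i - z i \<in> \<int>"
    then have "(x i - y i) + (y i - z i) \<in> \<int>" by (intro Ints_add) auto
    then show "x i - z i \<in> \<int>" by simp
  qed
qed

instantiation torus :: ab_group_add
begin

lift_definition zero_torus :: torus is "\<lambda>_. 0" .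

lift_definition plus_torus :: "torus \<Rightarrow> torus \<Rightarrow> torus" is "\<lambda>x y i. x i + y i"
proof -
  fix x x' y y' :: "nat \<Rightarrow> real" and i
  assume "\<And>i. x i - x' i \<in> \<int>" "\<And>i. y i - y' i \<in> \<int>"
  then have "(x i - x' i) + (y i - y' i) \<in> \<int>" by (intro Ints_add) auto
  then show "x i + y i - (x' i + y' i) \<in> \<int>" by (simp add: algebra_simps)
qed

lift_definition uminus_torus :: "torus \<Rightarrow> torus" is "\<lambda>x i. - x i"
proof -
  fix x x' :: "nat \<Rightarrow> real" and i
  assume "\<And>i. x i - x' i \<in> \<int>"
  then have "- (x i - x' i) \<in> \<int>" by (intro Ints_minus) auto
  then show "- x i - - x' i \<in> \<int>" by simp
qed

definition minus_torus :: "torus \<Rightarrow> torus \<Rightarrow> torus" where "minus_torus x y = x + - y"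

instance
proof
  fix a b c :: torus
  show "a + b + c = a + (b + c)" by transfer (simp add: algebra_simps)
  show "a + b = b + a" by transfer (simp add: algebra_simps)
  show "0 + a = a" by transfer simp
  show "- a + a = 0" by transfer simp
  show "a - b = a + - b" by (rule minus_torus_def)
qed

end

lift_definition torus_scale :: "int \<Rightarrow> torus \<Rightarrow> torus" is "\<lambda>k x i. of_int k * x i"
proof -
  fix k and x x' :: "nat \<Rightarrow> real" and i
  assume "\<And>i. x i - x' i \<in> \<int>"
  then have "of_int k * (x i - x' i) \<in> \<int>" by (intro Ints_mult) auto
  then show "of_int k * x i - of_int k * x' i \<in> \<int>" by (simp add: algebra_simps)
qed

text \<open>For q > 0 an element of order q, supported in coordinate i.\<close>

lift_definition torus_unit :: "nat \<Rightarrow> nat \<Rightarrow> torus" is "\<lambda>q i j. if j = i then 1 / real q else 0" .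

lemma int_module_torus: "int_module torus_scale"
  by unfold_locales (transfer; simp add: algebra_simps)+

lift_definition torus_of :: "(nat \<Rightarrow> real) \<Rightarrow> torus" is "\<lambda>x. x" .

lemma torus_of_eq_0: "torus_of x = 0 \<longleftrightarrow> (\<forall>i. x i \<in> \<int>)"
  by transfer simp

lemma torus_of_add_unit:
  "torus_of f + torus_scale k (torus_unit q n) = torus_of (\<lambda>j. f j + of_int k * (if j = n then 1 / real q else 0))"
  by transfer simp

lemma torus_sum:
  "(\<Sum>i<n. torus_scale (c i) (torus_unit q i)) = torus_of (\<lambda>j. if j < n then of_int (c j) / real q else 0)"
proof (induction n)
  case 0 then show ?case by simp (transfer, simp)
next
  case (Suc n)
  have "(\<lambda>j. (if j < n then of_int (c j) / real q else 0) + of_int (c n) * (if j = n then 1 / real q else 0)) =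
      (\<lambda>j. if j < Suc n then of_int (c j) / real q else 0)"
    by (auto simp: fun_eq_iff less_Suc_eq)
  then show ?case unfolding sum.lessThan_Suc Suc torus_of_add_unit by simp
qed

text \<open>A combination of the units vanishes only if each of its coordinates c_i / p^L is an
  integer.\<close>

lemma torsion_basis_torus:
  assumes p: "Factorial_Ring.prime p" and L: "L > 0"
  shows "torsion_basis torus_scale p L (torus_unit (p ^ L))"
proof -
  interpret int_module torus_scale by (rule int_module_torus)
  have p0: "p > 0" using p by (rule prime_gt_0_nat)
  show ?thesis
  proof unfold_locales
    show "torus_scale (int p ^ L) (torus_unit (p ^ L) i) = 0" for i
      using p0 by transfer simp
    fix c :: "nat \<Rightarrow> int" and i n
    assume "(\<Sum>i<n. torus_scale (c i) (torus_unit (p ^ L) i)) = 0" and i: "i < n"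
    then have "of_int (c i) / real (p ^ L) \<in> \<int>"
      unfolding torus_sum torus_of_eq_0 by (metis (mono_tags))
    then obtain k where "of_int (c i) / real (p ^ L) = of_int k" by (elim Ints_cases)
    then have "real_of_int (c i) = of_int (int p ^ L * k)" using p0 by (simp add: field_simps)
    then have "c i = int p ^ L * k" by (simp only: of_int_eq_iff)
    then show "int p ^ L dvd c i" by simp
  qed (use p L in auto)
qed

section \<open>Arithmetic of \<open>p\<close>-adic residues\<close>

lemma residue_range: "residue (x :: 'p :: prime_card padic_int) k \<in> {0..<int CARD('p) ^ k}"
  using residue[of x] by simp

lemma residue_Suc: "residue (x :: 'p :: prime_card padic_int) (Suc k) mod int CARD('p) ^ k = residue x k"
  using residue[of x] by simp

lemma residue_mod_self: "residue (x :: 'p :: prime_card padic_int) k mod int CARD('p) ^ k = residue x k"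
  using residue_range[of x k] by simp

lemma residue_add_index:
  "residue (x :: 'p :: prime_card padic_int) (j + k) mod int CARD('p) ^ k = residue x k"
proof (induction j)
  case 0 then show ?case by (simp add: residue_mod_self)
next
  case (Suc j)
  have "residue x (Suc j + k) mod int CARD('p) ^ k =
      residue x (Suc (j + k)) mod int CARD('p) ^ (j + k) mod int CARD('p) ^ k"
    by (simp add: mod_mod_cancel le_imp_power_dvd)
  then show ?case using Suc residue_Suc by metis
qed

lemma residue_zero: "residue (0 :: 'p :: prime_card padic_int) k = 0"
  by transfer simp

lemma residue_plus: "residue (x + y :: 'p :: prime_card padic_int) k = (residue x k + residue y k) mod int CARD('p) ^ k"
  by transfer simp

lemma residue_times: "residue (x * y :: 'p :: prime_card padic_int) k = (residue x k * residue y k) mod int CARD('p) ^ k"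
  by transfer simp

lemma residue_minus:
  "residue (x - y :: 'p :: prime_card padic_int) k = (residue x k - residue y k) mod int CARD('p) ^ k"
  unfolding minus_padic_int_def residue_plus
  by transfer (simp add: mod_simps)

lemma residue_of_nat: "residue (of_nat a :: 'p :: prime_card padic_int) k = int a mod int CARD('p) ^ k"
proof (induction a)
  case 0 then show ?case by (simp add: residue_zero)
next
  case (Suc a)
  have one: "residue (1 :: 'p padic_int) k = 1 mod int CARD('p) ^ k" by transfer simp
  show ?case using Suc by (simp add: residue_plus one mod_simps)
qed

lemma padic_eqI: "(\<And>k. residue x k = residue y k) \<Longrightarrow> x = y"
  by (metis ext residue_inject)

lemma residue_eq_0_iff:
  fixes x :: "'p :: prime_card padic_int"
  shows "residue x k = 0 \<longleftrightarrow> of_nat CARD('p) ^ k dvd x"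
proof
  let ?p = "int CARD('p)"
  assume 0: "residue x k = 0"
  \<comment> \<open>Division by p^k costs k digits, so the j-th residue of the quotient is computed
    from the residue of x at j + k.\<close>
  define z where "z j = residue x (j + k) div ?p ^ k" for j
  have z: "z \<in> {z. \<forall>j. z j \<in> {0..<?p ^ j} \<and> z (Suc j) mod ?p ^ j = z j}"
  proof (intro CollectI allI conjI)
    fix j
    have "residue x (j + k) < ?p ^ k * ?p ^ j" using residue_range[of x "j + k"]
      by (simp add: power_add mult.commute)
    moreover have "?p ^ k * (residue x (j + k) div ?p ^ k) \<le> residue x (j + k)"
      using mult_div_mod_eq[of "?p ^ k" "residue x (j + k)"]
        pos_mod_sign[OF CARD_prime_card_pos[of k, where 'p = 'p], of "residue x (j + k)"] by linarith
    ultimately have "residue x (j + k) div ?p ^ k < ?p ^ j"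
      using CARD_prime_card_pos[of k, where 'p = 'p] by (metis mult_less_cancel_left_pos order_le_less_trans)
    moreover have "0 \<le> residue x (j + k) div ?p ^ k"
      using residue_range[of x "j + k"] CARD_prime_card_pos[of k, where 'p = 'p] by (simp add: pos_imp_zdiv_nonneg_iff)
    ultimately show "z j \<in> {0..<?p ^ j}" unfolding z_def by simp
    have "z j = (residue x (Suc (j + k)) mod (?p ^ k * ?p ^ j)) div ?p ^ k"
      unfolding z_def using residue_Suc[of x "j + k"] by (simp add: power_add mult.commute)
    also have "\<dots> = (residue x (Suc (j + k)) div ?p ^ k) mod ?p ^ j"
      using CARD_prime_card_pos[of k, where 'p = 'p] by (simp add: zmod_zmult2_eq)
    finally show "z (Suc j) mod ?p ^ j = z j" unfolding z_def by simp
  qed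
  have "x = of_nat CARD('p) ^ k * Abs_padic_int z"
  proof (rule padic_eqI)
    fix j
    have d: "?p ^ k dvd residue x (j + k)"
      using residue_add_index[of x j k] 0 by (simp add: mod_eq_0_iff_dvd)
    have "residue (of_nat CARD('p) ^ k * Abs_padic_int z :: 'p padic_int) j = (?p ^ k mod ?p ^ j * z j) mod ?p ^ j"
      unfolding residue_times Abs_padic_int_inverse[OF z]
      using residue_of_nat[of "CARD('p) ^ k" j, where 'p = 'p] by simp
    also have "\<dots> = residue x (j + k) mod ?p ^ j"
      unfolding z_def using d by (simp add: mod_simps)
    also have "\<dots> = residue x j" using residue_add_index[of x k j] by (simp add: add.commute)
    finally show "residue x j = residue (of_nat CARD('p) ^ k * Abs_padic_int z :: 'p padic_int) j" by simp
  qed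
  then show "of_nat CARD('p) ^ k dvd x" by (rule dvdI)
next
  assume "of_nat CARD('p) ^ k dvd x"
  then obtain z where "x = of_nat CARD('p) ^ k * z" by (elim dvdE)
  then show "residue x k = 0"
    using residue_of_nat[of "CARD('p) ^ k" k, where 'p = 'p] by (simp add: residue_times)
qed

lemma residue_eq_iff:
  fixes x y :: "'p :: prime_card padic_int"
  shows "residue x k = residue y k \<longleftrightarrow> of_nat CARD('p) ^ k dvd x - y"
proof -
  have "of_nat CARD('p) ^ k dvd x - y \<longleftrightarrow> (residue x k - residue y k) mod int CARD('p) ^ k = 0"
    unfolding residue_eq_0_iff[symmetric] residue_minus ..
  also have "\<dots> \<longleftrightarrow> residue x k mod int CARD('p) ^ k = residue y k mod int CARD('p) ^ k"
    by (simp add: mod_eq_dvd_iff mod_eq_0_iff_dvd)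
  finally show ?thesis by (simp only: residue_mod_self)
qed

lemma padic_zeroI:
  fixes x :: "'p :: prime_card padic_int"
  assumes "\<And>k. of_nat CARD('p) ^ k dvd x" shows "x = 0"
  using assms by (intro padic_eqI) (simp add: residue_zero residue_eq_0_iff)

text \<open>Completeness: the diagonal sequence of residues is compatible and hence is itself a
  p-adic integer.\<close>

lemma padic_limit:
  fixes s :: "nat \<Rightarrow> 'p :: prime_card padic_int"
  assumes s: "\<And>k. of_nat CARD('p) ^ k dvd s (Suc k) - s k"
  shows "\<exists>z. \<forall>k. of_nat CARD('p) ^ k dvd z - s k"
proof -
  have z: "(\<lambda>k. residue (s k) k) \<in> {z. \<forall>j. z j \<in> {0..<int CARD('p) ^ j} \<and> z (Suc j) mod int CARD('p) ^ j = z j}"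
    using residue_range residue_Suc[of "s (Suc _)"] s[folded residue_eq_iff] by auto
  have "residue (Abs_padic_int (\<lambda>k. residue (s k) k) :: 'p padic_int) k = residue (s k) k" for k
    by (subst Abs_padic_int_inverse[OF z]) (rule refl)
  then show ?thesis using residue_eq_iff by blast
qed

section \<open>Reduction of matrices modulo \<open>p\<^sup>L\<close>\<close>

text \<open>The first isomorphism theorem, used to replace cosets by a map on G; such a map can be
  passed through the reduction modulo p^L.\<close>

lemma quotient_is_iso_iff:
  assumes G: "comm_group G" and S: "subgroup S G" and H: "group H"
  shows "G Mod S \<cong> H \<longleftrightarrow>
    (\<exists>\<psi>\<in>hom G H. \<psi> ` carrier G = carrier H \<and> (\<forall>x\<in>carrier G. \<psi> x = \<one>\<^bsub>H\<^esub> \<longleftrightarrow> x \<in> S))"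
proof
  interpret G: comm_group G by (rule G)
  interpret H: group H by (rule H)
  interpret N: normal S G using G.subgroup_imp_normal[OF S] .
  interpret Q: group "G Mod S" by (rule N.factorgroup_is_group)
  assume "G Mod S \<cong> H"
  then obtain \<phi> where \<phi>: "\<phi> \<in> iso (G Mod S) H" unfolding is_iso_def by blast
  interpret f: group_hom "G Mod S" H \<phi>
    using \<phi> by unfold_locales (simp add: iso_def)
  let ?\<psi> = "\<phi> \<circ> (\<lambda>x. S #>\<^bsub>G\<^esub> x)"
  have hom: "?\<psi> \<in> hom G H"
    using N.r_coset_hom_Mod f.homh by (rule hom_compose)
  moreover have "?\<psi> ` carrier G = carrier H"
  proof -
    have "?\<psi> ` carrier G = \<phi> ` carrier (G Mod S)" by (simp add: carrier_FactGroup image_image)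
    then show ?thesis using \<phi> by (simp add: iso_def bij_betw_def)
  qed
  moreover have "?\<psi> x = \<one>\<^bsub>H\<^esub> \<longleftrightarrow> x \<in> S" if x: "x \<in> carrier G" for x
  proof -
    have mem: "S #>\<^bsub>G\<^esub> x \<in> carrier (G Mod S)" using x by (simp add: carrier_FactGroup)
    have "inj_on \<phi> (carrier (G Mod S))" using \<phi> by (simp add: iso_def bij_betw_def)
    moreover have "\<phi> (\<one>\<^bsub>G Mod S\<^esub>) = \<one>\<^bsub>H\<^esub>" by (rule f.hom_one)
    ultimately have "?\<psi> x = \<one>\<^bsub>H\<^esub> \<longleftrightarrow> S #>\<^bsub>G\<^esub> x = \<one>\<^bsub>G Mod S\<^esub>"
      using mem Q.one_closed by (metis comp_apply inj_onD)
    then show ?thesis using G.coset_join1[OF _ x S] G.coset_join2[OF x S] by auto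
  qed
  ultimately show "\<exists>\<psi>\<in>hom G H. \<psi> ` carrier G = carrier H \<and> (\<forall>x\<in>carrier G. \<psi> x = \<one>\<^bsub>H\<^esub> \<longleftrightarrow> x \<in> S)"
    by blast
next
  assume "\<exists>\<psi>\<in>hom G H. \<psi> ` carrier G = carrier H \<and> (\<forall>x\<in>carrier G. \<psi> x = \<one>\<^bsub>H\<^esub> \<longleftrightarrow> x \<in> S)"
  then obtain \<psi> where \<psi>: "\<psi> \<in> hom G H" "\<psi> ` carrier G = carrier H"
    "\<forall>x\<in>carrier G. \<psi> x = \<one>\<^bsub>H\<^esub> \<longleftrightarrow> x \<in> S" by blast
  interpret f: group_hom G H \<psi>
    using G H \<psi>(1) by (simp add: group_hom_def group_hom_axioms_def comm_group_def)
  have "kernel G H \<psi> = S"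
    using \<psi>(3) subgroup.subset[OF S] by (auto simp: kernel_def)
  then show "G Mod S \<cong> H" using f.FactGroup_iso[OF \<psi>(2)] by simp
qed

lemma mult_mat_vec_smult:
  fixes A :: "'a :: comm_ring_1 mat"
  assumes "A \<in> carrier_mat nr nc" "v \<in> carrier_vec nc"
  shows "A *\<^sub>v (k \<cdot>\<^sub>v v) = k \<cdot>\<^sub>v (A *\<^sub>v v)"
  using assms by (intro eq_vecI) auto

section \<open>Matrices over the p-adic integers acting on V_n\<close>

locale padic_reduction = torsion_basis scale p L e
  for scale :: "int \<Rightarrow> 'v::ab_group_add \<Rightarrow> 'v" (infixr "\<star>" 75) and p L :: nat and e :: "nat \<Rightarrow> 'v" +
  fixes P :: "'p :: prime_card itself"
  assumes p_def: "p = CARD('p)"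
begin

abbreviation Q :: "'p padic_int" where "Q \<equiv> of_nat p ^ L"

lemma Q_eq: "Q = of_nat p ^ (L - 1) * of_nat p"
  by (rule power_minus_mult[OF L_pos, symmetric])

definition red :: "nat \<Rightarrow> 'p padic_int Matrix.vec \<Rightarrow> 'v" where
  "red n x = (\<Sum>i<n. residue (x $ i) L \<star> e i)"

lemma residue_scale_e: "(a mod q) \<star> e i = a \<star> e i"
  by (rule torsion_mod[OF e_torsion]) (simp add: mod_eq_dvd_iff[symmetric])

lemma red_add:
  "x \<in> carrier_vec n \<Longrightarrow> y \<in> carrier_vec n \<Longrightarrow> red n (x + y) = red n x + red n y"
  by (simp add: red_def residue_plus p_def[symmetric] residue_scale_e scale_left_distrib sum.distrib)

lemma red_smult:
  "x \<in> carrier_vec n \<Longrightarrow> red n (a \<cdot>\<^sub>v x) = residue a L \<star> red n x"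
  by (simp add: red_def residue_times p_def[symmetric] residue_scale_e scale_sum_right)

lemma red_mem: "red n x \<in> V n"
  unfolding red_def V_def by (rule CollectI, rule exI[of _ "\<lambda>i. residue (x $ i) L"]) simp

lemma red_surj: "red n ` carrier_vec n = V n"
proof (intro equalityI subsetI)
  fix v assume "v \<in> V n"
  then obtain c where c: "v = (\<Sum>i<n. c i \<star> e i)" unfolding V_def by blast
  have "residue (of_nat (nat (c i mod q)) :: 'p padic_int) L \<star> e i = c i \<star> e i" for i
    unfolding residue_of_nat p_def[symmetric] using q_pos by (simp add: residue_scale_e)
  then have "red n (Matrix.vec n (\<lambda>i. of_nat (nat (c i mod q)))) = v"
    unfolding red_def c by (intro sum.cong) simp_all
  moreover have "Matrix.vec n (\<lambda>i. of_nat (nat (c i mod q)) :: 'p padic_int) \<in> carrier_vec n" by simp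
  ultimately show "v \<in> red n ` carrier_vec n" by blast
qed (use red_mem in auto)

lemma red_eq_0_iff: "red n x = 0 \<longleftrightarrow> (\<forall>i<n. Q dvd x $ i)"
proof
  assume 0: "red n x = 0"
  show "\<forall>i<n. Q dvd x $ i"
  proof (intro allI impI)
    fix i assume "i < n"
    then have "q dvd residue (x $ i) L" using e_indep[of "\<lambda>i. residue (x $ i) L" n i] 0 by (simp add: red_def)
    then have "residue (x $ i) L = 0"
      using residue_mod_self[of "x $ i" L] by (simp add: p_def mod_eq_0_iff_dvd[symmetric])
    then show "Q dvd x $ i" by (simp add: residue_eq_0_iff p_def)
  qed
next
  assume "\<forall>i<n. Q dvd x $ i"
  then have "residue (x $ i) L = 0" if "i < n" for i using that by (simp add: residue_eq_0_iff p_def)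
  then show "red n x = 0" by (simp add: red_def)
qed

lemma red_diff:
  assumes "x \<in> carrier_vec n" "y \<in> carrier_vec n" shows "red n (x - y) = red n x - red n y"
proof -
  have "x = (x - y) + y" using assms by (intro eq_vecI) auto
  then have "red n x = red n (x - y) + red n y" using assms red_add[of "x - y" n y] by simp
  then show ?thesis by simp
qed

lemma red_eq_0_smult:
  assumes x: "x \<in> carrier_vec n" and "red n x = 0"
  obtains z where "z \<in> carrier_vec n" "x = Q \<cdot>\<^sub>v z"
proof -
  have "\<forall>i. \<exists>z. i < n \<longrightarrow> x $ i = Q * z" using assms(2) by (auto simp: red_eq_0_iff elim: dvdE)
  then obtain z where "\<And>i. i < n \<Longrightarrow> x $ i = Q * z i" by metis
  then have "x = Q \<cdot>\<^sub>v Matrix.vec n z" using x by (intro eq_vecI) auto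
  then show thesis using that[of "Matrix.vec n z"] by simp
qed

lemma red_mult_cong:
  assumes A: "A \<in> carrier_mat n n" and x: "x \<in> carrier_vec n" "y \<in> carrier_vec n" and e: "red n x = red n y"
  shows "red n (A *\<^sub>v x) = red n (A *\<^sub>v y)"
proof -
  have "red n (x - y) = 0" using x e by (simp add: red_diff)
  then obtain z where z: "z \<in> carrier_vec n" "x - y = Q \<cdot>\<^sub>v z" using red_eq_0_smult[of "x - y" n] x by auto
  have "A *\<^sub>v x - A *\<^sub>v y = A *\<^sub>v (x - y)" using mult_minus_distrib_mat_vec[OF A x] by simp
  also have "\<dots> = Q \<cdot>\<^sub>v (A *\<^sub>v z)" unfolding z(2) by (rule mult_mat_vec_smult[OF A z(1)])
  finally have "red n (A *\<^sub>v x - A *\<^sub>v y) = 0" using A z by (simp add: red_eq_0_iff)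
  then show ?thesis using A x red_diff[of "A *\<^sub>v x" n "A *\<^sub>v y"] by simp
qed

text \<open>The endomorphism of V_n induced by A. The chosen lift of v is immaterial: two lifts
  differ by a multiple of p^L, and so do their images under A
  (\<open>red_mult_cong\<close>).\<close>

definition act :: "nat \<Rightarrow> 'p padic_int mat \<Rightarrow> 'v \<Rightarrow> 'v" where
  "act n A v = (if v \<in> V n then red n (A *\<^sub>v (SOME x. x \<in> carrier_vec n \<and> red n x = v)) else 0)"

lemma act_red:
  assumes A: "A \<in> carrier_mat n n" and x: "x \<in> carrier_vec n"
  shows "act n A (red n x) = red n (A *\<^sub>v x)"
proof -
  let ?y = "SOME y. y \<in> carrier_vec n \<and> red n y = red n x"
  have "?y \<in> carrier_vec n \<and> red n ?y = red n x" by (rule someI[of _ x]) (use x in simp)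
  then show ?thesis unfolding act_def using red_mult_cong[OF A _ x] red_mem by simp
qed

lemma V_redE: assumes "v \<in> V n" obtains x where "x \<in> carrier_vec n" "v = red n x"
  using assms red_surj by blast

lemma act_Homs:
  assumes A: "A \<in> carrier_mat n n" shows "act n A \<in> End n"
proof (rule HomsI)
  fix v assume "v \<in> V n"
  then obtain x where x: "x \<in> carrier_vec n" "v = red n x" by (rule V_redE)
  then show "act n A v \<in> V n" using act_red[OF A] red_mem by simp
  fix w assume "w \<in> V n"
  then obtain y where y: "y \<in> carrier_vec n" "w = red n y" by (rule V_redE)
  have "v + w = red n (x + y)" using x y by (simp add: red_add)
  then have "act n A (v + w) = red n (A *\<^sub>v x + A *\<^sub>v y)"
    using act_red[OF A, of "x + y"] x y mult_add_distrib_mat_vec[OF A x(1) y(1)] by simp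
  then show "act n A (v + w) = act n A v + act n A w"
    using A x y by (simp add: red_add act_red)
qed (simp add: act_def)

lemma act_eq_iff:
  assumes A: "A \<in> carrier_mat n n" and B: "B \<in> carrier_mat n n"
  shows "act n A = act n B \<longleftrightarrow> (\<forall>i<n. \<forall>j<n. residue (A $$ (i, j)) L = residue (B $$ (i, j)) L)"
proof
  assume eq: "act n A = act n B"
  show "\<forall>i<n. \<forall>j<n. residue (A $$ (i, j)) L = residue (B $$ (i, j)) L"
  proof (intro allI impI)
    fix i j assume ij: "i < n" "j < n"
    have u: "unit_vec n j \<in> carrier_vec n" by simp
    have "red n (A *\<^sub>v unit_vec n j) = red n (B *\<^sub>v unit_vec n j)"
      using act_red[OF A u] act_red[OF B u] eq by simp
    then have "red n (A *\<^sub>v unit_vec n j - B *\<^sub>v unit_vec n j) = 0"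
      using A B u by (simp add: red_diff)
    then have "Q dvd (A *\<^sub>v unit_vec n j - B *\<^sub>v unit_vec n j) $ i" using ij by (simp add: red_eq_0_iff)
    also have "(A *\<^sub>v unit_vec n j - B *\<^sub>v unit_vec n j) $ i = A $$ (i, j) - B $$ (i, j)"
      using A B ij by simp
    finally show "residue (A $$ (i, j)) L = residue (B $$ (i, j)) L"
      by (simp add: residue_eq_iff p_def)
  qed
next
  assume r: "\<forall>i<n. \<forall>j<n. residue (A $$ (i, j)) L = residue (B $$ (i, j)) L"
  show "act n A = act n B"
  proof (rule Homs_eqI[OF act_Homs[OF A] act_Homs[OF B]])
    fix v assume "v \<in> V n"
    then obtain x where x: "x \<in> carrier_vec n" "v = red n x" by (rule V_redE)
    have "Q dvd ((A - B) *\<^sub>v x) $ i" if i: "i < n" for i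
    proof -
      have "((A - B) *\<^sub>v x) $ i = (\<Sum>j\<in>{0..<n}. (A $$ (i, j) - B $$ (i, j)) * x $ j)"
        using A B x i by (simp add: scalar_prod_def)
      moreover have "Q dvd A $$ (i, j) - B $$ (i, j)" if "j < n" for j
        using r i that by (simp add: residue_eq_iff p_def)
      ultimately show ?thesis by (auto intro!: dvd_sum)
    qed
    then have "red n ((A - B) *\<^sub>v x) = 0" by (simp add: red_eq_0_iff)
    then have "red n (A *\<^sub>v x - B *\<^sub>v x) = 0" using minus_mult_distrib_mat_vec[OF A B x(1)] by simp
    then show "act n A v = act n B v" using A B x by (simp add: red_diff act_red)
  qed
qed

lemma act_shift:
  assumes A: "A \<in> carrier_mat n n"
  shows "act n (A + y \<cdot>\<^sub>m 1\<^sub>m n) = shift (V n) (residue y L) (act n A)"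
proof -
  have B: "A + y \<cdot>\<^sub>m 1\<^sub>m n \<in> carrier_mat n n" using A by simp
  show ?thesis
  proof (rule Homs_eqI[OF act_Homs[OF B] shift_Homs[OF act_Homs[OF A] subspace_V]])
    fix v assume "v \<in> V n"
    then obtain x where x: "x \<in> carrier_vec n" "v = red n x" by (rule V_redE)
    have "(A + y \<cdot>\<^sub>m 1\<^sub>m n) *\<^sub>v x = A *\<^sub>v x + (y \<cdot>\<^sub>m 1\<^sub>m n) *\<^sub>v x"
      by (rule add_mult_distrib_mat_vec[OF A _ x(1)]) simp
    also have "(y \<cdot>\<^sub>m 1\<^sub>m n) *\<^sub>v x = y \<cdot>\<^sub>v x"
      using x by (intro eq_vecI) auto
    finally have "act n (A + y \<cdot>\<^sub>m 1\<^sub>m n) v = red n (A *\<^sub>v x + y \<cdot>\<^sub>v x)"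
      using act_red[OF B x(1)] x(2) by simp
    also have "\<dots> = act n A v + residue y L \<star> v"
      using A x by (simp add: red_add red_smult act_red)
    finally show "act n (A + y \<cdot>\<^sub>m 1\<^sub>m n) v = shift (V n) (residue y L) (act n A) v"
      using \<open>v \<in> V n\<close> by (simp add: shift_def)
  qed
qed

text \<open>If \<open>p\<^sup>L\<^sup>-\<^sup>1\<close> kills the cokernel modulo \<open>p\<^sup>L\<close>, then it kills the cokernel: successive
  approximation, using that \<open>\<int>\<^sub>p\<close> is complete.\<close>

lemma smult_mem_image:
  assumes B: "B \<in> carrier_mat n n"
    and approx: "\<And>x. x \<in> carrier_vec n \<Longrightarrow> \<exists>c\<in>carrier_vec n. red n (of_nat p ^ (L - 1) \<cdot>\<^sub>v x) = red n (B *\<^sub>v c)"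
    and x: "x \<in> carrier_vec n"
  shows "\<exists>c\<in>carrier_vec n. of_nat p ^ (L - 1) \<cdot>\<^sub>v x = B *\<^sub>v c"
proof -
  let ?p = "of_nat p :: 'p padic_int" and ?P = "of_nat p ^ (L - 1) :: 'p padic_int"
  have QP: "Q = ?p * ?P" unfolding Q_eq by (rule mult.commute)
  have "\<exists>c r. c \<in> carrier_vec n \<and> r \<in> carrier_vec n \<and> ?P \<cdot>\<^sub>v x = B *\<^sub>v c + Q \<cdot>\<^sub>v r" if x: "x \<in> carrier_vec n" for x
  proof -
    obtain c where c: "c \<in> carrier_vec n" "red n (?P \<cdot>\<^sub>v x) = red n (B *\<^sub>v c)" using approx[OF x] by blast
    then have "red n (?P \<cdot>\<^sub>v x - B *\<^sub>v c) = 0" using B x by (simp add: red_diff)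
    then obtain r where r: "r \<in> carrier_vec n" "?P \<cdot>\<^sub>v x - B *\<^sub>v c = Q \<cdot>\<^sub>v r"
      using red_eq_0_smult[of "?P \<cdot>\<^sub>v x - B *\<^sub>v c" n] B x c by auto
    have "?P \<cdot>\<^sub>v x = B *\<^sub>v c + (?P \<cdot>\<^sub>v x - B *\<^sub>v c)" using B x c by (intro eq_vecI) auto
    then show ?thesis using c r by metis
  qed
  then obtain c r where cr: "\<And>x. x \<in> carrier_vec n \<Longrightarrow> c x \<in> carrier_vec n" "\<And>x. x \<in> carrier_vec n \<Longrightarrow> r x \<in> carrier_vec n"
    "\<And>x. x \<in> carrier_vec n \<Longrightarrow> ?P \<cdot>\<^sub>v x = B *\<^sub>v c x + Q \<cdot>\<^sub>v r x" by metis
  \<comment> \<open>The remainders are fed back into the approximation: as Q = p \<open>?P\<close>,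
    each step reads \<open>?P\<close> w_k = B c(w_k) + p \<open>?P\<close> w_(k+1). Hence the
    partial sums S_k of the p^k c(w_k) solve the equation up to p^k \<open>?P\<close> w_k, and they
    converge p-adically.\<close>
  define w where "w k = (r ^^ k) x" for k
  have w: "w k \<in> carrier_vec n" for k unfolding w_def by (induction k) (use x cr in auto)
  have w_Suc: "w (Suc k) = r (w k)" for k unfolding w_def by simp
  define S where "S = rec_nat (0\<^sub>v n) (\<lambda>k s. s + ?p ^ k \<cdot>\<^sub>v c (w k))"
  have S_0: "S 0 = 0\<^sub>v n" and S_Suc: "S (Suc k) = S k + ?p ^ k \<cdot>\<^sub>v c (w k)" for k unfolding S_def by auto
  have S: "S k \<in> carrier_vec n" for k by (induction k) (use S_0 S_Suc cr(1)[OF w] in auto)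
  have main: "?P \<cdot>\<^sub>v x = B *\<^sub>v S k + (?p ^ k * ?P) \<cdot>\<^sub>v w k" for k
  proof (induction k)
    case 0
    have "B *\<^sub>v 0\<^sub>v n = 0\<^sub>v n" using B by (intro eq_vecI) auto
    then show ?case using x by (simp add: S_0 w_def)
  next
    case (Suc k)
    have "(?p ^ k * ?P) \<cdot>\<^sub>v w k = ?p ^ k \<cdot>\<^sub>v (B *\<^sub>v c (w k) + Q \<cdot>\<^sub>v w (Suc k))"
      using cr(3)[OF w[of k]] w_Suc[of k] smult_smult_assoc[of "?p ^ k" ?P "w k"] by simp
    also have "\<dots> = ?p ^ k \<cdot>\<^sub>v (B *\<^sub>v c (w k)) + (?p ^ Suc k * ?P) \<cdot>\<^sub>v w (Suc k)"
      using B w[of "Suc k"] unfolding QP by (intro eq_vecI) (auto simp: algebra_simps)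
    also have "?p ^ k \<cdot>\<^sub>v (B *\<^sub>v c (w k)) = B *\<^sub>v (?p ^ k \<cdot>\<^sub>v c (w k))"
      by (rule mult_mat_vec_smult[OF B cr(1)[OF w], symmetric])
    finally have "?P \<cdot>\<^sub>v x = B *\<^sub>v S k + (B *\<^sub>v (?p ^ k \<cdot>\<^sub>v c (w k)) + (?p ^ Suc k * ?P) \<cdot>\<^sub>v w (Suc k))"
      using Suc by simp
    also have "\<dots> = (B *\<^sub>v S k + B *\<^sub>v (?p ^ k \<cdot>\<^sub>v c (w k))) + (?p ^ Suc k * ?P) \<cdot>\<^sub>v w (Suc k)"
      using B w[of "Suc k"] by (intro eq_vecI) auto
    also have "B *\<^sub>v S k + B *\<^sub>v (?p ^ k \<cdot>\<^sub>v c (w k)) = B *\<^sub>v S (Suc k)"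
      unfolding S_Suc using mult_add_distrib_mat_vec[OF B S] cr(1)[OF w[of k]] by simp
    finally show ?case .
  qed
  have "\<exists>z. \<forall>k. ?p ^ k dvd z - S k $ i" if "i < n" for i
  proof -
    have "S (Suc k) $ i - S k $ i = ?p ^ k * c (w k) $ i" for k
      using that S[of k] cr(1)[OF w[of k]] by (simp add: S_Suc)
    then show ?thesis using padic_limit[of "\<lambda>k. S k $ i"] by (simp add: p_def)
  qed
  then obtain z where z: "\<And>i k. i < n \<Longrightarrow> ?p ^ k dvd z i - S k $ i" by metis
  let ?z = "Matrix.vec n z"
  have "?P \<cdot>\<^sub>v x = B *\<^sub>v ?z"
  proof (rule eq_vecI)
    fix i assume "i < dim_vec (B *\<^sub>v ?z)"
    then have i: "i < n" using B by simp
    have "?p ^ k dvd (?P \<cdot>\<^sub>v x) $ i - (B *\<^sub>v ?z) $ i" for k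
    proof -
      have "(?P \<cdot>\<^sub>v x) $ i - (B *\<^sub>v ?z) $ i = (?p ^ k * ?P) * w k $ i - (\<Sum>j\<in>{0..<n}. B $$ (i, j) * (z j - S k $ j))"
        unfolding main[of k] using B w[of k] S[of k] i
        by (simp add: scalar_prod_def algebra_simps sum_subtractf)
      moreover have "?p ^ k dvd (\<Sum>j\<in>{0..<n}. B $$ (i, j) * (z j - S k $ j))"
        using z by (intro dvd_sum dvd_mult) auto
      ultimately show ?thesis by (simp add: dvd_diff mult.assoc)
    qed
    then have "(?P \<cdot>\<^sub>v x) $ i - (B *\<^sub>v ?z) $ i = 0" by (intro padic_zeroI) (simp add: p_def)
    then show "(?P \<cdot>\<^sub>v x) $ i = (B *\<^sub>v ?z) $ i" by simp
  qed (use B x in simp)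
  then show ?thesis by (intro bexI[of _ ?z]) auto
qed

text \<open>A homomorphism to H kills all multiples of p^L because p^(L-1) already kills H, so it
  factors through \<open>red\<close>. Conversely, a map on V_n with the required kernel shows that
  p^(L-1) kills the cokernel modulo p^L; \<open>smult_mem_image\<close> lifts this, so every vector
  that reduces to 0 lies in the image of B.\<close>

lemma cok_iso_iff:
  fixes H :: "'h monoid"
  assumes B: "B \<in> carrier_mat n n" and H: "group H"
    and kill: "\<And>h. h \<in> carrier H \<Longrightarrow> h [^]\<^bsub>H\<^esub> (p ^ (L - 1)) = \<one>\<^bsub>H\<^esub>"
  shows "cok B \<cong> H \<longleftrightarrow> has_cok (V n) (act n B) H"
proof -
  interpret H: group H by (rule H)
  let ?G = "monoid_vec TYPE('p padic_int) n" and ?S = "(\<lambda>v. B *\<^sub>v v) ` carrier_vec n"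
  have G: "comm_group ?G" by (rule comm_group_vec)
  interpret G: comm_group ?G by (rule G)
  have carG: "carrier ?G = carrier_vec n" and multG: "mult ?G = (+)" by (auto simp: monoid_vec_def)
  have h: "group_hom ?G ?G (\<lambda>v. B *\<^sub>v v)"
    by unfold_locales (use B in \<open>auto simp: hom_def carG multG mult_add_distrib_mat_vec\<close>)
  have S: "subgroup ?S ?G" using group_hom.img_is_subgroup[OF h] by (simp add: carG)
  have cok: "cok B = ?G Mod ?S" using B by (simp add: cok_def)
  have im: "red n x \<in> act n B ` V n \<longleftrightarrow> (\<exists>c\<in>carrier_vec n. red n x = red n (B *\<^sub>v c))" for x
    unfolding red_surj[symmetric] using act_red[OF B] by force
  have pw: "\<psi> (of_nat k \<cdot>\<^sub>v x) = \<psi> x [^]\<^bsub>H\<^esub> k"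
    if \<psi>: "\<psi> \<in> hom ?G H" and x: "x \<in> carrier_vec n" for \<psi> x k
  proof (induction k)
    case 0
    have "(0 :: 'p padic_int) \<cdot>\<^sub>v x = 0\<^sub>v n" using x by (intro eq_vecI) auto
    moreover have "\<psi> (0\<^sub>v n) = \<one>\<^bsub>H\<^esub>" using hom_one[OF \<psi> G.is_group H] by (simp add: monoid_vec_def)
    ultimately show ?case by simp
  next
    case (Suc k)
    have "(of_nat (Suc k) :: 'p padic_int) \<cdot>\<^sub>v x = of_nat k \<cdot>\<^sub>v x + x"
      using x by (intro eq_vecI) (auto simp: algebra_simps)
    then have "\<psi> (of_nat (Suc k) \<cdot>\<^sub>v x) = \<psi> (of_nat k \<cdot>\<^sub>v x) \<otimes>\<^bsub>H\<^esub> \<psi> x"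
      using hom_mult[OF \<psi>, of "of_nat k \<cdot>\<^sub>v x" x] x by (simp add: carG multG)
    then show ?case using Suc by simp
  qed
  show ?thesis
    unfolding cok quotient_is_iso_iff[OF G S H]
  proof
    assume "\<exists>\<psi>\<in>hom ?G H. \<psi> ` carrier ?G = carrier H \<and> (\<forall>x\<in>carrier ?G. \<psi> x = \<one>\<^bsub>H\<^esub> \<longleftrightarrow> x \<in> ?S)"
    then obtain \<psi> where \<psi>: "\<psi> \<in> hom ?G H" "\<psi> ` carrier_vec n = carrier H"
      "\<And>x. x \<in> carrier_vec n \<Longrightarrow> \<psi> x = \<one>\<^bsub>H\<^esub> \<longleftrightarrow> x \<in> ?S" unfolding carG by blast
    have \<psi>_add: "\<psi> (x + y) = \<psi> x \<otimes>\<^bsub>H\<^esub> \<psi> y" if "x \<in> carrier_vec n" "y \<in> carrier_vec n" for x y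
      using hom_mult[OF \<psi>(1)] that by (simp add: carG multG)
    have \<psi>_mem: "\<psi> x \<in> carrier H" if "x \<in> carrier_vec n" for x using \<psi>(2) that by blast
    have \<psi>0: "\<psi> x = \<one>\<^bsub>H\<^esub>" if "x \<in> carrier_vec n" "red n x = 0" for x
    proof -
      obtain z where z: "z \<in> carrier_vec n" "x = Q \<cdot>\<^sub>v z" using red_eq_0_smult[OF \<open>x \<in> carrier_vec n\<close> \<open>red n x = 0\<close>] .
      have "x = of_nat (p ^ (L - 1)) \<cdot>\<^sub>v (of_nat p \<cdot>\<^sub>v z)"
        unfolding z(2) Q_eq smult_smult_assoc[symmetric] by simp
      then show ?thesis
        using pw[OF \<psi>(1), of "of_nat p \<cdot>\<^sub>v z" "p ^ (L - 1)"] kill[OF \<psi>_mem] z by simp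
    qed
    have cong: "\<psi> x = \<psi> y" if "x \<in> carrier_vec n" "y \<in> carrier_vec n" "red n x = red n y" for x y
    proof -
      have "\<psi> (x - y) = \<one>\<^bsub>H\<^esub>" using that by (intro \<psi>0) (auto simp: red_diff)
      moreover have "x = (x - y) + y" using that by (intro eq_vecI) auto
      then have "\<psi> x = \<psi> (x - y) \<otimes>\<^bsub>H\<^esub> \<psi> y" using \<psi>_add[of "x - y" y] that by simp
      ultimately show ?thesis using \<psi>_mem that by simp
    qed
    define \<eta> where "\<eta> v = \<psi> (SOME x. x \<in> carrier_vec n \<and> red n x = v)" for v
    have \<eta>: "\<eta> (red n x) = \<psi> x" if "x \<in> carrier_vec n" for x
      unfolding \<eta>_def
    proof (rule someI2[of _ x])
      show "x \<in> carrier_vec n \<and> red n x = red n x" using that by simp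
      show "\<psi> y = \<psi> x" if "y \<in> carrier_vec n \<and> red n y = red n x" for y
        using that by (intro cong[OF _ \<open>x \<in> carrier_vec n\<close>]) auto
    qed
    have "\<forall>v\<in>V n. \<forall>w\<in>V n. \<eta> (v + w) = \<eta> v \<otimes>\<^bsub>H\<^esub> \<eta> w"
    proof (intro ballI)
      fix v w assume "v \<in> V n" "w \<in> V n"
      then obtain x y where xy: "x \<in> carrier_vec n" "y \<in> carrier_vec n" "v = red n x" "w = red n y"
        by (metis V_redE)
      then have "v + w = red n (x + y)" by (simp add: red_add)
      then have "\<eta> (v + w) = \<psi> (x + y)" using \<eta>[of "x + y"] xy by simp
      then show "\<eta> (v + w) = \<eta> v \<otimes>\<^bsub>H\<^esub> \<eta> w" using \<eta> \<psi>_add xy by simp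
    qed
    moreover have "\<eta> ` V n = carrier H"
      unfolding red_surj[symmetric] image_image \<psi>(2)[symmetric] using \<eta> by (intro image_cong) auto
    moreover have "\<forall>v\<in>V n. \<eta> v = \<one>\<^bsub>H\<^esub> \<longleftrightarrow> v \<in> act n B ` V n"
    proof
      fix v assume "v \<in> V n"
      then obtain x where x: "x \<in> carrier_vec n" "v = red n x" by (rule V_redE)
      have "\<psi> x = \<one>\<^bsub>H\<^esub> \<longleftrightarrow> (\<exists>c\<in>carrier_vec n. red n x = red n (B *\<^sub>v c))"
      proof
        assume "\<psi> x = \<one>\<^bsub>H\<^esub>"
        then show "\<exists>c\<in>carrier_vec n. red n x = red n (B *\<^sub>v c)" using \<psi>(3)[OF x(1)] by blast
      next
        assume "\<exists>c\<in>carrier_vec n. red n x = red n (B *\<^sub>v c)"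
        then obtain c where c: "c \<in> carrier_vec n" "red n x = red n (B *\<^sub>v c)" by blast
        then have "\<psi> x = \<psi> (B *\<^sub>v c)" using B by (intro cong[OF x(1)]) auto
        then show "\<psi> x = \<one>\<^bsub>H\<^esub>" using \<psi>(3)[of "B *\<^sub>v c"] c B by auto
      qed
      then show "\<eta> v = \<one>\<^bsub>H\<^esub> \<longleftrightarrow> v \<in> act n B ` V n"
        unfolding x(2) \<eta>[OF x(1)] im .
    qed
    ultimately show "has_cok (V n) (act n B) H" unfolding has_cok_def by blast
  next
    assume "has_cok (V n) (act n B) H"
    then obtain \<eta> where \<eta>: "\<forall>v\<in>V n. \<forall>w\<in>V n. \<eta> (v + w) = \<eta> v \<otimes>\<^bsub>H\<^esub> \<eta> w" "\<eta> ` V n = carrier H"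
      "\<forall>v\<in>V n. \<eta> v = \<one>\<^bsub>H\<^esub> \<longleftrightarrow> v \<in> act n B ` V n" unfolding has_cok_def by blast
    let ?\<psi> = "\<lambda>x. \<eta> (red n x)"
    have im\<psi>: "?\<psi> ` carrier_vec n = carrier H" using \<eta>(2) red_surj[of n] by (metis image_image)
    have hom: "?\<psi> \<in> hom ?G H"
      using \<eta>(1) red_mem im\<psi> by (auto simp: hom_def carG multG red_add)
    have ker: "?\<psi> x = \<one>\<^bsub>H\<^esub> \<longleftrightarrow> (\<exists>c\<in>carrier_vec n. red n x = red n (B *\<^sub>v c))" if "x \<in> carrier_vec n" for x
      using \<eta>(3) red_mem im by blast
    have approx: "\<exists>c\<in>carrier_vec n. red n (of_nat p ^ (L - 1) \<cdot>\<^sub>v x) = red n (B *\<^sub>v c)" if x: "x \<in> carrier_vec n" for x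
    proof -
      have "?\<psi> x \<in> carrier H" using im\<psi> x by blast
      then have "?\<psi> (of_nat (p ^ (L - 1)) \<cdot>\<^sub>v x) = \<one>\<^bsub>H\<^esub>" using pw[OF hom x, of "p ^ (L - 1)"] kill by simp
      then show ?thesis using ker[of "of_nat (p ^ (L - 1)) \<cdot>\<^sub>v x"] x by simp
    qed
    have "?\<psi> x = \<one>\<^bsub>H\<^esub> \<longleftrightarrow> x \<in> ?S" if x: "x \<in> carrier_vec n" for x
    proof
      assume "?\<psi> x = \<one>\<^bsub>H\<^esub>"
      then obtain c where c: "c \<in> carrier_vec n" "red n x = red n (B *\<^sub>v c)" using ker[OF x] by blast
      then have "red n (x - B *\<^sub>v c) = 0" using x B by (simp add: red_diff)
      then obtain z where z: "z \<in> carrier_vec n" "x - B *\<^sub>v c = Q \<cdot>\<^sub>v z"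
        using red_eq_0_smult[of "x - B *\<^sub>v c" n] x B c by auto
      have "Q \<cdot>\<^sub>v z = of_nat p ^ (L - 1) \<cdot>\<^sub>v (of_nat p \<cdot>\<^sub>v z)"
        unfolding Q_eq smult_smult_assoc ..
      then obtain d where d: "d \<in> carrier_vec n" "Q \<cdot>\<^sub>v z = B *\<^sub>v d"
        using smult_mem_image[OF B approx, of "of_nat p \<cdot>\<^sub>v z"] z by auto
      have "x = B *\<^sub>v c + (x - B *\<^sub>v c)" using x B c by (intro eq_vecI) auto
      also have "\<dots> = B *\<^sub>v (c + d)" unfolding z d(2) by (rule mult_add_distrib_mat_vec[OF B c(1) d(1), symmetric])
      finally show "x \<in> ?S" using c d by (intro image_eqI[of _ _ "c + d"]) auto
    next
      assume "x \<in> ?S" then show "?\<psi> x = \<one>\<^bsub>H\<^esub>" using ker[OF x] by blast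
    qed
    then show "\<exists>\<psi>\<in>hom ?G H. \<psi> ` carrier ?G = carrier H \<and> (\<forall>x\<in>carrier ?G. \<psi> x = \<one>\<^bsub>H\<^esub> \<longleftrightarrow> x \<in> ?S)"
      unfolding carG using hom im\<psi> by blast
  qed
qed

end

section \<open>The Haar measure of a condition modulo \<open>p\<^sup>L\<close>\<close>

lemma space_borel_mat: "space (borel_mat n) = carrier_mat n n"
  by (simp add: borel_mat_def space_measure_of_conv)

lemma open_residue_eq: "open {x :: 'p :: prime_card padic_int. residue x k = r}"
proof -
  have "open ((\<lambda>f :: nat \<Rightarrow> int. f k) -` {r})"
    by (intro open_vimage continuous_on_product_coordinates Topological_Spaces.open_discrete)
  moreover have "{x :: 'p padic_int. residue x k = r} = residue -` ((\<lambda>f. f k) -` {r})" by auto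
  ultimately show ?thesis unfolding open_padic_int_def by blast
qed

lemma sets_borel_mat_residue:
  fixes r :: "nat \<Rightarrow> nat \<Rightarrow> int"
  shows "{B \<in> carrier_mat n n. \<forall>i<n. \<forall>j<n. residue (B $$ (i, j) :: 'p :: prime_card padic_int) k = r i j}
    \<in> sets (borel_mat n)"
proof -
  have "{B \<in> space (borel_mat n). residue (B $$ (i, j) :: 'p padic_int) k = r i j} \<in> sets (borel_mat n)"
    if "i < n" "j < n" for i j
  proof -
    have "{B \<in> carrier_mat n n. B $$ (i, j) \<in> {x :: 'p padic_int. residue x k = r i j}} \<in> sets (borel_mat n)"
      unfolding borel_mat_def using that open_residue_eq
      by (subst sets_measure_of) (blast intro: sigma_sets.Basic)+
    then show ?thesis by (simp add: space_borel_mat)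
  qed
  then have "{B \<in> space (borel_mat n). \<forall>x\<in>{..<n} \<times> {..<n}. residue (B $$ (fst x, snd x) :: 'p padic_int) k = r (fst x) (snd x)}
      \<in> sets (borel_mat n)"
    by (intro sets.sets_Collect_finite_All) auto
  also have "{B \<in> space (borel_mat n). \<forall>x\<in>{..<n} \<times> {..<n}. residue (B $$ (fst x, snd x) :: 'p padic_int) k = r (fst x) (snd x)}
    = {B \<in> carrier_mat n n. \<forall>i<n. \<forall>j<n. residue (B $$ (i, j)) k = r i j}"
    by (auto simp: space_borel_mat)
  finally show ?thesis .
qed

context padic_reduction
begin

lemma Homs_V_eqI:
  assumes f: "f \<in> Homs (V n) N" and g: "g \<in> Homs (V n) N" and eq: "\<And>i. i < n \<Longrightarrow> f (e i) = g (e i)"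
  shows "f = g"
proof (rule Homs_eqI[OF f g])
  fix v assume "v \<in> V n"
  then obtain c where c: "v = (\<Sum>i<n. c i \<star> e i)" unfolding V_def by blast
  have m: "c i \<star> e i \<in> V n" "e i \<in> V n" if "i < n" for i
    using e_mem_V[of i] V_mono[of "Suc i" n] that V_scale by auto
  have "h (\<Sum>i<k. c i \<star> e i) = (\<Sum>i<k. c i \<star> h (e i))" if h: "h \<in> Homs (V n) N" and "k \<le> n" for h k
    using \<open>k \<le> n\<close>
  proof (induction k)
    case 0 then show ?case using Homs_0[OF h subspace_V] by simp
  next
    case (Suc k)
    have "(\<Sum>i<k. c i \<star> e i) \<in> V n" using m Suc.prems by (intro subspace_sum[OF subspace_V]) auto
    then show ?case
      using Suc Homs_add[OF h _ m(1)[of k]] Homs_scale[OF h subspace_V m(2)[of k]] by simp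
  qed
  from this[OF f, of n] this[OF g, of n] show "f v = g v" unfolding c using eq by simp
qed

lemma red_unit:
  assumes j: "j < n" shows "red n (unit_vec n j) = e j"
proof -
  have "q > 1" using p_gt_1 L_pos by (simp add: one_less_power)
  then have "residue (1 :: 'p padic_int) L = 1"
    using residue_of_nat[of 1 L, where 'p = 'p] by (simp add: p_def)
  then have "residue (unit_vec n j $ i :: 'p padic_int) L \<star> e i = (if i = j then e i else 0)" if "i < n" for i
    using that j by (simp add: residue_zero unit_vec_def)
  then have "red n (unit_vec n j) = (\<Sum>i<n. if i = j then e i else 0)" unfolding red_def by simp
  then show ?thesis using j by simp
qed

text \<open>The j-th column of the matrix is any lift of f (e j).\<close>

lemma act_surj: "act n ` carrier_mat n n = End n"
proof (intro equalityI subsetI)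
  fix f assume f: "f \<in> End n"
  have "\<exists>x. x \<in> carrier_vec n \<and> red n x = f (e j)" if "j < n" for j
  proof -
    have "e j \<in> V n" using e_mem_V[of j] V_mono[of "Suc j" n] that by auto
    then have "f (e j) \<in> V n" by (rule Homs_mem[OF f])
    then show ?thesis by (metis V_redE)
  qed
  then obtain x where x: "\<And>j. j < n \<Longrightarrow> x j \<in> carrier_vec n" "\<And>j. j < n \<Longrightarrow> red n (x j) = f (e j)" by metis
  let ?B = "Matrix.mat n n (\<lambda>(i, j). x j $ i)"
  have B: "?B \<in> carrier_mat n n" by simp
  have "act n ?B = f"
  proof (rule Homs_V_eqI[OF act_Homs[OF B] f])
    fix j assume j: "j < n"
    have "act n ?B (e j) = red n (?B *\<^sub>v unit_vec n j)"
      unfolding red_unit[OF j, symmetric] by (rule act_red[OF B]) simp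
    also have "?B *\<^sub>v unit_vec n j = x j"
      using j x(1)[OF j] by (intro eq_vecI) auto
    finally show "act n ?B (e j) = f (e j)" using x(2)[OF j] by simp
  qed
  then show "f \<in> act n ` carrier_mat n n" using B by blast
qed (use act_Homs in auto)

lemma sets_act:
  assumes "f \<in> End n"
  shows "{B \<in> carrier_mat n n. act n B = f} \<in> sets (borel_mat n)"
proof -
  obtain B0 where B0: "B0 \<in> carrier_mat n n" "f = act n B0" using assms act_surj by blast
  have "{B \<in> carrier_mat n n. act n B = f} =
      {B \<in> carrier_mat n n. \<forall>i<n. \<forall>j<n. residue (B $$ (i, j)) L = residue (B0 $$ (i, j)) L}"
    unfolding B0(2) by (intro Collect_cong conj_cong refl act_eq_iff[OF _ B0(1)])
  then show ?thesis using sets_borel_mat_residue by (simp only:)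
qed

text \<open>The fibres are translates of each other: adding C - B carries the matrices that act like
  B to those that act like C.\<close>

lemma measure_act_fibre:
  assumes \<mu>: "haar_mat n \<mu>" and f: "f \<in> End n" and g: "g \<in> End n"
  shows "emeasure \<mu> {B \<in> carrier_mat n n. act n B = f} = emeasure \<mu> {B \<in> carrier_mat n n. act n B = g}"
proof -
  obtain B where B: "B \<in> carrier_mat n n" "f = act n B" using f act_surj by blast
  obtain C where C: "C \<in> carrier_mat n n" "g = act n C" using g act_surj by blast
  let ?D = "C - B"
  have D: "?D \<in> carrier_mat n n" by (rule minus_carrier_mat[OF B(1)])
  have iff: "act n (?D + Z) = g \<longleftrightarrow> act n Z = f" if Z: "Z \<in> carrier_mat n n" for Z
  proof -
    have DX: "?D + Z \<in> carrier_mat n n" using D Z by simp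
    have "residue ((?D + Z) $$ (i, j)) L = residue (C $$ (i, j)) L \<longleftrightarrow> residue (Z $$ (i, j)) L = residue (B $$ (i, j)) L"
      if "i < n" "j < n" for i j
      using that B C Z unfolding residue_eq_iff by (simp add: algebra_simps)
    then show ?thesis unfolding B(2) C(2) act_eq_iff[OF DX C(1)] act_eq_iff[OF Z B(1)] by blast
  qed
  have translate: "(\<lambda>Z. ?D + Z) ` {B \<in> carrier_mat n n. act n B = f} = {B \<in> carrier_mat n n. act n B = g}"
  proof (intro equalityI subsetI)
    fix Y assume Y: "Y \<in> {B \<in> carrier_mat n n. act n B = g}"
    then have "Y = ?D + (Y - ?D)" using B(1) C(1) by (intro eq_matI) auto
    moreover have "Y - ?D \<in> carrier_mat n n" by (rule minus_carrier_mat[OF D])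
    ultimately show "Y \<in> (\<lambda>Z. ?D + Z) ` {B \<in> carrier_mat n n. act n B = f}"
      using iff[of "Y - ?D"] Y by (intro image_eqI[of _ _ "Y - ?D"]) auto
  qed (use iff D in auto)
  have meas: "{B \<in> carrier_mat n n. act n B = f} \<in> sets \<mu>"
    using sets_act[OF f] \<mu> by (simp add: haar_mat_def)
  have "emeasure \<mu> ((\<lambda>Z. ?D + Z) ` S) = emeasure \<mu> S" if "S \<in> sets \<mu>" for S
    using \<mu> D that unfolding haar_mat_def by blast
  from this[OF meas] show ?thesis unfolding translate by (rule sym)
qed

text \<open>Finitely many fibres of equal measure partition the space, so each has measure 1 / |End
  V_n|.\<close>

lemma measure_act:
  assumes \<mu>: "haar_mat n \<mu>" and F: "F \<subseteq> End n"
  shows "{B \<in> carrier_mat n n. act n B \<in> F} \<in> sets (borel_mat n)"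
    and "Sigma_Algebra.measure \<mu> {B \<in> carrier_mat n n. act n B \<in> F} = real (card F) / real (card (End n))"
proof -
  let ?C = "\<lambda>f. {B \<in> carrier_mat n n. act n B = f}" and ?E = "End n"
  interpret prob_space \<mu> using \<mu> by (simp add: haar_mat_def)
  have sets: "sets \<mu> = sets (borel_mat n)" using \<mu> by (simp add: haar_mat_def)
  have space: "space \<mu> = carrier_mat n n" using sets_eq_imp_space_eq[OF sets] by (simp add: space_borel_mat)
  have fin: "finite ?E" by (intro finite_Homs finite_V)
  have C: "?C f \<in> sets (borel_mat n)" if "f \<in> ?E" for f using sets_act[OF that] .
  have zero: "(\<lambda>_. 0) \<in> ?E" using V_zero by (intro HomsI) auto
  define c where "c = Sigma_Algebra.measure \<mu> (?C (\<lambda>_. 0))"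
  have c: "Sigma_Algebra.measure \<mu> (?C f) = c" if "f \<in> ?E" for f
    unfolding c_def Sigma_Algebra.measure_def using measure_act_fibre[OF \<mu> that zero] by simp
  have un: "{B \<in> carrier_mat n n. act n B \<in> G} = (\<Union>f\<in>G. ?C f)" for G by auto
  have meas: "Sigma_Algebra.measure \<mu> {B \<in> carrier_mat n n. act n B \<in> G} = real (card G) * c" if "G \<subseteq> ?E" for G
  proof -
    have "Sigma_Algebra.measure \<mu> (\<Union>f\<in>G. ?C f) = (\<Sum>f\<in>G. Sigma_Algebra.measure \<mu> (?C f))"
      using that C fin sets by (intro finite_measure_finite_Union) (auto simp: disjoint_family_on_def finite_subset)
    also have "\<dots> = real (card G) * c" using c that by (simp add: subset_iff)
    finally show ?thesis unfolding un .
  qed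
  show "{B \<in> carrier_mat n n. act n B \<in> F} \<in> sets (borel_mat n)"
    unfolding un using C F finite_subset[OF F fin] by (intro sets.finite_UN) auto
  have "{B \<in> carrier_mat n n. act n B \<in> ?E} = space \<mu>" using act_Homs space by auto
  then have "real (card ?E) * c = 1" using meas[OF subset_refl] prob_space by simp
  moreover have "real (card ?E) > 0" using fin zero card_gt_0_iff by auto
  ultimately have "c = 1 / real (card ?E)" by (simp add: field_simps)
  then show "Sigma_Algebra.measure \<mu> {B \<in> carrier_mat n n. act n B \<in> F} = real (card F) / real (card ?E)"
    using meas[OF F] by simp
qed

end

theorem theorem4p1:
  fixes M :: "nat \<Rightarrow> 'w measure"
    and A :: "nat \<Rightarrow> 'w \<Rightarrow> 'p :: prime_card padic_int mat"
    and m :: nat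
    and y :: "nat \<Rightarrow> 'p padic_int"
    and H :: "nat \<Rightarrow> 'h monoid"
  assumes "\<And>n. n \<ge> 1 \<Longrightarrow> haar_random_matrix (M n) n (A n)"
    and "inj_on y {1..m}"
    and "\<And>i. i \<in> {1..m} \<Longrightarrow> finite_abelian_p_group CARD('p) (H i)"
  shows "convergent (\<lambda>n. \<P>(\<omega> in M n. \<forall>i \<in> {1..m}. cok (A n \<omega> + y i \<cdot>\<^sub>m 1\<^sub>m n) \<cong> H i))"
proof -
  have H: "group (H i)" if "i \<in> {1..m}" for i
    using assms(3)[OF that] by (simp add: finite_abelian_p_group_def comm_group_def)
  obtain k where k: "\<And>i. i \<in> {1..m} \<Longrightarrow> Coset.order (H i) = CARD('p) ^ k i"
    using assms(3) unfolding finite_abelian_p_group_def by metis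
  \<comment> \<open>The sum bounds every exponent k i, so that p^(L-1) kills every H i; the
    successor makes L positive and provides the spare factor p.\<close>
  define L where "L = Suc (\<Sum>i\<in>{1..m}. k i)"
  have kill: "h [^]\<^bsub>H i\<^esub> (CARD('p) ^ (L - 1)) = \<one>\<^bsub>H i\<^esub>" if i: "i \<in> {1..m}" and h: "h \<in> carrier (H i)" for i h
  proof -
    interpret group "H i" by (rule H[OF i])
    have "k i \<le> L - 1" unfolding L_def using i by (simp add: member_le_sum)
    then have "k i + (L - 1 - k i) = L - 1" by (rule le_add_diff_inverse)
    then have "CARD('p) ^ (L - 1) = CARD('p) ^ k i * CARD('p) ^ (L - 1 - k i)"
      by (metis power_add)
    then have "h [^]\<^bsub>H i\<^esub> (CARD('p) ^ (L - 1)) = (h [^]\<^bsub>H i\<^esub> Coset.order (H i)) [^]\<^bsub>H i\<^esub> (CARD('p) ^ (L - 1 - k i))"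
      using h k[OF i] by (simp add: nat_pow_pow)
    then show ?thesis using pow_order_eq_1[OF h] by simp
  qed
  interpret torsion_basis torus_scale "CARD('p)" L "torus_unit (CARD('p) ^ L)"
    by (rule torsion_basis_torus) (auto simp: prime_card L_def)
  interpret padic_reduction torus_scale "CARD('p)" L "torus_unit (CARD('p) ^ L)" "TYPE('p)"
    by unfold_locales simp
  \<comment> \<open>By \<open>act_shift\<close>, adding the scalar matrix of y i becomes the shift
    by this residue on V_n.\<close>
  define Y where "Y i = residue (y i) L" for i
  define F where "F n = {f \<in> End n. \<forall>i\<in>{1..m}. has_cok (V n) (shift (V n) (Y i) f) (H i)}" for n
  have "\<P>(\<omega> in M n. \<forall>i \<in> {1..m}. cok (A n \<omega> + y i \<cdot>\<^sub>m 1\<^sub>m n) \<cong> H i) =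
      real (card (F n)) / real (card (End n))" if n: "n \<ge> 1" for n
  proof -
    have A: "A n \<in> measurable (M n) (borel_mat n)" and \<mu>: "haar_mat n (distr (M n) (borel_mat n) (A n))"
      using assms(1)[OF n] by (auto simp: haar_random_matrix_def)
    have mem: "A n \<omega> \<in> carrier_mat n n" if "\<omega> \<in> space (M n)" for \<omega>
      using measurable_space[OF A that] by (simp add: space_borel_mat)
    have "(\<forall>i \<in> {1..m}. cok (A n \<omega> + y i \<cdot>\<^sub>m 1\<^sub>m n) \<cong> H i) \<longleftrightarrow> act n (A n \<omega>) \<in> F n"
      if \<omega>: "\<omega> \<in> space (M n)" for \<omega>
    proof -
      have "cok (A n \<omega> + y i \<cdot>\<^sub>m 1\<^sub>m n) \<cong> H i \<longleftrightarrow> has_cok (V n) (shift (V n) (Y i) (act n (A n \<omega>))) (H i)"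
        if i: "i \<in> {1..m}" for i
        using cok_iso_iff[OF _ H[OF i] kill[OF i], of "A n \<omega> + y i \<cdot>\<^sub>m 1\<^sub>m n" n] mem[OF \<omega>]
        by (simp add: act_shift Y_def)
      then show ?thesis using act_Homs[OF mem[OF \<omega>]] by (simp add: F_def)
    qed
    then have "{\<omega> \<in> space (M n). \<forall>i \<in> {1..m}. cok (A n \<omega> + y i \<cdot>\<^sub>m 1\<^sub>m n) \<cong> H i} =
        A n -` {B \<in> carrier_mat n n. act n B \<in> F n} \<inter> space (M n)"
      using mem by auto
    moreover have "F n \<subseteq> End n" by (auto simp: F_def)
    ultimately show ?thesis
      using measure_act[OF \<mu>, of "F n"] measure_distr[OF A, of "{B \<in> carrier_mat n n. act n B \<in> F n}"]
      by simp
  qed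
  \<comment> \<open>The matrices are Haar distributed for n >= 1, so the two sequences are compared
    from n = 1 on.\<close>
  then have "eventually (\<lambda>n. \<P>(\<omega> in M n. \<forall>i \<in> {1..m}. cok (A n \<omega> + y i \<cdot>\<^sub>m 1\<^sub>m n) \<cong> H i) =
      real (card (F n)) / real (card (End n))) sequentially"
    unfolding eventually_sequentially by blast
  moreover have "convergent (\<lambda>n. real (card (F n)) / real (card (End n)))"
    unfolding F_def by (rule convergent_proportion) (use H in auto)
  ultimately show ?thesis using convergent_cong by fast
qed

end
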